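(* Let $q\in[0,1]$, and let $\alpha\in(0,1]$ and $\beta\in(0,1)$ be constants. For each $n$ let $m=\alpha n$ and $k=\beta n$ (rounded to integers), and let $A$ be an $m\times n$ random matrix with i.i.d. standard normal entries. Set $c_\nu=\sqrt{2}\,\mathrm{erfinv}(1-\beta)$ (so that $P(|h|\ge c_\nu)=\beta$ for $h$ standard normal). Let $h$ be a standard normal random variable and for $\nu\ge0,\gamma\ge0$ define \[ I^{(1)}_{str}(\nu,\gamma)=\mathbb{E}\Big[\mathbf{1}_{\{|h|\ge c_\nu\}}\max_{w\in\mathbb{R}}\big(|h||w|+\nu|w|^q-\gamma w^2\big)\Big],\qquad I^{(2)}_{str}(\nu,\gamma)=\mathbb{E}\Big[\mathbf{1}_{\{|h|\le c_\nu\}}\max_{w\in\mathbb{R}}\big(|h||w|-\nu|w|^q-\gamma w^2\big)\Big]. \] Suppose \[ \min_{\gamma\ge0,\ \nu\ge0}\Big(I^{(1)}_{str}(\nu,\gamma)+I^{(2)}_{str}(\nu,\gamma)+\gamma\Big)<\sqrt{\alpha}. \] Then with overwhelming probability the following holds: for every $k$-sparse vector $\tilde x\in\mathbb{R}^n$ (at most $k$ nonzero entries), setting $y=A\tilde x$, the (unique) solution of $\min\{\|x\|_q^q : Ax=y\}$ is $\tilde x$.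
   Context: For $q\in(0,1]$, $\|x\|_q^q=\sum_i|x_i|^q$; for $q=0$ one uses the convention $|t|^0=1$ if $t\neq0$ and $0^0=0$. "With overwhelming probability" means with probability at least $1-\epsilon_n$, where $\epsilon_n$ decays exponentially in $n$ as $n\to\infty$. *)

theory Defs
  imports "HOL-Probability.Probability"
begin

definition std_normal :: "real measure" where
  "std_normal = density lborel (\<lambda>x. ennreal (std_normal_density x))"

definition qpow :: "real \<Rightarrow> real \<Rightarrow> real" where
  "qpow q t = (if q = 0 then (if t = 0 then 0 else 1) else \<bar>t\<bar> powr q)"

definition lq_q :: "real \<Rightarrow> nat \<Rightarrow> (nat \<Rightarrow> real) \<Rightarrow> real" where
  "lq_q q n x = (\<Sum>j<n. qpow q (x j))"

(* c_nu = sqrt 2 * erfinv(1 - beta): the unique c \<ge> 0 with P(|h| \<ge> c) = beta *)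
definition c_nu :: "real \<Rightarrow> real" where
  "c_nu \<beta> = (THE c. c \<ge> 0 \<and> measure std_normal {h. \<bar>h\<bar> \<ge> c} = \<beta>)"

(* max over w of the inner objectives; these are \<ge> 0 (take w = 0), and may be +\<infinity> *)
definition I1_str :: "real \<Rightarrow> real \<Rightarrow> real \<Rightarrow> real \<Rightarrow> ennreal" where
  "I1_str q \<beta> \<nu> \<gamma> = (\<integral>\<^sup>+ h. indicator {h. \<bar>h\<bar> \<ge> c_nu \<beta>} h *
      (SUP w::real. ennreal (\<bar>h\<bar> * \<bar>w\<bar> + \<nu> * qpow q w - \<gamma> * w\<^sup>2)) \<partial>std_normal)"

definition I2_str :: "real \<Rightarrow> real \<Rightarrow> real \<Rightarrow> real \<Rightarrow> ennreal" where
  "I2_str q \<beta> \<nu> \<gamma> = (\<integral>\<^sup>+ h. indicator {h. \<bar>h\<bar> \<le> c_nu \<beta>} h *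
      (SUP w::real. ennreal (\<bar>h\<bar> * \<bar>w\<bar> - \<nu> * qpow q w - \<gamma> * w\<^sup>2)) \<partial>std_normal)"

definition gauss_matrix :: "nat \<Rightarrow> nat \<Rightarrow> (nat \<times> nat \<Rightarrow> real) measure" where
  "gauss_matrix m n = PiM ({0..<m} \<times> {0..<n}) (\<lambda>_. std_normal)"

definition mat_vec :: "nat \<Rightarrow> (nat \<times> nat \<Rightarrow> real) \<Rightarrow> (nat \<Rightarrow> real) \<Rightarrow> nat \<Rightarrow> real" where
  "mat_vec n A x i = (\<Sum>j<n. A (i, j) * x j)"

definition sparse :: "nat \<Rightarrow> nat \<Rightarrow> (nat \<Rightarrow> real) \<Rightarrow> bool" where
  "sparse n k x \<longleftrightarrow> card {j\<in>{0..<n}. x j \<noteq> 0} \<le> k"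

definition strong_recovery :: "real \<Rightarrow> nat \<Rightarrow> nat \<Rightarrow> nat \<Rightarrow> (nat \<times> nat \<Rightarrow> real) \<Rightarrow> bool" where
  "strong_recovery q m n k A \<longleftrightarrow>
     (\<forall>xt. sparse n k xt \<longrightarrow>
        (\<forall>x. (\<forall>i<m. mat_vec n A x i = mat_vec n A xt i) \<and> (\<exists>j<n. x j \<noteq> xt j)
             \<longrightarrow> lq_q q n xt < lq_q q n x))"

end

theory Submission
  imports Defs
begin

text \<open>If recovery fails, the kernel of \<open>A\<close> meets the set \<open>S\<close> of unit vectors \<open>w\<close> for which some
  \<open>k\<close> coordinates carry at least half of \<open>\<parallel>w\<parallel>\<^sub>q\<^sup>q\<close>. This is Gordon's escape through a mesh: for a
  finite set of unit vectors, the probability that \<open>A w\<close> is small for some \<open>w\<close> is at most a constant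
  times the probability that \<open>\<parallel>g\<parallel>\<close> is smaller than the supremum of \<open>- \<langle>h, w\<rangle>\<close>, with \<open>g\<close>, \<open>h\<close>
  standard Gaussian vectors; a net of \<open>S\<close> reduces the problem to finite sets.

  The comparison is proved by replacing one Gaussian process by the other in many small steps. Gaussian
  smearing operators form commuting semigroups, so it suffices to compare a single step up to an error of
  third order, and there only the covariances matter. The test function is
  \<open>exp (- \<Sum>w. \<psi> (sqrt (1 + \<parallel>A w + g\<parallel>\<^sup>2) + g\<^sub>0 + \<langle>h, w\<rangle>))\<close>, where \<open>\<psi>\<close> is decreasing and vanishes on
  the nonnegative reals. All Gaussians are entries of one \<open>(m + 1) \<times> (n + 1)\<close> matrix: \<open>A\<close> is the
  upper left block, \<open>g\<close> the last column, \<open>h\<close> the last row and \<open>g\<^sub>0\<close> the corner.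

  On \<open>S\<close>, Lagrange multipliers \<open>\<nu>\<close> and \<open>\<gamma>\<close> bound \<open>\<langle>h, w\<rangle>\<close> by a sum over the coordinates of one of two
  inner maxima, depending on whether the coordinate belongs to the large part. The difference of these
  maxima increases with \<open>\<bar>h\<^sub>i\<bar>\<close>, so comparison with its value at \<open>c\<^sub>\<nu>\<close> bounds the sum, uniformly over all
  choices of the large part, by a sum of i.i.d. variables. Chernoff bounds for it and for
  \<open>\<parallel>g\<parallel>\<^sup>2\<close> finish the proof.\<close>

section \<open>Gaussian product measures and smearing\<close>

lemma prob_space_std_normal: "prob_space std_normal"
  unfolding std_normal_def by (rule prob_space_normal_density) simp

interpretation std_normal: prob_space std_normal
  by (rule prob_space_std_normal)

lemma sets_std_normal [simp, measurable_cong]: "sets std_normal = sets borel"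
  by (simp add: std_normal_def)

lemma space_std_normal [simp]: "space std_normal = UNIV"
  by (simp add: std_normal_def)

lemma char_scaled_std_normal:
  "(CLINT x|std_normal. iexp (t * (b * x))) = of_real (exp (- ((t * b)\<^sup>2) / 2))"
  using fun_cong[OF char_std_normal_distribution, of "t * b"]
  by (simp add: char_def std_normal_def mult.assoc)

text \<open>The characteristic function of either side at \<open>t\<close> is
  \<open>exp (- t\<^sup>2 * (b\<^sup>2 + c\<^sup>2) / 2)\<close>, so Levy uniqueness applies,
  degenerate coefficients included.\<close>

lemma distr_std_normal_add:
  "distr (std_normal \<Otimes>\<^sub>M std_normal) borel (\<lambda>z. b * fst z + c * snd z) =
    distr std_normal borel (\<lambda>x. sqrt (b\<^sup>2 + c\<^sup>2) * x)" (is "?L = ?R")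
proof (rule Levy_uniqueness)
  interpret P: pair_prob_space std_normal std_normal ..
  show "real_distribution ?L"
    by (intro real_distribution.intro P.P.prob_space_distr real_distribution_axioms.intro) auto
  show "real_distribution ?R"
    by (intro real_distribution.intro std_normal.prob_space_distr
        real_distribution_axioms.intro) auto
  show "char ?L = char ?R"
  proof
    fix t
    have "char ?L t = (CLINT z|(std_normal \<Otimes>\<^sub>M std_normal). iexp (t * (b * fst z)) * iexp (t * (c * snd z)))"
      by (simp add: char_def integral_distr distrib_left exp_add[symmetric])
    also have "\<dots> = (CLINT x|std_normal. CLINT y|std_normal. iexp (t * (b * x)) * iexp (t * (c * y)))"
      by (subst P.integral_fst'[symmetric])
         (auto intro!: P.P.integrable_const_bound[where B=1] simp: norm_mult)
    also have "\<dots> = of_real (exp (- ((t * b)\<^sup>2) / 2)) * of_real (exp (- ((t * c)\<^sup>2) / 2))"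
      unfolding char_scaled_std_normal[symmetric] by simp
    also have "\<dots> = of_real (exp (- ((t * sqrt (b\<^sup>2 + c\<^sup>2))\<^sup>2) / 2))"
      by (simp add: of_real_mult[symmetric] exp_add[symmetric] power_mult_distrib field_simps
          del: of_real_mult)
    also have "\<dots> = char ?R t"
      unfolding char_scaled_std_normal[symmetric] by (simp add: char_def integral_distr)
    finally show "char ?L t = char ?R t" .
  qed
qed

text \<open>The product runs over the whole index type, so every function is a point of the space;
  finite matrices are recovered by restriction through \<open>distr_gauss_restrict\<close>.\<close>

definition gauss :: "('i \<Rightarrow> real) measure" where
  "gauss = PiM UNIV (\<lambda>_. std_normal)"

lemma sets_gauss [simp, measurable_cong]: "sets gauss = sets (PiM UNIV (\<lambda>_. borel))"
  unfolding gauss_def by (intro sets_PiM_cong) auto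

lemma space_gauss [simp]: "space gauss = UNIV"
  by (simp add: gauss_def space_PiM PiE_UNIV_domain)

lemma product_prob_space_std_normal: "product_prob_space (\<lambda>_. std_normal)"
  by unfold_locales

interpretation gauss: prob_space gauss
  unfolding gauss_def by (intro prob_space_PiM prob_space_std_normal)

lemma measure_gauss_UNIV [simp]: "measure gauss UNIV = 1"
  using gauss.prob_space by simp

lemma emeasure_gauss_Collect:
  assumes "finite J" "\<And>i. i \<in> J \<Longrightarrow> X i \<in> sets borel"
  shows "emeasure gauss {x. \<forall>i\<in>J. x i \<in> X i} = (\<Prod>i\<in>J. emeasure std_normal (X i))"
proof -
  interpret product_prob_space "\<lambda>_. std_normal" UNIV by (rule product_prob_space_std_normal)
  show ?thesis
    using emeasure_PiM_Collect[of J X] assms by (simp add: gauss_def[symmetric])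
qed

lemma distr_gauss_restrict:
  assumes "finite J"
  shows "distr gauss (PiM J (\<lambda>_. std_normal)) (\<lambda>x. restrict x J) = PiM J (\<lambda>_. std_normal)"
proof -
  interpret product_prob_space "\<lambda>_. std_normal" UNIV by (rule product_prob_space_std_normal)
  show ?thesis
    using distr_PiM_restrict_finite[of J] assms by (simp add: gauss_def[symmetric])
qed

lemma nn_integral_gauss_prod:
  assumes "finite J" "\<And>i. i \<in> J \<Longrightarrow> f i \<in> borel_measurable borel"
  shows "(\<integral>\<^sup>+x. (\<Prod>i\<in>J. f i (x i)) \<partial>gauss) = (\<Prod>i\<in>J. \<integral>\<^sup>+x. f i x \<partial>std_normal)"
proof -
  interpret product_sigma_finite "\<lambda>_. std_normal" by unfold_locales
  have [measurable]: "(\<lambda>x. \<Prod>i\<in>J. f i (x i)) \<in> borel_measurable (PiM J (\<lambda>_. std_normal))"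
    using assms(2) by (intro borel_measurable_prod_ennreal) (auto intro!: measurable_compose[OF measurable_component_singleton])
  have "(\<integral>\<^sup>+x. (\<Prod>i\<in>J. f i (x i)) \<partial>gauss) = (\<integral>\<^sup>+x. (\<Prod>i\<in>J. f i (restrict x J i)) \<partial>gauss)"
    by (intro nn_integral_cong prod.cong) auto
  also have "\<dots> = (\<integral>\<^sup>+x. (\<Prod>i\<in>J. f i (x i)) \<partial>distr gauss (PiM J (\<lambda>_. std_normal)) (\<lambda>x. restrict x J))"
    by (subst nn_integral_distr) (auto intro!: measurable_restrict simp: measurable_cong_sets[OF sets_gauss refl])
  also have "\<dots> = (\<Prod>i\<in>J. \<integral>\<^sup>+x. f i x \<partial>std_normal)"
    unfolding distr_gauss_restrict[OF assms(1)]
    using assms by (intro product_nn_integral_prod) auto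
  finally show ?thesis .
qed

text \<open>Both measures are compared on finite cylinders, where Fubini and independence of the
  coordinates reduce the claim to \<open>distr_std_normal_add\<close> in each coordinate.\<close>

lemma distr_gauss_add:
  fixes b c :: "'i \<Rightarrow> real"
  shows "distr (gauss \<Otimes>\<^sub>M gauss) (PiM UNIV (\<lambda>_. borel)) (\<lambda>z i. b i * fst z i + c i * snd z i) =
    distr gauss (PiM UNIV (\<lambda>_. borel)) (\<lambda>x i. sqrt ((b i)\<^sup>2 + (c i)\<^sup>2) * x i)" (is "distr ?P ?B ?f = distr _ _ ?g")
proof -
  interpret P: pair_prob_space "gauss :: ('i \<Rightarrow> real) measure" gauss ..
  interpret Q: pair_prob_space std_normal std_normal ..
  have f[measurable]: "?f \<in> measurable ?P ?B" and g[measurable]: "?g \<in> measurable gauss ?B"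
    by (rule measurable_PiM_single', auto)+
  show ?thesis
  proof (rule measure_eqI_PiM_infinite)
    show "finite_measure (distr ?P ?B ?f)"
      by (rule prob_space.finite_measure[OF P.P.prob_space_distr[OF f]])
    fix A :: "'i \<Rightarrow> real set" and J :: "'i set"
    assume J: "finite J" and "J \<subseteq> UNIV" and A: "\<And>i. i \<in> J \<Longrightarrow> A i \<in> sets borel"
    let ?X = "prod_emb UNIV (\<lambda>_. borel) J (Pi\<^sub>E J A)"
    have X: "?X = {x. \<forall>i\<in>J. x i \<in> A i}"
      by (auto simp: prod_emb_def PiE_iff)
    have [measurable]: "?X \<in> sets ?B"
      by (rule sets_PiM_I) (use J A in auto)
    then have Xm[measurable]: "{x. \<forall>i\<in>J. x i \<in> A i} \<in> sets ?B"
      unfolding X .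
    have "emeasure (distr ?P ?B ?f) ?X = emeasure ?P {z. \<forall>i\<in>J. b i * fst z i + c i * snd z i \<in> A i}"
      by (subst emeasure_distr) (auto simp: X space_pair_measure intro!: arg_cong[where f="emeasure _"])
    also have "\<dots> = (\<integral>\<^sup>+x. emeasure gauss {y. \<forall>i\<in>J. y i \<in> {t. b i * x i + c i * t \<in> A i}} \<partial>gauss)"
    proof -
      have "{z. \<forall>i\<in>J. b i * fst z i + c i * snd z i \<in> A i} = ?f -` ?X \<inter> space ?P"
        by (auto simp: X space_pair_measure)
      also have "\<dots> \<in> sets ?P" by measurable
      finally show ?thesis
        by (subst gauss.emeasure_pair_measure_alt) (auto intro!: nn_integral_cong arg_cong[where f="emeasure _"])
    qed
    also have "\<dots> = (\<integral>\<^sup>+x. (\<Prod>i\<in>J. emeasure std_normal {t. b i * x i + c i * t \<in> A i}) \<partial>gauss)"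
    proof (intro nn_integral_cong emeasure_gauss_Collect J)
      fix x :: "'i \<Rightarrow> real" and i assume "i \<in> J"
      from A[OF this] show "{t. b i * x i + c i * t \<in> A i} \<in> sets borel" by measurable
    qed
    also have "\<dots> = (\<Prod>i\<in>J. \<integral>\<^sup>+x. emeasure std_normal {t. b i * x + c i * t \<in> A i} \<partial>std_normal)"
    proof (intro nn_integral_gauss_prod[where f="\<lambda>i x. emeasure std_normal {t. b i * x + c i * t \<in> A i}"] J)
      fix i assume i: "i \<in> J"
      have "(\<lambda>z. b i * fst z + c i * snd z) -` A i \<inter> space (borel \<Otimes>\<^sub>M std_normal) \<in> sets (borel \<Otimes>\<^sub>M std_normal)"
        using A[OF i] by measurable
      from std_normal.measurable_emeasure_Pair[OF this]
      show "(\<lambda>x. emeasure std_normal {t. b i * x + c i * t \<in> A i}) \<in> borel_measurable borel"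
        by (simp add: space_pair_measure vimage_def)
    qed
    also have "\<dots> = (\<Prod>i\<in>J. emeasure std_normal {t. sqrt ((b i)\<^sup>2 + (c i)\<^sup>2) * t \<in> A i})"
    proof (intro prod.cong refl)
      fix i assume i: "i \<in> J"
      have S: "(\<lambda>z. b i * fst z + c i * snd z) -` A i \<inter> space (std_normal \<Otimes>\<^sub>M std_normal) \<in> sets (std_normal \<Otimes>\<^sub>M std_normal)"
        using A[OF i] by measurable
      have "(\<integral>\<^sup>+x. emeasure std_normal {t. b i * x + c i * t \<in> A i} \<partial>std_normal)
          = emeasure (std_normal \<Otimes>\<^sub>M std_normal) ((\<lambda>z. b i * fst z + c i * snd z) -` A i \<inter> space (std_normal \<Otimes>\<^sub>M std_normal))"
        by (subst std_normal.emeasure_pair_measure_alt[OF S]) (simp add: space_pair_measure vimage_def)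
      also have "\<dots> = emeasure (distr std_normal borel (\<lambda>x. sqrt ((b i)\<^sup>2 + (c i)\<^sup>2) * x)) (A i)"
        unfolding distr_std_normal_add[symmetric] using A[OF i] by (subst emeasure_distr) auto
      also have "\<dots> = emeasure std_normal {t. sqrt ((b i)\<^sup>2 + (c i)\<^sup>2) * t \<in> A i}"
        using A[OF i] by (subst emeasure_distr) (auto simp: vimage_def)
      finally show "(\<integral>\<^sup>+x. emeasure std_normal {t. b i * x + c i * t \<in> A i} \<partial>std_normal) = \<dots>" .
    qed
    also have "\<dots> = emeasure gauss {x. \<forall>i\<in>J. x i \<in> {t. sqrt ((b i)\<^sup>2 + (c i)\<^sup>2) * t \<in> A i}}"
    proof (intro emeasure_gauss_Collect[symmetric] J)
      fix i assume "i \<in> J"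
      from A[OF this] show "{t. sqrt ((b i)\<^sup>2 + (c i)\<^sup>2) * t \<in> A i} \<in> sets borel" by measurable
    qed
    also have "\<dots> = emeasure (distr gauss ?B ?g) ?X"
      by (subst emeasure_distr) (auto simp: X vimage_def)
    finally show "emeasure (distr ?P ?B ?f) ?X = emeasure (distr gauss ?B ?g) ?X" .
  qed auto
qed

section \<open>Gaussian smearing operators and their semigroup law\<close>

definition smear :: "('i \<Rightarrow> real) \<Rightarrow> (('i \<Rightarrow> real) \<Rightarrow> real) \<Rightarrow> ('i \<Rightarrow> real) \<Rightarrow> real" where
  "smear b F M = (\<integral>x. F (\<lambda>i. M i + b i * x i) \<partial>gauss)"

definition bmeas :: "(('i \<Rightarrow> real) \<Rightarrow> real) \<Rightarrow> bool" where
  "bmeas F \<longleftrightarrow> F \<in> borel_measurable (PiM UNIV (\<lambda>_. borel)) \<and> (\<exists>B. \<forall>x. \<bar>F x\<bar> \<le> B)"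

lemma bmeas_shift_pair:
  assumes "bmeas F"
  shows "(\<lambda>z. F (\<lambda>i. fst z i + b i * snd z i)) \<in> borel_measurable (PiM UNIV (\<lambda>_. borel) \<Otimes>\<^sub>M gauss)"
proof -
  have "(\<lambda>z i. fst z i + b i * snd z i) \<in> measurable (PiM UNIV (\<lambda>_. borel) \<Otimes>\<^sub>M gauss) (PiM UNIV (\<lambda>_. borel))"
    by (rule measurable_PiM_single') auto
  with assms show ?thesis
    unfolding bmeas_def by (auto intro: measurable_compose)
qed

lemma bmeas_shift: 
  assumes "bmeas F"
  shows "integrable gauss (\<lambda>x. F (\<lambda>i. M i + b i * x i))"
proof -
  obtain B where B: "\<And>x. \<bar>F x\<bar> \<le> B" using assms unfolding bmeas_def by blast
  have "(\<lambda>x i. M i + b i * x i) \<in> measurable gauss (PiM UNIV (\<lambda>_. borel))"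
    by (rule measurable_PiM_single') auto
  then have "(\<lambda>x. F (\<lambda>i. M i + b i * x i)) \<in> borel_measurable gauss"
    using assms unfolding bmeas_def by (auto intro: measurable_compose)
  then show ?thesis
    using B by (intro gauss.integrable_const_bound[where B=B]) auto
qed

lemma bmeas_smear:
  assumes "bmeas F"
  shows "bmeas (smear b F)"
proof -
  obtain B where B: "\<And>x. \<bar>F x\<bar> \<le> B" using assms unfolding bmeas_def by blast
  have "smear b F \<in> borel_measurable (PiM UNIV (\<lambda>_. borel))"
    unfolding smear_def
    by (intro gauss.borel_measurable_lebesgue_integral)
       (simp add: split_beta' bmeas_shift_pair[OF assms])
  moreover have "\<bar>smear b F x\<bar> \<le> B" for x
  proof -
    have "-B \<le> F y" "F y \<le> B" for y using B[of y] by auto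
    then have "-B \<le> smear b F x" "smear b F x \<le> B"
      unfolding smear_def
      by (auto intro!: gauss.integral_ge_const gauss.integral_le_const bmeas_shift assms)
    then show ?thesis by auto
  qed
  ultimately show ?thesis unfolding bmeas_def by blast
qed

text \<open>Independent centred Gaussian noises add up to Gaussian noise with the sum of the
  variances. The result is symmetric in \<open>b\<close> and \<open>c\<close>, hence the operators
  commute.\<close>

lemma smear_smear:
  assumes "bmeas F"
  shows "smear b (smear c F) = smear (\<lambda>i. sqrt ((b i)\<^sup>2 + (c i)\<^sup>2)) F"
proof
  fix M :: "'a \<Rightarrow> real"
  interpret P: pair_prob_space "gauss :: ('a \<Rightarrow> real) measure" gauss ..
  obtain B where B: "\<And>x. \<bar>F x\<bar> \<le> B" using assms unfolding bmeas_def by blast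
  have F[measurable]: "F \<in> borel_measurable (PiM UNIV (\<lambda>_. borel))" using assms unfolding bmeas_def by blast
  have [measurable]: "(\<lambda>x i. M i + x i) \<in> measurable (PiM UNIV (\<lambda>_. borel)) (PiM UNIV (\<lambda>_. borel))"
    by (rule measurable_PiM_single') auto
  have f[measurable]: "(\<lambda>z i. b i * fst z i + c i * snd z i) \<in> measurable (gauss \<Otimes>\<^sub>M gauss) (PiM UNIV (\<lambda>_. borel))"
    and g[measurable]: "(\<lambda>x i. sqrt ((b i)\<^sup>2 + (c i)\<^sup>2) * x i) \<in> measurable gauss (PiM UNIV (\<lambda>_. borel))"
    by (rule measurable_PiM_single', auto)+
  have "smear b (smear c F) M = (\<integral>x. \<integral>y. F (\<lambda>i. M i + (b i * fst (x, y) i + c i * snd (x, y) i)) \<partial>gauss \<partial>gauss)"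
    by (simp add: smear_def add.assoc)
  also have "\<dots> = (\<integral>z. F (\<lambda>i. M i + (b i * fst z i + c i * snd z i)) \<partial>(gauss \<Otimes>\<^sub>M gauss))"
  proof (rule P.integral_fst')
    show "integrable (gauss \<Otimes>\<^sub>M gauss) (\<lambda>z. F (\<lambda>i. M i + (b i * fst z i + c i * snd z i)))"
      using B by (intro P.P.integrable_const_bound[where B=B]) (auto intro: measurable_compose[OF f])
  qed
  also have "\<dots> = (\<integral>x. F (\<lambda>i. M i + x i) \<partial>distr (gauss \<Otimes>\<^sub>M gauss) (PiM UNIV (\<lambda>_. borel)) (\<lambda>z i. b i * fst z i + c i * snd z i))"
    by (subst integral_distr) auto
  also have "\<dots> = (\<integral>x. F (\<lambda>i. M i + sqrt ((b i)\<^sup>2 + (c i)\<^sup>2) * x i) \<partial>gauss)"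
    unfolding distr_gauss_add by (subst integral_distr) auto
  finally show "smear b (smear c F) M = smear (\<lambda>i. sqrt ((b i)\<^sup>2 + (c i)\<^sup>2)) F M"
    by (simp add: smear_def)
qed

lemma smear_mono_diff:
  assumes "bmeas F" "bmeas G" "\<And>x. F x \<le> G x + e"
  shows "smear b F M \<le> smear b G M + e"
proof -
  have "smear b F M \<le> (\<integral>x. G (\<lambda>i. M i + b i * x i) + e \<partial>gauss)"
    unfolding smear_def
    using bmeas_shift[OF assms(1)] bmeas_shift[OF assms(2)] assms(3)
    by (intro integral_mono Bochner_Integration.integrable_add) auto
  also have "\<dots> = smear b G M + e"
    unfolding smear_def by (simp add: bmeas_shift assms)
  finally show ?thesis .
qed

lemma smear_commute: "bmeas F \<Longrightarrow> smear b (smear c F) = smear c (smear b F)"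
  by (simp add: smear_smear add.commute)

lemma smear_iterate:
  assumes "bmeas F" "\<And>i. 0 \<le> b i"
  shows "((smear b ^^ Suc n) F) = smear (\<lambda>i. sqrt (real (Suc n)) * b i) F \<and> bmeas ((smear b ^^ n) F)"
proof (induction n)
  case (Suc n)
  have "(smear b ^^ Suc (Suc n)) F = smear b ((smear b ^^ Suc n) F)" by simp
  also have "\<dots> = smear (\<lambda>i. sqrt ((b i)\<^sup>2 + (sqrt (real (Suc n)) * b i)\<^sup>2)) F"
    using Suc assms by (simp add: smear_smear)
  also have "(\<lambda>i. sqrt ((b i)\<^sup>2 + (sqrt (real (Suc n)) * b i)\<^sup>2)) = (\<lambda>i. sqrt (real (Suc (Suc n))) * b i)"
  proof
    fix i
    have "(b i)\<^sup>2 + (sqrt (real (Suc n)) * b i)\<^sup>2 = real (Suc (Suc n)) * (b i)\<^sup>2"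
      by (simp add: power_mult_distrib field_simps)
    then show "sqrt ((b i)\<^sup>2 + (sqrt (real (Suc n)) * b i)\<^sup>2) = sqrt (real (Suc (Suc n))) * b i"
      using assms(2)[of i] by (simp add: real_sqrt_mult)
  qed
  finally show ?case using Suc bmeas_smear[of "(smear b ^^ n) F" b] by simp
qed (use assms in simp)

text \<open>Lindeberg-style telescoping: the full smear is cut into \<open>N\<close> steps of scale
  \<open>1 / sqrt N\<close>, and exchanging all of them costs \<open>N * C / N powr (3/2)\<close>,
  which tends to 0. The local bound is uniform in \<open>M\<close> so that it survives further
  smearing.\<close>

lemma smear_compare:
  fixes b c :: "'i \<Rightarrow> real"
  assumes F: "bmeas F" and b: "\<And>i. 0 \<le> b i" and c: "\<And>i. 0 \<le> c i"
    and loc: "\<And>M t. 0 < t \<Longrightarrow> t \<le> 1 \<Longrightarrow>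
       smear (\<lambda>i. t * c i) F M \<le> smear (\<lambda>i. t * b i) F M + C * t ^ 3"
  shows "smear c F M \<le> smear b F M"
proof -
  have step: "smear c F M \<le> smear b F M + C / sqrt (real (Suc n))" for n
  proof -
    define t where "t = 1 / sqrt (real (Suc n))"
    have t: "0 < t" "t \<le> 1" by (auto simp: t_def)
    let ?b = "\<lambda>i. t * b i" and ?c = "\<lambda>i. t * c i"
    have bm: "bmeas ((smear ?b ^^ k) F)" "bmeas ((smear ?c ^^ k) F)" for k
      using smear_iterate[OF F, of ?b k] smear_iterate[OF F, of ?c k] b c t by auto
    have com: "smear ?c ((smear ?b ^^ k) F) = (smear ?b ^^ k) (smear ?c F)" for k
    proof (induction k)
      case (Suc k)
      then show ?case using smear_commute[OF bm(1)[of k], of ?c ?b] by simp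
    qed simp
    have mon: "(smear ?b ^^ k) G M \<le> (smear ?b ^^ k) H M + e"
      if "bmeas G" "bmeas H" "\<And>x. G x \<le> H x + e" for k G H M e
      using that
    proof (induction k arbitrary: M)
      case (Suc k)
      have "bmeas ((smear ?b ^^ k) G)" "bmeas ((smear ?b ^^ k) H)"
        using smear_iterate[of G ?b k] smear_iterate[of H ?b k] Suc b t by auto
      with Suc show ?case by (auto intro!: smear_mono_diff)
    qed auto
    \<comment> \<open>Commuting moves the next \<open>c\<close>-step inside the
      \<open>b\<close>-steps until it acts on \<open>F\<close> itself, so the local bound for
      \<open>F\<close> alone suffices.\<close>
    have "(smear ?c ^^ k) F M \<le> (smear ?b ^^ k) F M + real k * (C * t ^ 3)" for k M
    proof (induction k arbitrary: M)
      case (Suc k)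
      have "(smear ?c ^^ Suc k) F M \<le> smear ?c ((smear ?b ^^ k) F) M + real k * (C * t ^ 3)"
        using Suc bm by (auto intro!: smear_mono_diff)
      also have "smear ?c ((smear ?b ^^ k) F) M = (smear ?b ^^ k) (smear ?c F) M"
        by (simp add: com)
      also have "\<dots> \<le> (smear ?b ^^ k) (smear ?b F) M + C * t ^ 3"
        using loc[OF t] F by (intro mon bmeas_smear) auto
      finally show ?case by (simp add: funpow_swap1 algebra_simps)
    qed auto
    from this[of "Suc n" M]
    have "smear (\<lambda>i. sqrt (real (Suc n)) * (t * c i)) F M
        \<le> smear (\<lambda>i. sqrt (real (Suc n)) * (t * b i)) F M + real (Suc n) * (C * t ^ 3)"
      using smear_iterate[OF F, of ?b n] smear_iterate[OF F, of ?c n] b c t by simp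
    moreover have "real (Suc n) * (C * t ^ 3) = C / sqrt (real (Suc n))"
    proof -
      have "real (Suc n) * t\<^sup>2 = 1" by (simp add: t_def power_divide)
      then have "real (Suc n) * (C * t ^ 3) = C * t" by (simp add: power3_eq_cube power2_eq_square mult_ac)
      then show ?thesis by (simp add: t_def)
    qed
    moreover have "(\<lambda>i. sqrt (real (Suc n)) * (t * f i)) = f" for f :: "'i \<Rightarrow> real"
      by (simp add: t_def)
    ultimately show ?thesis by simp
  qed
  have "(\<lambda>n. smear b F M + C / sqrt (real (Suc n))) \<longlonglongrightarrow> smear b F M + 0"
    by (intro tendsto_add tendsto_const tendsto_divide_0[OF tendsto_const] filterlim_at_top_imp_at_infinity
        filterlim_compose[OF sqrt_at_top] filterlim_compose[OF filterlim_real_sequentially] filterlim_Suc)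
  then show ?thesis
    by (intro LIMSEQ_le_const) (use step in auto)
qed

section \<open>Second-order expansion along lines\<close>

text \<open>The second derivative is only required to be Lipschitz: the penalty \<open>psi\<close> below is
  not three times differentiable at the origin.\<close>
definition tame :: "(real \<Rightarrow> real) \<Rightarrow> (real \<Rightarrow> real) \<Rightarrow> (real \<Rightarrow> real) \<Rightarrow> real \<Rightarrow> real \<Rightarrow> bool" where
  "tame f f1 f2 r C \<longleftrightarrow>
    (\<forall>t. (f has_real_derivative f1 t) (at t)) \<and> (\<forall>t. (f1 has_real_derivative f2 t) (at t)) \<and>
    (\<forall>t. \<bar>f1 t\<bar> \<le> C * r) \<and> (\<forall>t. \<bar>f2 t\<bar> \<le> C * r\<^sup>2) \<and>
    (\<forall>t u. \<bar>f2 t - f2 u\<bar> \<le> C * r ^ 3 * \<bar>t - u\<bar>)"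

lemma lipschitz_of_deriv_bound:
  fixes f :: "real \<Rightarrow> real"
  assumes "\<And>t. (f has_real_derivative f' t) (at t)" "\<And>t. \<bar>f' t\<bar> \<le> K"
  shows "\<bar>f t - f u\<bar> \<le> K * \<bar>t - u\<bar>"
  using field_differentiable_bound[of UNIV f f' K t u] assms by auto

lemma tame_sum:
  assumes "finite W" "\<And>w. w \<in> W \<Longrightarrow> tame (f w) (f1 w) (f2 w) r C"
  shows "tame (\<lambda>t. \<Sum>w\<in>W. f w t) (\<lambda>t. \<Sum>w\<in>W. f1 w t) (\<lambda>t. \<Sum>w\<in>W. f2 w t) r (real (card W) * C)"
proof -
  have a: "\<bar>\<Sum>w\<in>W. h w\<bar> \<le> real (card W) * K" if "\<And>w. w \<in> W \<Longrightarrow> \<bar>h w\<bar> \<le> K" for h :: "'a \<Rightarrow> real" and K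
    using sum_norm_bound[of W h K] that by simp
  show ?thesis
    unfolding tame_def sum_subtractf[symmetric] mult.assoc
    using assms(2) unfolding tame_def
    by (auto intro!: DERIV_sum a simp: mult.assoc)
qed

text \<open>\<open>T\<close> contains the range of \<open>f\<close>, and the bounds on
  \<open>g\<close> are demanded only there. This matters for \<open>exp (- x)\<close>, whose
  derivatives are unbounded on the whole line.\<close>

lemma tame_comp:
  assumes f: "tame f f1 f2 r C" and r: "0 \<le> r" and C: "0 \<le> C" and fT: "\<And>t. f t \<in> T"
    and g: "\<And>x. x \<in> T \<Longrightarrow> (g has_real_derivative g' x) (at x)"
    and g1: "\<And>x. x \<in> T \<Longrightarrow> (g' has_real_derivative g'' x) (at x)"
    and b1: "\<And>x. x \<in> T \<Longrightarrow> \<bar>g' x\<bar> \<le> B" and b2: "\<And>x. x \<in> T \<Longrightarrow> \<bar>g'' x\<bar> \<le> B"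
    and lip: "\<And>x y. x \<in> T \<Longrightarrow> y \<in> T \<Longrightarrow> \<bar>g'' x - g'' y\<bar> \<le> B * \<bar>x - y\<bar>"
  shows "tame (\<lambda>t. g (f t)) (\<lambda>t. g' (f t) * f1 t) (\<lambda>t. g'' (f t) * (f1 t)\<^sup>2 + g' (f t) * f2 t)
    r (B * (C ^ 3 + 3 * C\<^sup>2 + C))"
proof -
  have B: "0 \<le> B" using b1[OF fT[of 0]] by linarith
  from f have d1: "\<And>t. (f has_real_derivative f1 t) (at t)" and d2: "\<And>t. (f1 has_real_derivative f2 t) (at t)"
    and c1: "\<And>t. \<bar>f1 t\<bar> \<le> C * r" and c2: "\<And>t. \<bar>f2 t\<bar> \<le> C * r\<^sup>2"
    and c3: "\<And>t u. \<bar>f2 t - f2 u\<bar> \<le> C * r ^ 3 * \<bar>t - u\<bar>" unfolding tame_def by auto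
  have l0: "\<bar>f t - f u\<bar> \<le> C * r * \<bar>t - u\<bar>" for t u
    by (rule lipschitz_of_deriv_bound[OF d1 c1])
  have l1: "\<bar>f1 t - f1 u\<bar> \<le> C * r\<^sup>2 * \<bar>t - u\<bar>" for t u
    by (rule lipschitz_of_deriv_bound[OF d2 c2])
  have D: "((\<lambda>t. g (f t)) has_real_derivative g' (f t) * f1 t) (at t)" for t
    by (rule DERIV_chain2[OF g[OF fT] d1])
  have D1: "((\<lambda>t. g' (f t)) has_real_derivative g'' (f t) * f1 t) (at t)" for t
    by (rule DERIV_chain2[OF g1[OF fT] d1])
  have e1: "\<bar>g'' (f t) * f1 t\<bar> \<le> B * (C * r)" for t
    unfolding abs_mult by (intro mult_mono b2 fT c1 B) auto
  have l2: "\<bar>g' (f t) - g' (f u)\<bar> \<le> B * (C * r) * \<bar>t - u\<bar>" for t u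
    by (rule lipschitz_of_deriv_bound[OF D1 e1])
  have sq: "(f1 t)\<^sup>2 \<le> (C * r)\<^sup>2" for t
    using c1[of t] by (rule abs_le_square_iff[THEN iffD1, OF order_trans]) (use C r in auto)
  have D2: "((\<lambda>t. g' (f t) * f1 t) has_real_derivative g'' (f t) * (f1 t)\<^sup>2 + g' (f t) * f2 t) (at t)" for t
    using DERIV_mult[OF D1[of t] d2[of t]] by (simp add: power2_eq_square algebra_simps)
  have n1: "\<bar>g' (f t) * f1 t\<bar> \<le> B * (C ^ 3 + 3 * C\<^sup>2 + C) * r" for t
  proof -
    have "\<bar>g' (f t) * f1 t\<bar> \<le> B * (C * r)"
      unfolding abs_mult by (intro mult_mono b1 fT c1 B) auto
    also have "\<dots> \<le> B * ((C ^ 3 + 3 * C\<^sup>2 + C) * r)"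
      by (intro mult_left_mono mult_right_mono B r) (use C in auto)
    finally show ?thesis by (simp add: mult.assoc)
  qed
  have n2: "\<bar>g'' (f t) * (f1 t)\<^sup>2 + g' (f t) * f2 t\<bar> \<le> B * (C ^ 3 + 3 * C\<^sup>2 + C) * r\<^sup>2" for t
  proof -
    have "\<bar>g'' (f t) * (f1 t)\<^sup>2\<bar> \<le> B * (C * r)\<^sup>2"
      unfolding abs_mult by (intro mult_mono b2 fT B) (use sq in auto)
    moreover have "\<bar>g' (f t) * f2 t\<bar> \<le> B * (C * r\<^sup>2)"
      unfolding abs_mult by (intro mult_mono b1 fT c2 B) auto
    moreover have "B * (C * r)\<^sup>2 + B * (C * r\<^sup>2) \<le> B * ((C ^ 3 + 3 * C\<^sup>2 + C) * r\<^sup>2)"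
    proof -
      have "B * (C * r)\<^sup>2 + B * (C * r\<^sup>2) = B * ((C\<^sup>2 + C) * r\<^sup>2)"
        by (simp add: power_mult_distrib algebra_simps)
      also have "\<dots> \<le> B * ((C ^ 3 + 3 * C\<^sup>2 + C) * r\<^sup>2)"
        by (intro mult_left_mono mult_right_mono B) (use C in auto)
      finally show ?thesis .
    qed
    ultimately show ?thesis
      using abs_triangle_ineq[of "g'' (f t) * (f1 t)\<^sup>2" "g' (f t) * f2 t"] by (simp add: mult.assoc)
  qed
  have n3: "\<bar>(g'' (f t) * (f1 t)\<^sup>2 + g' (f t) * f2 t) - (g'' (f u) * (f1 u)\<^sup>2 + g' (f u) * f2 u)\<bar>
      \<le> B * (C ^ 3 + 3 * C\<^sup>2 + C) * r ^ 3 * \<bar>t - u\<bar>" for t u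
  proof -
    define d where "d = \<bar>t - u\<bar>"
    have d: "0 \<le> d" by (simp add: d_def)
    have "\<bar>g'' (f t) - g'' (f u)\<bar> \<le> B * (C * r * d)"
      using lip[OF fT[of t] fT[of u]] mult_left_mono[OF l0[of t u] B] unfolding d_def by linarith
    then have p1: "\<bar>(g'' (f t) - g'' (f u)) * (f1 t)\<^sup>2\<bar> \<le> (B * (C * r * d)) * (C * r)\<^sup>2"
      unfolding abs_mult by (intro mult_mono) (use sq B C r d in auto)
    have "\<bar>f1 t + f1 u\<bar> \<le> 2 * (C * r)"
      using c1[of t] c1[of u] by linarith
    then have "\<bar>(f1 t - f1 u) * (f1 t + f1 u)\<bar> \<le> (C * r\<^sup>2 * d) * (2 * (C * r))"
      unfolding abs_mult d_def by (intro mult_mono l1) (use C r in auto)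
    then have p2: "\<bar>g'' (f u) * ((f1 t - f1 u) * (f1 t + f1 u))\<bar> \<le> B * ((C * r\<^sup>2 * d) * (2 * (C * r)))"
      unfolding abs_mult[of "g'' (f u)"] by (intro mult_mono b2 fT B) auto
    have p3: "\<bar>(g' (f t) - g' (f u)) * f2 t\<bar> \<le> (B * (C * r) * d) * (C * r\<^sup>2)"
      unfolding abs_mult d_def by (intro mult_mono l2 c2) (use B C r in auto)
    have p4: "\<bar>g' (f u) * (f2 t - f2 u)\<bar> \<le> B * (C * r ^ 3 * d)"
      unfolding abs_mult d_def by (intro mult_mono b1 fT c3 B) auto
    \<comment> \<open>One factor is varied at a time; the four products contribute
      \<open>C ^ 3\<close>, \<open>2 * C\<^sup>2\<close>, \<open>C\<^sup>2\<close> and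
      \<open>C\<close> to the constant.\<close>
    have "(g'' (f t) * (f1 t)\<^sup>2 + g' (f t) * f2 t) - (g'' (f u) * (f1 u)\<^sup>2 + g' (f u) * f2 u) =
      (g'' (f t) - g'' (f u)) * (f1 t)\<^sup>2 + g'' (f u) * ((f1 t - f1 u) * (f1 t + f1 u)) +
      (g' (f t) - g' (f u)) * f2 t + g' (f u) * (f2 t - f2 u)"
      by (simp add: algebra_simps power2_eq_square)
    moreover have "(B * (C * r * d)) * (C * r)\<^sup>2 + B * ((C * r\<^sup>2 * d) * (2 * (C * r))) +
       (B * (C * r) * d) * (C * r\<^sup>2) + B * (C * r ^ 3 * d) = B * (C ^ 3 + 3 * C\<^sup>2 + C) * r ^ 3 * d"
      by (simp add: algebra_simps power2_eq_square power3_eq_cube)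
    ultimately show ?thesis
      using p1 p2 p3 p4 unfolding d_def by linarith
  qed
  show ?thesis
    unfolding tame_def using D D2 n1 n2 n3 by blast
qed

text \<open>In the Lagrange form of the second-order remainder, moving the evaluation point of
  \<open>f2\<close> back to 0 costs one more factor \<open>t\<close> by the Lipschitz bound.\<close>

lemma tame_taylor:
  assumes "tame f f1 f2 r C" "0 \<le> t" "0 \<le> C" "0 \<le> r"
  shows "\<bar>f t - (f 0 + t * f1 0 + t\<^sup>2 / 2 * f2 0)\<bar> \<le> C * r ^ 3 * t ^ 3"
proof (cases "t = 0")
  case False
  then have t: "0 < t" using assms by simp
  let ?d = "\<lambda>k. if k = 0 then f else if k = Suc 0 then f1 else f2"
  have "\<exists>\<tau>>0. \<tau> < t \<and> f t = (\<Sum>m<2. ?d m 0 / fact m * t ^ m) + ?d 2 \<tau> / fact 2 * t ^ 2"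
    by (rule Maclaurin[OF t]) (use assms(1) in \<open>auto simp: tame_def less_2_cases_iff\<close>)
  then obtain \<tau> where \<tau>: "0 < \<tau>" "\<tau> < t" and eq: "f t = f 0 + f1 0 * t + f2 \<tau> / 2 * t\<^sup>2"
    by (auto simp: numeral_2_eq_2 lessThan_Suc)
  have "f t - (f 0 + t * f1 0 + t\<^sup>2 / 2 * f2 0) = (f2 \<tau> - f2 0) * (t\<^sup>2 / 2)"
    unfolding eq by (simp add: algebra_simps)
  also have "\<bar>\<dots>\<bar> \<le> (C * r ^ 3 * t) * (t\<^sup>2 / 2)"
  proof -
    have "\<bar>f2 \<tau> - f2 0\<bar> \<le> C * r ^ 3 * \<bar>\<tau> - 0\<bar>" using assms(1) unfolding tame_def by blast
    also have "\<dots> \<le> C * r ^ 3 * t" using \<tau> assms by (intro mult_left_mono) auto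
    finally show ?thesis unfolding abs_mult by (intro mult_mono) auto
  qed
  also have "\<dots> \<le> C * r ^ 3 * t ^ 3"
    using assms t by (simp add: power2_eq_square power3_eq_cube)
  finally show ?thesis .
qed simp

text \<open>Left of 0 and close to it, \<open>arctan s - s\<close> behaves like
  \<open>- s ^ 3 / 3\<close>, so gluing it to 0 is twice differentiable with Lipschitz second
  derivative. Its growth towards minus infinity is only linear, so the derivatives are
  bounded.\<close>

definition psi :: "real \<Rightarrow> real" where "psi s = (if s < 0 then arctan s - s else 0)"
definition psi1 :: "real \<Rightarrow> real" where "psi1 s = (if s < 0 then 1 / (1 + s\<^sup>2) - 1 else 0)"
definition psi2 :: "real \<Rightarrow> real" where "psi2 s = (if s < 0 then - 2 * s / (1 + s\<^sup>2)\<^sup>2 else 0)"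

text \<open>Away from 0 the glued function locally equals \<open>g\<close> or 0. At 0 its difference
  quotient is dominated by that of \<open>g\<close>, which tends to 0.\<close>

lemma DERIV_glue_zero:
  fixes g :: "real \<Rightarrow> real"
  assumes "\<And>x. (g has_real_derivative g1 x) (at x)" "g 0 = 0" "g1 0 = 0"
  shows "((\<lambda>s. if s < 0 then g s else 0) has_real_derivative (if x < 0 then g1 x else 0)) (at x)"
proof (cases x "0 :: real" rule: linorder_cases)
  case less
  have "((\<lambda>s. if s < 0 then g s else 0) has_real_derivative g1 x) (at x)"
    by (rule has_field_derivative_transform_within_open[OF assms(1), where S="{..<0}"]) (use less in auto)
  then show ?thesis using less by simp
next
  case greater
  have "((\<lambda>s. if s < 0 then g s else 0) has_real_derivative 0) (at x)"
    by (rule has_field_derivative_transform_within_open[OF DERIV_const[of 0], where S="{0<..}"]) (use greater in auto)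
  then show ?thesis using greater by simp
next
  case equal
  have "((\<lambda>y. (g y - g 0) / (y - 0)) \<longlongrightarrow> 0) (at 0)"
    using assms(1)[of 0] unfolding has_field_derivative_iff assms(3) by simp
  then have "((\<lambda>y. ((if y < 0 then g y else 0) - 0) / (y - 0)) \<longlongrightarrow> 0) (at 0)"
    by (rule Lim_null_comparison[OF _ tendsto_norm_zero, rotated]) (auto simp: assms(2))
  then show ?thesis using equal unfolding has_field_derivative_iff by simp
qed

lemma DERIV_psi: "(psi has_real_derivative psi1 s) (at s)"
  unfolding psi_def psi1_def
  by (rule DERIV_glue_zero) (auto intro!: derivative_eq_intros simp: inverse_eq_divide)

lemma DERIV_psi1: "(psi1 has_real_derivative psi2 s) (at s)"
proof -
  have "((\<lambda>s::real. 1 / (1 + s\<^sup>2) - 1) has_real_derivative - 2 * s / (1 + s\<^sup>2)\<^sup>2) (at s)" for s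
    by (auto intro!: derivative_eq_intros simp: power2_eq_square add_nonneg_eq_0_iff)
  from DERIV_glue_zero[OF this] show ?thesis unfolding psi1_def psi2_def by simp
qed

lemma psi1_bounds: "psi1 s \<le> 0" "\<bar>psi1 s\<bar> \<le> 6"
proof -
  have "0 \<le> 1 / (1 + s\<^sup>2)" "1 / (1 + s\<^sup>2) \<le> 1" by (auto simp: add_pos_nonneg)
  then have "1 / (1 + s\<^sup>2) - 1 \<le> 0" "\<bar>1 / (1 + s\<^sup>2) - 1\<bar> \<le> 6" by linarith+
  then show "psi1 s \<le> 0" "\<bar>psi1 s\<bar> \<le> 6" unfolding psi1_def by simp_all
qed

lemma psi2_bounds: "\<bar>psi2 s\<bar> \<le> 6" "\<bar>psi2 s - psi2 u\<bar> \<le> 6 * \<bar>s - u\<bar>"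
proof -
  let ?g = "\<lambda>s::real. - 2 * s / (1 + s\<^sup>2)\<^sup>2"
  let ?h = "\<lambda>s::real. (6 * s\<^sup>2 - 2) / (1 + s\<^sup>2) ^ 3"
  have p: "0 < 1 + x\<^sup>2" for x :: real by (simp add: add_pos_nonneg)
  have d: "(?g has_real_derivative ?h x) (at x)" for x
  proof -
    have "(?g has_real_derivative (- 2 * (1 + x\<^sup>2)\<^sup>2 - (- 2 * x) * (2 * (1 + x\<^sup>2) * (2 * x))) / ((1 + x\<^sup>2)\<^sup>2 * (1 + x\<^sup>2)\<^sup>2)) (at x)"
      by (rule DERIV_divide) (use p[of x] in \<open>auto intro!: derivative_eq_intros simp: add_nonneg_eq_0_iff\<close>)
    moreover have "(- 2 * (1 + x\<^sup>2)\<^sup>2 - (- 2 * x) * (2 * (1 + x\<^sup>2) * (2 * x))) = (1 + x\<^sup>2) * (6 * x\<^sup>2 - 2)"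
      by (simp add: algebra_simps power2_eq_square)
    moreover have "(1 + x\<^sup>2)\<^sup>2 * (1 + x\<^sup>2)\<^sup>2 = (1 + x\<^sup>2) * (1 + x\<^sup>2) ^ 3"
      by (simp add: power_add[symmetric] power_Suc[symmetric] del: power_Suc)
    ultimately show ?thesis using p[of x] by simp
  qed
  have hb: "\<bar>?h x\<bar> \<le> 6" for x
  proof -
    have "\<bar>6 * x\<^sup>2 - 2\<bar> \<le> 6 * (1 + x\<^sup>2)" by (auto simp: abs_le_iff)
    also have "\<dots> \<le> 6 * (1 + x\<^sup>2) ^ 3"
      using power_increasing[of 1 3 "1 + x\<^sup>2"] by simp
    finally show ?thesis using p[of x] by (simp add: abs_divide divide_le_eq)
  qed
  have l: "\<bar>?g x - ?g y\<bar> \<le> 6 * \<bar>x - y\<bar>" for x y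
    by (rule lipschitz_of_deriv_bound[OF d hb])
  \<comment> \<open>Clamping the argument at 0 is a contraction, so the Lipschitz bound of the
    rational function carries across the origin.\<close>
  have e: "psi2 x = ?g (min x 0)" for x by (auto simp: psi2_def min_def)
  have "\<bar>?g (min s 0) - ?g (min u 0)\<bar> \<le> 6 * \<bar>min s 0 - min u 0\<bar>" by (rule l)
  also have "\<dots> \<le> 6 * \<bar>s - u\<bar>" by (auto simp: min_def)
  finally show "\<bar>psi2 s - psi2 u\<bar> \<le> 6 * \<bar>s - u\<bar>" unfolding e .
  have "\<bar>?g x\<bar> \<le> 6" for x
  proof -
    have "2 * \<bar>x\<bar> \<le> 6 * (1 + x\<^sup>2)" using zero_le_power2[of "\<bar>x\<bar> - 1"] unfolding power2_diff by simp
    also have "\<dots> \<le> 6 * (1 + x\<^sup>2)\<^sup>2"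
      using power_increasing[of 1 2 "1 + x\<^sup>2"] by simp
    finally show ?thesis using p[of x] by (simp add: abs_divide abs_mult divide_le_eq)
  qed
  then show "\<bar>psi2 s\<bar> \<le> 6" unfolding e .
qed

lemma psi_antimono: "s \<le> u \<Longrightarrow> psi u \<le> psi s"
  by (rule DERIV_nonpos_imp_nonincreasing[of s u psi]) (use DERIV_psi psi1_bounds in blast)+

lemma psi_nonneg: "0 \<le> psi s"
  using psi_antimono[of s 0] psi_antimono[of 0 s] by (cases "s \<le> 0") (auto simp: psi_def)

lemma psi_zero: "0 \<le> s \<Longrightarrow> psi s = 0"
  by (simp add: psi_def)

lemma psi_minus_one_pos: "0 < psi (-1)"
  using pi_less_4 by (simp add: psi_def arctan_minus arctan_one)

text \<open>The 1 under the root keeps \<open>\<rho>\<close> at least 1, so derivatives stay bounded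
  even where the vector vanishes. Cauchy-Schwarz bounds the slope of \<open>\<rho>\<close> by
  \<open>r\<close>; a third derivative exists and yields the Lipschitz constant. Coordinate
  \<open>m\<close> is the linear summand.\<close>

lemma tame_sqrt_norm:
  fixes v d :: "nat \<Rightarrow> real"
  assumes r: "0 \<le> r" "(\<Sum>i<m. (d i)\<^sup>2) \<le> r\<^sup>2" "\<bar>d m\<bar> \<le> r"
  defines "\<rho> \<equiv> \<lambda>t. sqrt (1 + (\<Sum>i<m. (v i + t * d i)\<^sup>2))"
  defines "p \<equiv> \<lambda>t. (\<Sum>i<m. (v i + t * d i) * d i) / \<rho> t"
  shows "tame (\<lambda>t. \<rho> t + (v m + t * d m)) (\<lambda>t. p t + d m) (\<lambda>t. ((\<Sum>i<m. (d i)\<^sup>2) - (p t)\<^sup>2) / \<rho> t) r 3"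
proof -
  define b where "b = (\<Sum>i<m. (d i)\<^sup>2)"
  define p2 where "p2 = (\<lambda>t. (b - (p t)\<^sup>2) / \<rho> t)"
  have b: "b \<le> r\<^sup>2" "0 \<le> b" using r by (auto simp: b_def intro: sum_nonneg)
  have arg: "1 \<le> 1 + (\<Sum>i<m. (v i + t * d i)\<^sup>2)" for t by (simp add: sum_nonneg)
  then have \<rho>: "1 \<le> \<rho> t" for t unfolding \<rho>_def by (rule real_le_rsqrt[OF order_trans, rotated]) simp
  have \<rho>sq: "(\<rho> t)\<^sup>2 = 1 + (\<Sum>i<m. (v i + t * d i)\<^sup>2)" for t
    unfolding \<rho>_def using arg[of t] by (intro real_sqrt_pow2) linarith
  have d\<rho>: "(\<rho> has_real_derivative p t) (at t)" for t
  proof -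
    have "0 < 1 + (\<Sum>i<m. (v i + t * d i)\<^sup>2)" using arg[of t] by linarith
    moreover have "((\<lambda>t. 1 + (\<Sum>i<m. (v i + t * d i)\<^sup>2)) has_real_derivative 2 * (\<Sum>i<m. (v i + t * d i) * d i)) (at t)"
      by (auto intro!: derivative_eq_intros simp: sum_distrib_left mult_ac)
    ultimately have "(\<rho> has_real_derivative inverse (sqrt (1 + (\<Sum>i<m. (v i + t * d i)\<^sup>2))) / 2 * (2 * (\<Sum>i<m. (v i + t * d i) * d i))) (at t)"
      unfolding \<rho>_def by (intro DERIV_chain2[OF DERIV_real_sqrt])
    then show ?thesis
      by (simp add: p_def \<rho>_def inverse_eq_divide)
  qed
  have dp: "(p has_real_derivative p2 t) (at t)" for t
  proof -
    have n: "\<rho> t \<noteq> 0" using \<rho>[of t] by linarith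
    have "((\<lambda>t. \<Sum>i<m. (v i + t * d i) * d i) has_real_derivative b) (at t)"
      unfolding b_def by (auto intro!: derivative_eq_intros simp: power2_eq_square)
    from DERIV_divide[OF this d\<rho>[of t] n]
    have "((\<lambda>t. (\<Sum>i<m. (v i + t * d i) * d i) / \<rho> t) has_real_derivative
        (b * \<rho> t - (\<Sum>i<m. (v i + t * d i) * d i) * p t) / (\<rho> t * \<rho> t)) (at t)" .
    moreover have "(\<Sum>i<m. (v i + t * d i) * d i) = p t * \<rho> t" using n by (simp add: p_def)
    moreover have "(b * \<rho> t - p t * \<rho> t * p t) / (\<rho> t * \<rho> t) = p2 t"
      using n by (simp add: p2_def field_simps power2_eq_square)
    ultimately show ?thesis unfolding p_def[symmetric] by simp
  qed
  have psq: "(p t)\<^sup>2 \<le> b" for t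
  proof -
    have "(\<Sum>i<m. (v i + t * d i) * d i)\<^sup>2 \<le> (\<Sum>i<m. (v i + t * d i)\<^sup>2) * b"
      unfolding b_def by (rule Cauchy_Schwarz_ineq_sum)
    also have "\<dots> \<le> (\<rho> t)\<^sup>2 * b" unfolding \<rho>sq using b by (intro mult_right_mono) auto
    finally show ?thesis using \<rho>[of t] by (simp add: p_def power_divide divide_le_eq mult.commute)
  qed
  have pb: "\<bar>p t\<bar> \<le> r" for t
    using psq[of t] b r(1) by (intro power2_le_imp_le[of "\<bar>p t\<bar>"]) auto
  have p2b: "0 \<le> p2 t" "p2 t \<le> r\<^sup>2" for t
  proof -
    show "0 \<le> p2 t" unfolding p2_def using psq[of t] \<rho>[of t] by simp
    have "p2 t \<le> (b - (p t)\<^sup>2) / 1" unfolding p2_def using psq[of t] \<rho>[of t] by (intro divide_left_mono) auto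
    also have "\<dots> \<le> b" by simp
    finally show "p2 t \<le> r\<^sup>2" using b by (rule_tac order_trans)
  qed
  have dp2: "(p2 has_real_derivative (- 3 * p t * p2 t / \<rho> t)) (at t)" for t
  proof -
    have n: "\<rho> t \<noteq> 0" using \<rho>[of t] by linarith
    have "((\<lambda>t. b - (p t)\<^sup>2) has_real_derivative (- 2 * p t * p2 t)) (at t)"
      using dp[of t] by (auto intro!: derivative_eq_intros)
    from DERIV_divide[OF this d\<rho>[of t] n]
    have "(p2 has_real_derivative (- 2 * p t * p2 t * \<rho> t - (b - (p t)\<^sup>2) * p t) / (\<rho> t * \<rho> t)) (at t)"
      unfolding p2_def .
    moreover have "b - (p t)\<^sup>2 = p2 t * \<rho> t" using n by (simp add: p2_def)
    ultimately show ?thesis using n by (simp add: field_simps)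
  qed
  have "\<bar>- 3 * p t * p2 t / \<rho> t\<bar> \<le> 3 * r ^ 3" for t
  proof -
    have "\<bar>p t\<bar> * \<bar>p2 t\<bar> \<le> r * r\<^sup>2" using pb p2b[of t] r by (intro mult_mono) auto
    then have "\<bar>- 3 * p t * p2 t\<bar> \<le> 3 * r ^ 3" by (simp add: abs_mult power3_eq_cube power2_eq_square)
    moreover have "\<bar>- 3 * p t * p2 t / \<rho> t\<bar> \<le> \<bar>- 3 * p t * p2 t\<bar> / 1"
      unfolding abs_divide using \<rho>[of t] by (intro divide_left_mono) auto
    ultimately show ?thesis by simp
  qed
  note lip = lipschitz_of_deriv_bound[OF dp2 this]
  have D: "((\<lambda>t. \<rho> t + (v m + t * d m)) has_real_derivative p t + d m) (at t)" for t
    using d\<rho>[of t] by (auto intro!: derivative_eq_intros)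
  have D1: "((\<lambda>t. p t + d m) has_real_derivative p2 t) (at t)" for t
    using dp[of t] by (auto intro!: derivative_eq_intros)
  have x: "\<bar>p t + d m\<bar> \<le> 3 * r" for t using pb[of t] r by linarith
  have y: "\<bar>p2 t\<bar> \<le> 3 * r\<^sup>2" for t using p2b[of t] by simp
  show ?thesis
    unfolding tame_def b_def[symmetric] p2_def[symmetric]
    using D D1 x y lip by blast
qed

section \<open>Gordon's comparison inequality\<close>

lemma distr_gauss_component: "distr gauss borel (\<lambda>x. x i) = std_normal"
proof -
  interpret product_prob_space "\<lambda>_. std_normal" UNIV by (rule product_prob_space_std_normal)
  have "distr gauss borel (\<lambda>x. x i) = distr gauss std_normal (\<lambda>x. x i)"
    by (rule distr_cong) auto
  then show ?thesis using PiM_component[of i] by (simp add: gauss_def)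
qed

lemma indep_vars_gauss: "gauss.indep_vars (\<lambda>_. borel) (\<lambda>i x. x i) UNIV"
proof -
  have m: "(\<lambda>x. x i) \<in> measurable gauss borel" for i :: 'a by measurable
  have "distr gauss (PiM UNIV (\<lambda>_. borel)) (\<lambda>x. \<lambda>i\<in>UNIV. x i) = (gauss :: ('a \<Rightarrow> real) measure)"
    by (simp add: restrict_UNIV distr_id2)
  then show ?thesis
    by (subst gauss.indep_vars_iff_distr_eq_PiM) (auto simp: gauss_def distr_gauss_component[unfolded gauss_def])
qed

lemma integrable_gauss_component:
  assumes "f \<in> borel_measurable borel"
  shows "integrable gauss (\<lambda>x. f (x i)) \<longleftrightarrow> integrable std_normal (f :: real \<Rightarrow> real)"
  using integrable_distr_eq[of "\<lambda>x. x i" gauss borel f] assms by (simp add: distr_gauss_component)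

lemma integral_gauss_component:
  assumes "f \<in> borel_measurable borel"
  shows "(\<integral>x. f (x i) \<partial>gauss) = (\<integral>x. f x \<partial>std_normal :: real)"
  using integral_distr[of "\<lambda>x. x i" gauss borel f] assms by (simp add: distr_gauss_component)

lemma integrable_std_normal_power: "integrable std_normal (\<lambda>x. x ^ k)"
  using integrable_std_normal_distribution_moment by (simp add: std_normal_def)

lemma std_normal_moments: "(\<integral>x. x \<partial>std_normal) = 0" "(\<integral>x. x\<^sup>2 \<partial>std_normal) = 1"
  using integral_std_normal_distribution_moment_odd[of 1] std_normal_distribution_even_moments(1)[of 1]
  by (simp_all add: std_normal_def)

lemma gauss_mean: "integrable gauss (\<lambda>x. x i)" "(\<integral>x. x i \<partial>gauss) = 0"
  using integrable_gauss_component[of "\<lambda>x. x" i] integral_gauss_component[of "\<lambda>x. x" i]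
    integrable_std_normal_power[of 1] std_normal_moments by simp_all

lemma gauss_covariance:
  "integrable gauss (\<lambda>x. x i * x j)" "(\<integral>x. x i * x j \<partial>gauss) = (if i = j then 1 else 0)"
proof -
  have "integrable gauss (\<lambda>x. x i * x j) \<and> (\<integral>x. x i * x j \<partial>gauss) = (if i = j then 1 else 0)"
  proof (cases "i = j")
    case True
    then show ?thesis
      using integrable_gauss_component[of "\<lambda>x. x\<^sup>2" i] integral_gauss_component[of "\<lambda>x. x\<^sup>2" i]
        integrable_std_normal_power[of 2] std_normal_moments by (simp add: power2_eq_square)
  next
    case False
    have "gauss.indep_vars (\<lambda>_. borel) (\<lambda>i x. x i) {i, j}"
      by (rule gauss.indep_vars_subset[OF indep_vars_gauss]) auto
    from gauss.indep_vars_lebesgue_integral[OF _ this gauss_mean(1)] gauss.indep_vars_integrable[OF _ this gauss_mean(1)]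
    show ?thesis using False gauss_mean(2)[of i] by simp
  qed
  then show "integrable gauss (\<lambda>x. x i * x j)" "(\<integral>x. x i * x j \<partial>gauss) = (if i = j then 1 else 0)"
    by auto
qed

lemma gauss_linear_forms:
  fixes x y :: "'i \<Rightarrow> real"
  assumes "finite I" "finite J"
  shows "integrable gauss (\<lambda>\<xi>. (\<Sum>a\<in>I. x a * \<xi> a) * (\<Sum>a\<in>J. y a * \<xi> a))"
    and "(\<integral>\<xi>. (\<Sum>a\<in>I. x a * \<xi> a) * (\<Sum>a\<in>J. y a * \<xi> a) \<partial>gauss) = (\<Sum>a\<in>I \<inter> J. x a * y a)"
proof -
  have e: "(\<Sum>a\<in>I. x a * \<xi> a) * (\<Sum>a\<in>J. y a * \<xi> a) = (\<Sum>a\<in>I. \<Sum>b\<in>J. x a * y b * (\<xi> a * \<xi> b))" for \<xi>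
    by (simp add: sum_product mult_ac)
  show "integrable gauss (\<lambda>\<xi>. (\<Sum>a\<in>I. x a * \<xi> a) * (\<Sum>a\<in>J. y a * \<xi> a))"
    unfolding e by (intro Bochner_Integration.integrable_sum integrable_mult_right gauss_covariance)
  have "(\<integral>\<xi>. (\<Sum>a\<in>I. x a * \<xi> a) * (\<Sum>a\<in>J. y a * \<xi> a) \<partial>gauss) = (\<Sum>a\<in>I. \<Sum>b\<in>J. x a * y b * (if a = b then 1 else 0))"
    unfolding e by (simp add: gauss_covariance)
  also have "\<dots> = (\<Sum>a\<in>I. if a \<in> J then x a * y a else 0)"
    using assms by (intro sum.cong refl) (simp add: if_distrib[of "(*) _"] sum.delta cong: if_cong)
  also have "\<dots> = (\<Sum>a\<in>I \<inter> J. x a * y a)"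
    using assms by (simp add: sum.inter_restrict)
  finally show "(\<integral>\<xi>. (\<Sum>a\<in>I. x a * \<xi> a) * (\<Sum>a\<in>J. y a * \<xi> a) \<partial>gauss) = (\<Sum>a\<in>I \<inter> J. x a * y a)" .
qed

lemma sum_abs_cube_le:
  fixes x :: "'i \<Rightarrow> real"
  assumes "finite J"
  shows "(\<Sum>a\<in>J. \<bar>x a\<bar>) ^ 3 \<le> real (card J) ^ 3 * (\<Sum>a\<in>J. \<bar>x a\<bar> ^ 3)"
proof -
  define s where "s = (\<Sum>a\<in>J. \<bar>x a\<bar> ^ 3)"
  have s: "0 \<le> s" unfolding s_def by (intro sum_nonneg) auto
  have "\<bar>x a\<bar> \<le> root 3 s" if "a \<in> J" for a
  proof -
    have "\<bar>x a\<bar> ^ 3 \<le> s" unfolding s_def using assms that by (intro member_le_sum) auto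
    then have "root 3 (\<bar>x a\<bar> ^ 3) \<le> root 3 s" by simp
    then show ?thesis by (simp add: real_root_power_cancel)
  qed
  then have "(\<Sum>a\<in>J. \<bar>x a\<bar>) \<le> real (card J) * root 3 s"
    using sum_bounded_above[of J "\<lambda>a. \<bar>x a\<bar>" "root 3 s"] by simp
  then have "(\<Sum>a\<in>J. \<bar>x a\<bar>) ^ 3 \<le> (real (card J) * root 3 s) ^ 3"
    by (intro power_mono sum_nonneg) auto
  also have "\<dots> = real (card J) ^ 3 * s"
    using s by (simp add: power_mult_distrib)
  finally show ?thesis unfolding s_def .
qed

lemma integrable_gauss_sum_abs_cube:
  fixes J :: "'i set"
  assumes "finite J"
  shows "integrable gauss (\<lambda>\<xi>. (\<Sum>a\<in>J. \<bar>\<xi> a\<bar>) ^ 3)"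
proof (rule Bochner_Integration.integrable_bound)
  have "integrable std_normal (\<lambda>x. \<bar>x\<bar> ^ 3)"
    using integrable_norm[OF integrable_std_normal_power[of 3]] by (simp add: power_abs)
  then have "integrable gauss (\<lambda>\<xi>. \<bar>\<xi> a\<bar> ^ 3)" for a :: 'i
    by (subst integrable_gauss_component) auto
  then show "integrable gauss (\<lambda>\<xi>. real (card J) ^ 3 * (\<Sum>a\<in>J. \<bar>\<xi> a\<bar> ^ 3))" by auto
  show "AE \<xi> in gauss. norm ((\<Sum>a\<in>J. \<bar>\<xi> a\<bar>) ^ 3) \<le> norm (real (card J) ^ 3 * (\<Sum>a\<in>J. \<bar>\<xi> a\<bar> ^ 3))"
    using sum_abs_cube_le[OF assms] by (intro AE_I2) (simp add: sum_nonneg)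
qed auto

text \<open>A unit vector of length \<open>n\<close> is extended by a last entry 1. A single linear
  form on the rows of an \<open>(m + 1) \<times> (n + 1)\<close> matrix then expresses both Gaussian
  processes, which differ only in the entries that carry noise.\<close>

locale gordon_matrix =
  fixes m n :: nat and W :: "(nat \<Rightarrow> real) set"
  assumes W: "finite W" and last1: "\<And>w. w \<in> W \<Longrightarrow> w n = 1" and unit: "\<And>w. w \<in> W \<Longrightarrow> (\<Sum>j<n. (w j)\<^sup>2) = 1"
begin

definition lin :: "(nat \<Rightarrow> real) \<Rightarrow> (nat \<times> nat \<Rightarrow> real) \<Rightarrow> nat \<Rightarrow> real" where
  "lin w M i = (\<Sum>j\<le>n. w j * M (i, j))"

definition rho :: "(nat \<times> nat \<Rightarrow> real) \<Rightarrow> (nat \<Rightarrow> real) \<Rightarrow> real" where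
  "rho M w = sqrt (1 + (\<Sum>i<m. (lin w M i)\<^sup>2))"

definition height :: "(nat \<times> nat \<Rightarrow> real) \<Rightarrow> (nat \<Rightarrow> real) \<Rightarrow> real" where
  "height M w = rho M w + lin w M m"

definition H :: "(nat \<times> nat \<Rightarrow> real) \<Rightarrow> real" where
  "H M = exp (- (\<Sum>w\<in>W. psi (height M w)))"

text \<open>The gradient of \<open>height\<close> with respect to the values
  \<open>lin w M i\<close>, \<open>i \<le> m\<close>; row \<open>m\<close> enters linearly, hence
  the 1.\<close>

definition dir :: "(nat \<times> nat \<Rightarrow> real) \<Rightarrow> (nat \<Rightarrow> real) \<Rightarrow> nat \<Rightarrow> real" where
  "dir M w i = (if i < m then lin w M i / rho M w else 1)"

definition dheight :: "(nat \<times> nat \<Rightarrow> real) \<Rightarrow> (nat \<times> nat \<Rightarrow> real) \<Rightarrow> (nat \<Rightarrow> real) \<Rightarrow> real" where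
  "dheight M \<eta> w = (\<Sum>i\<le>m. dir M w i * lin w \<eta> i)"

definition drho :: "(nat \<times> nat \<Rightarrow> real) \<Rightarrow> (nat \<times> nat \<Rightarrow> real) \<Rightarrow> (nat \<Rightarrow> real) \<Rightarrow> real" where
  "drho M \<eta> w = (\<Sum>i<m. dir M w i * lin w \<eta> i)"

text \<open>\<open>S1\<close> and \<open>S2\<close> are the first and second derivatives at 0 of the
  penalty sum along the line through \<open>M\<close> in direction \<open>\<eta>\<close>.\<close>

definition S1 :: "(nat \<times> nat \<Rightarrow> real) \<Rightarrow> (nat \<times> nat \<Rightarrow> real) \<Rightarrow> real" where
  "S1 M \<eta> = (\<Sum>w\<in>W. psi1 (height M w) * dheight M \<eta> w)"

definition S2 :: "(nat \<times> nat \<Rightarrow> real) \<Rightarrow> (nat \<times> nat \<Rightarrow> real) \<Rightarrow> real" where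
  "S2 M \<eta> = (\<Sum>w\<in>W. psi2 (height M w) * (dheight M \<eta> w)\<^sup>2 +
     psi1 (height M w) * (((\<Sum>i<m. (lin w \<eta> i)\<^sup>2) - (drho M \<eta> w)\<^sup>2) / rho M w))"

definition size1 :: "(nat \<times> nat \<Rightarrow> real) \<Rightarrow> real" where
  "size1 \<eta> = (\<Sum>a\<in>{..m} \<times> {..n}. \<bar>\<eta> a\<bar>)"

lemma lin_add: "lin w (\<lambda>a. M a + t * \<eta> a) i = lin w M i + t * lin w \<eta> i"
  by (simp add: lin_def sum.distrib sum_distrib_left algebra_simps)

lemma abs_le_1: "w \<in> W \<Longrightarrow> j \<le> n \<Longrightarrow> \<bar>w j\<bar> \<le> 1"
proof (cases "j = n")
  case False
  assume w: "w \<in> W" and "j \<le> n"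
  then have "(w j)\<^sup>2 \<le> (\<Sum>j<n. (w j)\<^sup>2)" using False by (intro member_le_sum) auto
  then show ?thesis using unit[OF w] by (simp add: abs_square_le_1)
qed (simp add: last1)

lemma sum_abs_lin_le:
  assumes "w \<in> W"
  shows "(\<Sum>i\<le>m. \<bar>lin w \<eta> i\<bar>) \<le> size1 \<eta>"
proof -
  have "\<bar>lin w \<eta> i\<bar> \<le> (\<Sum>j\<le>n. \<bar>\<eta> (i, j)\<bar>)" for i
  proof -
    have "\<bar>lin w \<eta> i\<bar> \<le> (\<Sum>j\<le>n. \<bar>w j * \<eta> (i, j)\<bar>)" unfolding lin_def by (rule sum_abs)
    also have "\<dots> \<le> (\<Sum>j\<le>n. \<bar>\<eta> (i, j)\<bar>)"
      using abs_le_1[OF assms] by (intro sum_mono) (auto simp: abs_mult intro: mult_left_le_one_le)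
    finally show ?thesis .
  qed
  then show ?thesis
    unfolding size1_def sum.cartesian_product' by (simp add: sum_mono)
qed

lemma lin_bounds:
  assumes "w \<in> W"
  shows "(\<Sum>i<m. (lin w \<eta> i)\<^sup>2) \<le> (size1 \<eta>)\<^sup>2" "\<bar>lin w \<eta> m\<bar> \<le> size1 \<eta>"
proof -
  have n: "0 \<le> (\<Sum>i<m. \<bar>lin w \<eta> i\<bar>)" by (simp add: sum_nonneg)
  have s: "(\<Sum>i<m. \<bar>lin w \<eta> i\<bar>) + \<bar>lin w \<eta> m\<bar> \<le> size1 \<eta>"
    using sum_abs_lin_le[OF assms, of \<eta>] by (simp add: lessThan_Suc_atMost[symmetric])
  from s n show "\<bar>lin w \<eta> m\<bar> \<le> size1 \<eta>" by linarith
  have "(\<Sum>i<m. (lin w \<eta> i)\<^sup>2) = (\<Sum>i<m. \<bar>lin w \<eta> i\<bar> * \<bar>lin w \<eta> i\<bar>)" by (simp add: power2_eq_square)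
  also have "\<dots> \<le> (\<Sum>i<m. \<bar>lin w \<eta> i\<bar> * (\<Sum>i<m. \<bar>lin w \<eta> i\<bar>))"
    by (intro sum_mono mult_left_mono member_le_sum) auto
  also have "\<dots> = (\<Sum>i<m. \<bar>lin w \<eta> i\<bar>)\<^sup>2" by (simp add: sum_distrib_right[symmetric] power2_eq_square)
  also have "\<dots> \<le> (size1 \<eta>)\<^sup>2" using s n by (intro power_mono) auto
  finally show "(\<Sum>i<m. (lin w \<eta> i)\<^sup>2) \<le> (size1 \<eta>)\<^sup>2" .
qed

text \<open>Along a line \<open>H\<close> arises from smoothed norms by \<open>psi\<close>, a finite
  sum and \<open>exp (- x)\<close>; each operation yields a \<open>tame\<close> function, so
  \<open>tame_taylor\<close> applies. \<open>K\<close> depends only on the number of vectors, hence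
  is uniform in \<open>M\<close> and \<open>\<eta>\<close>.\<close>

lemma H_expansion:
  obtains K where "0 \<le> K" "\<And>M \<eta> t. 0 \<le> t \<Longrightarrow>
    \<bar>H (\<lambda>a. M a + t * \<eta> a) - (H M - t * S1 M \<eta> * H M + t\<^sup>2 / 2 * (((S1 M \<eta>)\<^sup>2 - S2 M \<eta>) * H M))\<bar>
      \<le> K * size1 \<eta> ^ 3 * t ^ 3"
proof -
  define C where "C = real (card W) * (6 * (3 ^ 3 + 3 * 3\<^sup>2 + 3))"
  define K where "K = 1 * (C ^ 3 + 3 * C\<^sup>2 + C)"
  have C: "0 \<le> C" and K: "0 \<le> K" by (auto simp: C_def K_def)
  have "\<bar>H (\<lambda>a. M a + t * \<eta> a) - (H M - t * S1 M \<eta> * H M + t\<^sup>2 / 2 * (((S1 M \<eta>)\<^sup>2 - S2 M \<eta>) * H M))\<bar>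
      \<le> K * size1 \<eta> ^ 3 * t ^ 3" if t: "0 \<le> t" for M \<eta> t
  proof -
    define r where "r = size1 \<eta>"
    have r: "0 \<le> r" by (auto simp: r_def size1_def intro: sum_nonneg)
    define R where "R w t = sqrt (1 + (\<Sum>i<m. (lin w M i + t * lin w \<eta> i)\<^sup>2))" for w t
    define p where "p w t = (\<Sum>i<m. (lin w M i + t * lin w \<eta> i) * lin w \<eta> i) / R w t" for w t
    define f where "f w t = R w t + (lin w M m + t * lin w \<eta> m)" for w t
    define f1 where "f1 w t = p w t + lin w \<eta> m" for w t
    define f2 where "f2 w t = ((\<Sum>i<m. (lin w \<eta> i)\<^sup>2) - (p w t)\<^sup>2) / R w t" for w t
    have "tame (f w) (f1 w) (f2 w) r 3" if "w \<in> W" for w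
      using tame_sqrt_norm[OF r, where m=m and d="lin w \<eta>" and v="lin w M"] lin_bounds[OF that, of \<eta>]
      unfolding f_def f1_def f2_def p_def R_def r_def by simp
    then have "tame (\<lambda>t. psi (f w t)) (\<lambda>t. psi1 (f w t) * f1 w t)
       (\<lambda>t. psi2 (f w t) * (f1 w t)\<^sup>2 + psi1 (f w t) * f2 w t) r (6 * (3 ^ 3 + 3 * 3\<^sup>2 + 3))" if "w \<in> W" for w
      using that by (intro tame_comp[where T=UNIV] DERIV_psi DERIV_psi1 psi1_bounds psi2_bounds r) auto
    from tame_sum[OF W this]
    have T: "tame (\<lambda>t. \<Sum>w\<in>W. psi (f w t)) (\<lambda>t. \<Sum>w\<in>W. psi1 (f w t) * f1 w t)
       (\<lambda>t. \<Sum>w\<in>W. psi2 (f w t) * (f1 w t)\<^sup>2 + psi1 (f w t) * f2 w t) r C" (is "tame ?f ?f1 ?f2 _ _")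
      unfolding C_def by simp
    \<comment> \<open>The penalty sum is nonnegative, and on the nonnegative half-line the
      derivatives of \<open>exp (- x)\<close> are bounded by 1.\<close>
    have lipe: "\<bar>exp (- x) - exp (- y)\<bar> \<le> 1 * \<bar>x - y\<bar>" if "x \<in> {0..}" "y \<in> {0..}" for x y :: real
      by (rule field_differentiable_bound[of "{0::real..}" "\<lambda>x. exp (- x)" "\<lambda>x. - exp (- x)" 1 x y, simplified real_norm_def])
         (use that in \<open>auto intro!: derivative_eq_intros\<close>)
    have "tame (\<lambda>t. exp (- ?f t)) (\<lambda>t. - exp (- ?f t) * ?f1 t)
       (\<lambda>t. exp (- ?f t) * (?f1 t)\<^sup>2 + - exp (- ?f t) * ?f2 t) r K"
      unfolding K_def
      by (rule tame_comp[OF T r C, where T="{0..}" and g="\<lambda>x. exp (- x)" and g'="\<lambda>x. - exp (- x)" and g''="\<lambda>x. exp (- x)"])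
         (use lipe in \<open>auto intro!: derivative_eq_intros sum_nonneg psi_nonneg\<close>)
    from tame_taylor[OF this t K r]
    have "\<bar>exp (- ?f t) - (exp (- ?f 0) + t * (- exp (- ?f 0) * ?f1 0) +
        t\<^sup>2 / 2 * (exp (- ?f 0) * (?f1 0)\<^sup>2 + - exp (- ?f 0) * ?f2 0))\<bar> \<le> K * r ^ 3 * t ^ 3" .
    moreover have R: "R w 0 = rho M w" for w by (simp add: R_def rho_def)
    then have f0: "f w 0 = height M w" for w by (simp add: f_def height_def)
    have ft: "f w t = height (\<lambda>a. M a + t * \<eta> a) w" for w by (simp add: f_def R_def height_def rho_def lin_add)
    have p0: "p w 0 = drho M \<eta> w" for w
      by (simp add: p_def R drho_def dir_def sum_divide_distrib)
    have f10: "f1 w 0 = dheight M \<eta> w" for w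
      unfolding f1_def p0 dheight_def drho_def by (simp add: lessThan_Suc_atMost[symmetric] dir_def)
    have "?f 0 = (\<Sum>w\<in>W. psi (height M w))" "?f1 0 = S1 M \<eta>" "?f2 0 = S2 M \<eta>"
      by (simp_all add: f0 f10 S1_def S2_def f2_def p0 R)
    ultimately show ?thesis
      unfolding ft H_def[symmetric] r_def[symmetric] by (simp add: H_def[symmetric] algebra_simps)
  qed
  with K show thesis by (rule that)
qed

section \<open>Expectations of the directional derivatives of \<open>H\<close>\<close>

lemma lin_measurable [measurable]: "(\<lambda>M. lin w M i) \<in> borel_measurable (PiM UNIV (\<lambda>_. borel))"
  unfolding lin_def by measurable

lemma height_measurable [measurable]: "(\<lambda>M. height M w) \<in> borel_measurable (PiM UNIV (\<lambda>_. borel))"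
  unfolding height_def rho_def by measurable

lemma psi_measurable [measurable]: "psi \<in> borel_measurable borel"
  unfolding psi_def by measurable

lemma H_bounds: "0 < H M" "H M \<le> 1"
  unfolding H_def by (auto intro!: sum_nonneg psi_nonneg)

lemma bmeas_H: "bmeas H"
proof -
  have "H \<in> borel_measurable (PiM UNIV (\<lambda>_. borel))"
    unfolding H_def by measurable
  moreover have "\<bar>H x\<bar> \<le> 1" for x using H_bounds[of x] by auto
  ultimately show ?thesis unfolding bmeas_def by blast
qed

text \<open>The covariance of \<^term>\<open>lin w (\<lambda>a. b a * \<xi> a) i\<close> and \<^term>\<open>lin w' (\<lambda>a. b a * \<xi> a) i\<close>.\<close>
definition cov :: "(nat \<times> nat \<Rightarrow> real) \<Rightarrow> nat \<Rightarrow> (nat \<Rightarrow> real) \<Rightarrow> (nat \<Rightarrow> real) \<Rightarrow> real" where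
  "cov b i w w' = (\<Sum>j\<le>n. w j * w' j * (b (i, j))\<^sup>2)"

lemma comb_eq:
  "(\<Sum>i\<in>I. e i * lin w (\<lambda>a. b a * \<xi> a) i) = (\<Sum>a\<in>I \<times> {..n}. (e (fst a) * w (snd a) * b a) * \<xi> a)"
  by (simp add: lin_def sum_distrib_left sum.cartesian_product split_beta' mult_ac)

lemma comb_expectation:
  assumes "finite I"
  shows "integrable gauss (\<lambda>\<xi>. (\<Sum>i\<in>I. e i * lin w (\<lambda>a. b a * \<xi> a) i) * (\<Sum>i\<in>I. e' i * lin w' (\<lambda>a. b a * \<xi> a) i))"
    and "(\<integral>\<xi>. (\<Sum>i\<in>I. e i * lin w (\<lambda>a. b a * \<xi> a) i) * (\<Sum>i\<in>I. e' i * lin w' (\<lambda>a. b a * \<xi> a) i) \<partial>gauss)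
       = (\<Sum>i\<in>I. e i * e' i * cov b i w w')"
proof -
  have f: "finite (I \<times> {..n})" using assms by simp
  show "integrable gauss (\<lambda>\<xi>. (\<Sum>i\<in>I. e i * lin w (\<lambda>a. b a * \<xi> a) i) * (\<Sum>i\<in>I. e' i * lin w' (\<lambda>a. b a * \<xi> a) i))"
    unfolding comb_eq by (rule gauss_linear_forms[OF f f])
  have "(\<Sum>i\<in>I. e i * e' i * cov b i w w') = (\<Sum>(i, j)\<in>I \<times> {..n}. e i * e' i * (w j * w' j * (b (i, j))\<^sup>2))"
    by (simp add: cov_def sum_distrib_left sum.cartesian_product)
  also have "\<dots> = (\<Sum>a\<in>I \<times> {..n}. (e (fst a) * w (snd a) * b a) * (e' (fst a) * w' (snd a) * b a))"
    by (intro sum.cong refl) (auto simp: power2_eq_square)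
  finally show "(\<integral>\<xi>. (\<Sum>i\<in>I. e i * lin w (\<lambda>a. b a * \<xi> a) i) * (\<Sum>i\<in>I. e' i * lin w' (\<lambda>a. b a * \<xi> a) i) \<partial>gauss)
       = (\<Sum>i\<in>I. e i * e' i * cov b i w w')"
    unfolding comb_eq gauss_linear_forms(2)[OF f f] by simp
qed

lemma lin_expectation:
  "integrable gauss (\<lambda>\<xi>. (lin w (\<lambda>a. b a * \<xi> a) i)\<^sup>2)" "(\<integral>\<xi>. (lin w (\<lambda>a. b a * \<xi> a) i)\<^sup>2 \<partial>gauss) = cov b i w w"
  using comb_expectation[of "{i}" "\<lambda>_. 1" w b "\<lambda>_. 1" w] by (simp_all add: power2_eq_square)

lemma integrable_lin: "integrable gauss (\<lambda>\<xi>. lin w (\<lambda>a. b a * \<xi> a) i)"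
  and integral_lin: "(\<integral>\<xi>. lin w (\<lambda>a. b a * \<xi> a) i \<partial>gauss) = 0"
  unfolding lin_def by (auto simp: gauss_mean mult.assoc[symmetric])

lemma S1_expectation:
  "integrable gauss (\<lambda>\<xi>. S1 M (\<lambda>a. b a * \<xi> a))" "(\<integral>\<xi>. S1 M (\<lambda>a. b a * \<xi> a) \<partial>gauss) = 0"
  unfolding S1_def dheight_def by (auto simp: integrable_lin integral_lin)

lemma S1_sq_expectation:
  "integrable gauss (\<lambda>\<xi>. (S1 M (\<lambda>a. b a * \<xi> a))\<^sup>2)"
  "(\<integral>\<xi>. (S1 M (\<lambda>a. b a * \<xi> a))\<^sup>2 \<partial>gauss) = (\<Sum>w\<in>W. \<Sum>w'\<in>W. psi1 (height M w) * psi1 (height M w') *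
     (\<Sum>i\<le>m. dir M w i * dir M w' i * cov b i w w'))"
proof -
  have e: "(S1 M \<eta>)\<^sup>2 = (\<Sum>w\<in>W. \<Sum>w'\<in>W. psi1 (height M w) * psi1 (height M w') * (dheight M \<eta> w * dheight M \<eta> w'))" for \<eta>
    unfolding S1_def power2_eq_square sum_product by (simp add: mult_ac)
  show "integrable gauss (\<lambda>\<xi>. (S1 M (\<lambda>a. b a * \<xi> a))\<^sup>2)"
    unfolding e dheight_def
    by (intro Bochner_Integration.integrable_sum integrable_mult_right comb_expectation) auto
  show "(\<integral>\<xi>. (S1 M (\<lambda>a. b a * \<xi> a))\<^sup>2 \<partial>gauss) = (\<Sum>w\<in>W. \<Sum>w'\<in>W. psi1 (height M w) * psi1 (height M w') *
     (\<Sum>i\<le>m. dir M w i * dir M w' i * cov b i w w'))"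
    unfolding e dheight_def
    by (simp add: comb_expectation Bochner_Integration.integral_sum)
qed

text \<open>Only the variances \<open>cov b i w w\<close> enter. They equal 1 for both processes, so
  the mean is free of \<open>b\<close> and cancels in the comparison.\<close>

lemma S2_expectation:
  assumes "\<And>w i. w \<in> W \<Longrightarrow> i \<le> m \<Longrightarrow> cov b i w w = 1"
  shows "integrable gauss (\<lambda>\<xi>. S2 M (\<lambda>a. b a * \<xi> a))"
  "(\<integral>\<xi>. S2 M (\<lambda>a. b a * \<xi> a) \<partial>gauss) = (\<Sum>w\<in>W. psi2 (height M w) * (\<Sum>i\<le>m. dir M w i * dir M w i) +
     psi1 (height M w) * ((real m - (\<Sum>i<m. dir M w i * dir M w i)) / rho M w))"
proof -
  show i: "integrable gauss (\<lambda>\<xi>. S2 M (\<lambda>a. b a * \<xi> a))"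
    unfolding S2_def dheight_def drho_def power2_eq_square
    by (intro Bochner_Integration.integrable_sum Bochner_Integration.integrable_add integrable_mult_right
        Bochner_Integration.integrable_diff integrable_divide comb_expectation
        lin_expectation[unfolded power2_eq_square]) auto
  have "(\<integral>\<xi>. psi2 (height M w) * (dheight M (\<lambda>a. b a * \<xi> a) w)\<^sup>2 +
     psi1 (height M w) * (((\<Sum>i<m. (lin w (\<lambda>a. b a * \<xi> a) i)\<^sup>2) - (drho M (\<lambda>a. b a * \<xi> a) w)\<^sup>2) / rho M w) \<partial>gauss)
    = psi2 (height M w) * (\<Sum>i\<le>m. dir M w i * dir M w i) +
     psi1 (height M w) * ((real m - (\<Sum>i<m. dir M w i * dir M w i)) / rho M w)" if "w \<in> W" for w
    using assms[OF that]
    unfolding dheight_def drho_def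
    by (simp add: power2_eq_square comb_expectation lin_expectation[unfolded power2_eq_square])
  then show "(\<integral>\<xi>. S2 M (\<lambda>a. b a * \<xi> a) \<partial>gauss) = (\<Sum>w\<in>W. psi2 (height M w) * (\<Sum>i\<le>m. dir M w i * dir M w i) +
     psi1 (height M w) * ((real m - (\<Sum>i<m. dir M w i * dir M w i)) / rho M w))"
    unfolding S2_def dheight_def drho_def power2_eq_square
    apply (subst Bochner_Integration.integral_sum)
     apply (intro Bochner_Integration.integrable_add integrable_mult_right
        Bochner_Integration.integrable_diff integrable_divide comb_expectation Bochner_Integration.integrable_sum
        lin_expectation[unfolded power2_eq_square]; simp)
    apply (intro sum.cong refl; simp)
    done
qed

text \<open>Standard deviations of the noise. \<open>bX\<close> keeps the upper left block and the
  corner, giving the smoothed norm of \<open>A w\<close> plus \<open>g\<^sub>0\<close>;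
  \<open>bY\<close> keeps the rest of the last column and row, giving the smoothed norm of
  \<open>g\<close> plus \<open>\<langle>h, w\<rangle>\<close>.\<close>

definition bX :: "nat \<times> nat \<Rightarrow> real" where
  "bX a = (if fst a < m \<and> snd a < n \<or> a = (m, n) then 1 else 0)"

definition bY :: "nat \<times> nat \<Rightarrow> real" where
  "bY a = (if fst a < m \<and> snd a = n \<or> fst a = m \<and> snd a < n then 1 else 0)"

lemma abs_bX_le: "\<bar>bX a\<bar> \<le> 1" and abs_bY_le: "\<bar>bY a\<bar> \<le> 1"
  by (auto simp: bX_def bY_def)

lemma cov_bX: "w \<in> W \<Longrightarrow> w' \<in> W \<Longrightarrow> i \<le> m \<Longrightarrow> cov bX i w w' = (if i < m then (\<Sum>j<n. w j * w' j) else 1)"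
  by (auto simp: cov_def bX_def last1 lessThan_Suc_atMost[symmetric] intro!: sum.cong)

lemma cov_bY: "w \<in> W \<Longrightarrow> w' \<in> W \<Longrightarrow> i \<le> m \<Longrightarrow> cov bY i w w' = (if i < m then 1 else (\<Sum>j<n. w j * w' j))"
  by (auto simp: cov_def bY_def last1 lessThan_Suc_atMost[symmetric] intro!: sum.cong)

lemma sum_dir_sq_le_1: "(\<Sum>i<m. (dir M w i)\<^sup>2) \<le> 1"
proof -
  have "(rho M w)\<^sup>2 = 1 + (\<Sum>i<m. (lin w M i)\<^sup>2)"
    unfolding rho_def by (rule real_sqrt_pow2) (simp add: add_nonneg_nonneg sum_nonneg)
  moreover have "(\<Sum>i<m. (dir M w i)\<^sup>2) = (\<Sum>i<m. (lin w M i)\<^sup>2) / (rho M w)\<^sup>2"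
    by (simp add: dir_def power_divide sum_divide_distrib)
  moreover have "0 < 1 + (\<Sum>i<m. (lin w M i)\<^sup>2)" by (simp add: add_pos_nonneg sum_nonneg)
  ultimately show ?thesis by simp
qed

lemma inner_le_1:
  fixes x y :: "nat \<Rightarrow> real"
  assumes "(\<Sum>i<k. (x i)\<^sup>2) \<le> 1" "(\<Sum>i<k. (y i)\<^sup>2) \<le> 1"
  shows "(\<Sum>i<k. x i * y i) \<le> 1"
proof -
  have "(\<Sum>i<k. x i * y i)\<^sup>2 \<le> (\<Sum>i<k. (x i)\<^sup>2) * (\<Sum>i<k. (y i)\<^sup>2)" by (rule Cauchy_Schwarz_ineq_sum)
  also have "\<dots> \<le> 1 * 1" using assms by (intro mult_mono) (auto intro: sum_nonneg)
  finally show ?thesis by (simp add: abs_square_le_1 abs_le_iff)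
qed

text \<open>For two vectors of \<^term>\<open>W\<close> the covariances of the two processes differ by
  \<open>(1 - \<langle>w, w'\<rangle>) * (1 - \<langle>e, e'\<rangle>)\<close> with \<open>e\<close>, \<open>e'\<close> in the unit ball, so both factors are nonnegative.\<close>
lemma S1_sq_compare:
  "(\<integral>\<xi>. (S1 M (\<lambda>a. bY a * \<xi> a))\<^sup>2 \<partial>gauss) \<le> (\<integral>\<xi>. (S1 M (\<lambda>a. bX a * \<xi> a))\<^sup>2 \<partial>gauss)"
  unfolding S1_sq_expectation
proof (intro sum_mono, rule mult_left_mono)
  fix w w' assume w: "w \<in> W" "w' \<in> W"
  show "0 \<le> psi1 (height M w) * psi1 (height M w')" by (intro mult_nonpos_nonpos psi1_bounds)
  define p where "p = (\<Sum>j<n. w j * w' j)"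
  define q where "q = (\<Sum>i<m. dir M w i * dir M w' i)"
  have p: "p \<le> 1" unfolding p_def using unit w by (intro inner_le_1) auto
  have q: "q \<le> 1" unfolding q_def by (intro inner_le_1 sum_dir_sq_le_1)
  have "(\<Sum>i\<le>m. dir M w i * dir M w' i * cov bX i w w') = q * p + 1"
    using w by (simp add: lessThan_Suc_atMost[symmetric] cov_bX p_def[symmetric] q_def sum_distrib_right dir_def)
  moreover have "(\<Sum>i\<le>m. dir M w i * dir M w' i * cov bY i w w') = q + p"
    using w by (simp add: lessThan_Suc_atMost[symmetric] cov_bY p_def[symmetric] q_def dir_def)
  moreover have "0 \<le> (1 - p) * (1 - q)" using p q by simp
  ultimately show "(\<Sum>i\<le>m. dir M w i * dir M w' i * cov bY i w w') \<le> (\<Sum>i\<le>m. dir M w i * dir M w' i * cov bX i w w')"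
    by (simp add: algebra_simps)
qed

lemma cov_diag:
  assumes "w \<in> W" "i \<le> m"
  shows "cov bX i w w = 1" "cov bY i w w = 1"
  using unit[OF assms(1)] assms by (auto simp: cov_bX cov_bY power2_eq_square)

text \<open>The first-order term has mean 0 because the noise is centred, and the third moment of
  \<open>size1\<close> controls the remainder. \<open>R\<close> is common to all admissible
  \<open>b\<close> and all \<open>M\<close>.\<close>

lemma smear_H_expansion:
  obtains R where "\<And>b M t. (\<And>a. \<bar>b a\<bar> \<le> 1) \<Longrightarrow> (\<And>w i. w \<in> W \<Longrightarrow> i \<le> m \<Longrightarrow> cov b i w w = 1) \<Longrightarrow> 0 \<le> t \<Longrightarrow>
    \<bar>smear (\<lambda>a. t * b a) H M - (H M + t\<^sup>2 / 2 * (((\<integral>\<xi>. (S1 M (\<lambda>a. b a * \<xi> a))\<^sup>2 \<partial>gauss)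
        - (\<integral>\<xi>. S2 M (\<lambda>a. b a * \<xi> a) \<partial>gauss)) * H M))\<bar> \<le> R * t ^ 3"
proof -
  obtain K where K: "0 \<le> K" and ex: "\<And>M \<eta> t. 0 \<le> t \<Longrightarrow>
    \<bar>H (\<lambda>a. M a + t * \<eta> a) - (H M - t * S1 M \<eta> * H M + t\<^sup>2 / 2 * (((S1 M \<eta>)\<^sup>2 - S2 M \<eta>) * H M))\<bar>
      \<le> K * size1 \<eta> ^ 3 * t ^ 3"
    using H_expansion by blast
  define R where "R = K * (\<integral>\<xi>. size1 \<xi> ^ 3 \<partial>gauss)"
  have int: "integrable gauss (\<lambda>\<xi>. size1 \<xi> ^ 3)"
    unfolding size1_def by (rule integrable_gauss_sum_abs_cube) simp
  have "\<bar>smear (\<lambda>a. t * b a) H M - (H M + t\<^sup>2 / 2 * (((\<integral>\<xi>. (S1 M (\<lambda>a. b a * \<xi> a))\<^sup>2 \<partial>gauss)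
        - (\<integral>\<xi>. S2 M (\<lambda>a. b a * \<xi> a) \<partial>gauss)) * H M))\<bar> \<le> R * t ^ 3"
    if b: "\<And>a. \<bar>b a\<bar> \<le> 1" and cov: "\<And>w i. w \<in> W \<Longrightarrow> i \<le> m \<Longrightarrow> cov b i w w = 1" and t: "0 \<le> t" for b M t
  proof -
    let ?\<eta> = "\<lambda>\<xi> a. b a * \<xi> a"
    let ?Q = "\<lambda>\<xi>. H M - t * S1 M (?\<eta> \<xi>) * H M + t\<^sup>2 / 2 * (((S1 M (?\<eta> \<xi>))\<^sup>2 - S2 M (?\<eta> \<xi>)) * H M)"
    let ?D = "\<lambda>\<xi>. H (\<lambda>a. M a + t * (b a * \<xi> a)) - ?Q \<xi>"
    have iH: "integrable gauss (\<lambda>\<xi>. H (\<lambda>a. M a + t * (b a * \<xi> a)))"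
      using bmeas_shift[OF bmeas_H, of M "\<lambda>a. t * b a"] by (simp add: mult.assoc)
    have iQ: "integrable gauss ?Q" and
      vQ: "(\<integral>\<xi>. ?Q \<xi> \<partial>gauss) = H M + t\<^sup>2 / 2 * (((\<integral>\<xi>. (S1 M (?\<eta> \<xi>))\<^sup>2 \<partial>gauss) - (\<integral>\<xi>. S2 M (?\<eta> \<xi>) \<partial>gauss)) * H M)"
      using S1_expectation[of M b] S1_sq_expectation(1)[of M b] S2_expectation(1)[OF cov, of M] by simp_all
    have "\<bar>(\<integral>\<xi>. ?D \<xi> \<partial>gauss)\<bar> \<le> (\<integral>\<xi>. \<bar>?D \<xi>\<bar> \<partial>gauss)" by (rule integral_abs_bound)
    also have "\<dots> \<le> (\<integral>\<xi>. K * size1 \<xi> ^ 3 * t ^ 3 \<partial>gauss)"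
    proof (intro integral_mono)
      show "integrable gauss (\<lambda>\<xi>. \<bar>?D \<xi>\<bar>)" by (intro integrable_abs Bochner_Integration.integrable_diff iH iQ)
      show "integrable gauss (\<lambda>\<xi>. K * size1 \<xi> ^ 3 * t ^ 3)" using int by simp
      fix \<xi>
      have "size1 (?\<eta> \<xi>) \<le> size1 \<xi>"
        unfolding size1_def using b by (intro sum_mono) (auto simp: abs_mult intro: mult_left_le_one_le)
      moreover have "0 \<le> size1 (?\<eta> \<xi>)" unfolding size1_def by (rule sum_nonneg) auto
      ultimately have "K * size1 (?\<eta> \<xi>) ^ 3 * t ^ 3 \<le> K * size1 \<xi> ^ 3 * t ^ 3"
        using K t by (intro mult_right_mono mult_left_mono power_mono) auto
      then show "\<bar>?D \<xi>\<bar> \<le> K * size1 \<xi> ^ 3 * t ^ 3" using ex[OF t, of M "?\<eta> \<xi>"] by linarith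
    qed
    also have "\<dots> = R * t ^ 3" by (simp add: R_def)
    also have "(\<integral>\<xi>. ?D \<xi> \<partial>gauss) = smear (\<lambda>a. t * b a) H M - (\<integral>\<xi>. ?Q \<xi> \<partial>gauss)"
      using iH iQ by (subst Bochner_Integration.integral_diff) (simp_all add: smear_def mult.assoc)
    finally show ?thesis unfolding vQ .
  qed
  then show thesis by (rule that)
qed

text \<open>The means of \<open>S2\<close> coincide, so the second-order terms of a short step are
  ordered by \<open>S1_sq_compare\<close>. The two remainders give the local error
  \<open>2 * R * t ^ 3\<close>, and \<open>smear_compare\<close> passes to the full smear.\<close>

theorem gordon_compare: "smear bY H M \<le> smear bX H M"
proof -
  obtain R where R: "\<And>b M t. (\<And>a. \<bar>b a\<bar> \<le> 1) \<Longrightarrow> (\<And>w i. w \<in> W \<Longrightarrow> i \<le> m \<Longrightarrow> cov b i w w = 1) \<Longrightarrow> 0 \<le> t \<Longrightarrow>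
    \<bar>smear (\<lambda>a. t * b a) H M - (H M + t\<^sup>2 / 2 * (((\<integral>\<xi>. (S1 M (\<lambda>a. b a * \<xi> a))\<^sup>2 \<partial>gauss)
        - (\<integral>\<xi>. S2 M (\<lambda>a. b a * \<xi> a) \<partial>gauss)) * H M))\<bar> \<le> R * t ^ 3"
    using smear_H_expansion by blast
  show ?thesis
  proof (rule smear_compare[OF bmeas_H, where C="2 * R"])
    fix M t assume t: "0 < t" "t \<le> (1::real)"
    let ?E = "\<lambda>b. (\<integral>\<xi>. (S1 M (\<lambda>a. b a * \<xi> a))\<^sup>2 \<partial>gauss) - (\<integral>\<xi>. S2 M (\<lambda>a. b a * \<xi> a) \<partial>gauss)"
    have "?E bY \<le> ?E bX"
      using S1_sq_compare[of M] S2_expectation(2)[of bX M] S2_expectation(2)[of bY M] cov_diag by simp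
    then have "t\<^sup>2 / 2 * (?E bY * H M) \<le> t\<^sup>2 / 2 * (?E bX * H M)"
      using H_bounds[of M] by (intro mult_left_mono mult_right_mono) auto
    moreover have "\<bar>smear (\<lambda>a. t * bX a) H M - (H M + t\<^sup>2 / 2 * (?E bX * H M))\<bar> \<le> R * t ^ 3"
      by (rule R) (use t cov_diag in \<open>auto simp: abs_bX_le abs_bY_le\<close>)
    moreover have "\<bar>smear (\<lambda>a. t * bY a) H M - (H M + t\<^sup>2 / 2 * (?E bY * H M))\<bar> \<le> R * t ^ 3"
      by (rule R) (use t cov_diag in \<open>auto simp: abs_bX_le abs_bY_le\<close>)
    ultimately show "smear (\<lambda>i. t * bY i) H M \<le> smear (\<lambda>i. t * bX i) H M + 2 * R * t ^ 3"
      by linarith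
  qed (auto simp: bX_def bY_def)
qed

end

section \<open>Escape probability and Chernoff bounds\<close>

text \<open>The constant consists of the loss from smoothing the indicator by \<^const>\<open>psi\<close> and the
  probability that the auxiliary Gaussian entry, which is independent of the matrix, is at most \<open>-3\<close>.\<close>
definition escape_const :: real where
  "escape_const = (1 - exp (- psi (-1))) * measure std_normal {..-3}"

lemma std_normal_pos:
  assumes "a < b" "{a<..<b} \<subseteq> A" "A \<in> sets borel"
  shows "0 < measure std_normal A"
proof -
  have "emeasure std_normal {a<..<b} \<noteq> 0"
  proof
    assume "emeasure std_normal {a<..<b} = 0"
    then have "{a<..<b} \<in> null_sets (density lborel (\<lambda>x. ennreal (std_normal_density x)))"
      unfolding std_normal_def by (intro null_setsI) auto
    then have "AE x in lborel. x \<in> {a<..<b} \<longrightarrow> ennreal (std_normal_density x) = 0"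
      by (subst (asm) null_sets_density_iff) auto
    then have "AE x in lborel. x \<notin> {a<..<b}"
    proof (eventually_elim)
      case (elim x)
      have "0 < std_normal_density x" by (rule normal_density_pos) simp
      with elim show ?case by auto
    qed
    then have "emeasure lborel {a<..<b} = 0"
      by (subst (asm) AE_iff_measurable[where N="{a<..<b}"]) auto
    with assms show False by (simp add: emeasure_lborel_Ioo)
  qed
  then have "0 < measure std_normal {a<..<b}"
    by (simp add: std_normal.emeasure_eq_measure zero_less_measure_iff)
  also have "\<dots> \<le> measure std_normal A"
    using assms by (intro std_normal.finite_measure_mono) auto
  finally show ?thesis .
qed

lemma escape_const_pos: "0 < escape_const"
  unfolding escape_const_def
  using psi_minus_one_pos by (intro mult_pos_pos std_normal_pos[of "-4" "-3"]) auto

lemma gauss_prob_indep: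
  assumes I: "I \<inter> J = {}"
    and A: "A \<in> sets (PiM I (\<lambda>_. borel))" and B: "B \<in> sets (PiM J (\<lambda>_. borel))"
  shows "measure gauss {\<xi>. restrict \<xi> I \<in> A \<and> restrict \<xi> J \<in> B} =
    measure gauss {\<xi>. restrict \<xi> I \<in> A} * measure gauss {\<xi>. restrict \<xi> J \<in> B}"
proof -
  have "gauss.indep_var (PiM I (\<lambda>_. borel)) (\<lambda>\<xi>. restrict (\<lambda>i. \<xi> i) I) (PiM J (\<lambda>_. borel)) (\<lambda>\<xi>. restrict (\<lambda>i. \<xi> i) J)"
    by (rule gauss.indep_var_restrict[OF indep_vars_gauss]) (use I in auto)
  from gauss.indep_varD[OF this A B] show ?thesis
    by (simp add: vimage_def conj_commute)
qed

lemma sets_gauss_CollectI: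
  "Measurable.pred gauss P \<Longrightarrow> {\<xi>. P \<xi>} \<in> sets gauss"
  by (simp add: pred_def)

text \<open>\<open>H\<close> replaces indicators: it is at most \<open>exp (- psi (-1))\<close> when
  some image is short and the corner entry is at most -3, and it is 1 when the comparison process is
  nowhere negative. The constant is independent of \<open>S\<close>, so nets of any size are
  admissible.\<close>

lemma escape_bound:
  fixes m n :: nat and S :: "(nat \<Rightarrow> real) set"
  assumes S: "finite S" and unit: "\<And>w. w \<in> S \<Longrightarrow> (\<Sum>j<n. (w j)\<^sup>2) = 1"
  shows "escape_const * measure gauss {\<xi>. \<exists>w\<in>S. (\<Sum>i<m. (\<Sum>j<n. w j * \<xi> (i, j))\<^sup>2) \<le> 1}
    \<le> measure gauss {\<xi>. \<exists>w\<in>S. sqrt (1 + (\<Sum>i<m. (\<xi> (i, n))\<^sup>2)) + (\<Sum>j<n. w j * \<xi> (m, j)) < 0}"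
proof -
  define W where "W = (\<lambda>w. w(n := 1)) ` S"
  interpret gordon_matrix m n W
    by unfold_locales (use S unit in \<open>auto simp: W_def\<close>)
  let ?A = "{\<xi> :: nat \<times> nat \<Rightarrow> real. \<exists>w\<in>S. (\<Sum>i<m. (\<Sum>j<n. w j * \<xi> (i, j))\<^sup>2) \<le> 1}"
  let ?g = "{\<xi> :: nat \<times> nat \<Rightarrow> real. \<xi> (m, n) \<le> -3}"
  let ?B = "{\<xi> :: nat \<times> nat \<Rightarrow> real. \<exists>w\<in>S. sqrt (1 + (\<Sum>i<m. (\<xi> (i, n))\<^sup>2)) + (\<Sum>j<n. w j * \<xi> (m, j)) < 0}"
  have mA: "?A \<in> sets gauss" and mg: "?g \<in> sets gauss" and mB: "?B \<in> sets gauss"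
    by (rule sets_gauss_CollectI; use S in measurable)+
  let ?X = "\<lambda>\<xi> a. 0 + bX a * \<xi> a" and ?Y = "\<lambda>\<xi> a. 0 + bY a * \<xi> a"
  have X1: "lin (w(n := 1)) (?X \<xi>) i = (\<Sum>j<n. w j * \<xi> (i, j))" if "i < m" for w \<xi> i
    unfolding lin_def lessThan_Suc_atMost[symmetric] by (use that in \<open>auto simp: bX_def\<close>)
  have X2: "lin (w(n := 1)) (?X \<xi>) m = \<xi> (m, n)" for w \<xi>
    unfolding lin_def lessThan_Suc_atMost[symmetric] by (simp add: bX_def)
  have Y1: "lin (w(n := 1)) (?Y \<xi>) i = \<xi> (i, n)" if "i < m" for w \<xi> i
    unfolding lin_def lessThan_Suc_atMost[symmetric] by (use that in \<open>auto simp: bY_def\<close>)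
  have Y2: "lin (w(n := 1)) (?Y \<xi>) m = (\<Sum>j<n. w j * \<xi> (m, j))" for w \<xi>
    unfolding lin_def lessThan_Suc_atMost[symmetric] by (simp add: bY_def)
  let ?k = "1 - exp (- psi (-1))"
  have low: "?k * indicator (?A \<inter> ?g) \<xi> \<le> 1 - H (?X \<xi>)" for \<xi>
  proof (cases "\<xi> \<in> ?A \<inter> ?g")
    case True
    then obtain w where w: "w \<in> S" "(\<Sum>i<m. (\<Sum>j<n. w j * \<xi> (i, j))\<^sup>2) \<le> 1" and g: "\<xi> (m, n) \<le> -3" by blast
    have "rho (?X \<xi>) (w(n := 1)) = sqrt (1 + (\<Sum>i<m. (\<Sum>j<n. w j * \<xi> (i, j))\<^sup>2))"
      unfolding rho_def
      by (intro arg_cong2[where f="(+)"] arg_cong[where f=sqrt] sum.cong refl) (simp only: X1 lessThan_iff)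
    \<comment> \<open>A smoothed norm of at most 2 and a corner entry of at most -3 bring the height
      down to -1.\<close>
    also have "\<dots> \<le> 2" using w(2) by (intro real_le_lsqrt) auto
    finally have "height (?X \<xi>) (w(n := 1)) \<le> -1" using g unfolding height_def X2 by linarith
    then have "psi (-1) \<le> psi (height (?X \<xi>) (w(n := 1)))" by (rule psi_antimono)
    also have "\<dots> \<le> (\<Sum>w\<in>W. psi (height (?X \<xi>) w))"
      using w W by (intro member_le_sum psi_nonneg) (simp_all add: W_def del: fun_upd_apply)
    finally have "H (?X \<xi>) \<le> exp (- psi (-1))" unfolding H_def by simp
    then show ?thesis using True by simp
  qed (use H_bounds[of "?X \<xi>"] in simp)
  have up: "1 - H (?Y \<xi>) \<le> indicator ?B \<xi>" for \<xi>
  proof (cases "\<xi> \<in> ?B")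
    case False
    have "psi (height (?Y \<xi>) w) = 0" if w: "w \<in> W" for w
    proof -
      obtain v where v: "v \<in> S" "w = v(n := 1)" using w unfolding W_def by blast
      have "height (?Y \<xi>) w = sqrt (1 + (\<Sum>i<m. (\<xi> (i, n))\<^sup>2)) + (\<Sum>j<n. v j * \<xi> (m, j))"
        unfolding height_def rho_def v(2) Y2
        by (intro arg_cong2[where f="(+)"] arg_cong[where f=sqrt] sum.cong refl) (simp only: Y1 lessThan_iff)
      with False v(1) show ?thesis by (auto simp: not_less intro!: psi_zero)
    qed
    then have "H (?Y \<xi>) = 1" unfolding H_def by simp
    then show ?thesis using False by simp
  qed (use H_bounds[of "?Y \<xi>"] in simp)
  have iX: "integrable gauss (\<lambda>\<xi>. H (?X \<xi>))" and iY: "integrable gauss (\<lambda>\<xi>. H (?Y \<xi>))"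
    by (rule bmeas_shift[OF bmeas_H])+
  \<comment> \<open>The block and the corner use disjoint coordinates, so the events are independent
    and the second costs only a constant factor.\<close>
  have prod: "measure gauss (?A \<inter> ?g) = measure gauss ?A * measure std_normal {..-3}"
  proof -
    let ?I = "{..<m} \<times> {..<n}" and ?J = "{(m, n)}"
    let ?A' = "{x \<in> space (PiM ?I (\<lambda>_. borel)). \<exists>w\<in>S. (\<Sum>i<m. (\<Sum>j<n. w j * x (i, j))\<^sup>2) \<le> 1}"
    let ?g' = "{x \<in> space (PiM ?J (\<lambda>_. borel)). x (m, n) \<le> (-3::real)}"
    have comp: "(\<lambda>x. x (i, j)) \<in> borel_measurable (PiM ?I (\<lambda>_. borel))" if "i < m" "j < n" for i j
      using that by (intro measurable_component_singleton) auto
    have "?A' \<in> sets (PiM ?I (\<lambda>_. borel))"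
      using S comp by (intro sets.sets_Collect_finite_Ex borel_measurable_le borel_measurable_sum borel_measurable_power
          borel_measurable_times) auto
    moreover have "?g' \<in> sets (PiM ?J (\<lambda>_. borel))" by measurable
    ultimately have "measure gauss {\<xi>. restrict \<xi> ?I \<in> ?A' \<and> restrict \<xi> ?J \<in> ?g'} =
      measure gauss {\<xi>. restrict \<xi> ?I \<in> ?A'} * measure gauss {\<xi>. restrict \<xi> ?J \<in> ?g'}"
      by (intro gauss_prob_indep) auto
    moreover have a: "restrict \<xi> ?I \<in> ?A' \<longleftrightarrow> \<xi> \<in> ?A" and b: "restrict \<xi> ?J \<in> ?g' \<longleftrightarrow> \<xi> \<in> ?g" for \<xi> :: "nat \<times> nat \<Rightarrow> real"
      by (simp_all add: space_PiM)
    moreover have "measure gauss ?g = measure std_normal {..-3}"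
    proof -
      have "measure std_normal {..-3} = measure (distr gauss borel (\<lambda>x. x (m, n))) {..-3}"
        by (simp add: distr_gauss_component)
      also have "\<dots> = measure gauss ?g"
        by (subst measure_distr) (auto simp: vimage_def)
      finally show ?thesis by simp
    qed
    ultimately show ?thesis unfolding a b by (simp add: Int_def)
  qed
  have "escape_const * measure gauss ?A = (\<integral>\<xi>. ?k * indicator (?A \<inter> ?g) \<xi> \<partial>gauss)"
    using mA mg by (simp add: prod escape_const_def)
  also have "\<dots> \<le> (\<integral>\<xi>. 1 - H (?X \<xi>) \<partial>gauss)"
    using mA mg low iX
    by (intro integral_mono integrable_mult_right Bochner_Integration.integrable_diff integrable_real_indicator)
       (auto simp: gauss.emeasure_eq_measure)
  also have "\<dots> = 1 - smear bX H (\<lambda>_. 0)" using iX by (simp add: smear_def)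
  also have "\<dots> \<le> 1 - smear bY H (\<lambda>_. 0)" using gordon_compare by simp
  also have "\<dots> = (\<integral>\<xi>. 1 - H (?Y \<xi>) \<partial>gauss)" using iY by (simp add: smear_def)
  also have "\<dots> \<le> (\<integral>\<xi>. indicator ?B \<xi> \<partial>gauss)"
    using mB up iY
    by (intro integral_mono Bochner_Integration.integrable_diff integrable_real_indicator)
       (auto simp: gauss.emeasure_eq_measure)
  also have "\<dots> = measure gauss ?B" using mB by simp
  finally show ?thesis .
qed

section \<open>Exponential moments and Chernoff bounds\<close>

lemma exp_le_quadratic: "exp (x :: real) \<le> 1 + x + x\<^sup>2 * exp \<bar>x\<bar>"
proof -
  obtain t where t: "\<bar>t\<bar> \<le> \<bar>x\<bar>" and e: "exp x = (\<Sum>m<2. x ^ m / fact m) + exp t / fact 2 * x\<^sup>2"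
    using Maclaurin_exp_le[of x 2] by blast
  have "exp t / 2 * x\<^sup>2 \<le> exp \<bar>x\<bar> * x\<^sup>2"
  proof (rule mult_right_mono)
    have "exp t / 2 \<le> exp t" by simp
    also have "\<dots> \<le> exp \<bar>x\<bar>" using t by simp
    finally show "exp t / 2 \<le> exp \<bar>x\<bar>" .
  qed simp
  then show ?thesis using e by (simp add: numeral_2_eq_2 mult.commute)
qed

lemma sq_le_exp: "0 \<le> y \<Longrightarrow> y\<^sup>2 \<le> 2 * exp (y :: real)"
  using exp_lower_Taylor_quadratic[of y] by simp

lemma integrable_if_exp_abs_integrable:
  fixes f :: "real \<Rightarrow> real"
  assumes [measurable]: "f \<in> borel_measurable borel" and l: "0 < l"
    and int: "integrable std_normal (\<lambda>x. exp (l * \<bar>f x\<bar>))"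
  shows "integrable std_normal f"
proof (rule Bochner_Integration.integrable_bound[of _ "\<lambda>x. 1 / l * exp (l * \<bar>f x\<bar>)"])
  show "AE x in std_normal. norm (f x) \<le> norm (1 / l * exp (l * \<bar>f x\<bar>))"
  proof (intro AE_I2)
    fix x
    have "l * \<bar>f x\<bar> \<le> exp (l * \<bar>f x\<bar>)" using exp_ge_add_one_self[of "l * \<bar>f x\<bar>"] by linarith
    then show "norm (f x) \<le> norm (1 / l * exp (l * \<bar>f x\<bar>))" using l by (simp add: field_simps)
  qed
qed (use int in auto)

text \<open>The moment is at most \<open>1 + s * \<mu> + s\<^sup>2 * C\<close>, and for small
  \<open>s\<close> the negative linear term dominates.\<close>

lemma exp_moment_less_1:
  fixes Y :: "real \<Rightarrow> real"
  assumes [measurable]: "Y \<in> borel_measurable borel" and l: "0 < l"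
    and int: "integrable std_normal (\<lambda>x. exp (l * \<bar>Y x\<bar>))" and neg: "(\<integral>x. Y x \<partial>std_normal) < 0"
  obtains s c where "0 < s" "0 < c" "integrable std_normal (\<lambda>x. exp (s * Y x))"
    "(\<integral>x. exp (s * Y x) \<partial>std_normal) \<le> exp (- c)"
proof -
  \<comment> \<open>\<open>C\<close> bounds the mean of
    \<open>Y\<^sup>2 * exp \<bar>s * Y\<bar>\<close> for \<open>s \<le> l / 2\<close>, through
    \<open>y\<^sup>2 \<le> 8 / l\<^sup>2 * exp (l / 2 * \<bar>y\<bar>)\<close>.\<close>
  define C where "C = 8 / l\<^sup>2 * (\<integral>x. exp (l * \<bar>Y x\<bar>) \<partial>std_normal)"
  define \<mu> where "\<mu> = (\<integral>x. Y x \<partial>std_normal)"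
  have C: "0 \<le> C" unfolding C_def by (intro mult_nonneg_nonneg integral_nonneg_AE) auto
  \<comment> \<open>The first bound leaves half of the exponential integrability for the square; the
    second makes \<open>s * C\<close> at most \<open>- \<mu> / 2\<close>, where \<open>C + 1\<close>
    keeps the denominator positive.\<close>
  define s where "s = min (l / 2) (- \<mu> / (2 * (C + 1)))"
  have "0 < - \<mu> / (2 * (C + 1))" using C neg by (intro divide_pos_pos) (auto simp: \<mu>_def)
  then have s: "0 < s" "s \<le> l / 2" using l min.cobounded1[of "l / 2"] unfolding s_def by auto
  have sC: "s * C \<le> - \<mu> / 2"
  proof -
    have "s * C \<le> - \<mu> / (2 * (C + 1)) * C" using C by (intro mult_right_mono) (auto simp: s_def)
    also have "\<dots> \<le> - \<mu> / 2" using C neg by (simp add: \<mu>_def[symmetric] field_simps)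
    finally show ?thesis .
  qed
  have key: "(s * y)\<^sup>2 * exp \<bar>s * y\<bar> \<le> s\<^sup>2 * (8 / l\<^sup>2 * exp (l * \<bar>y\<bar>))" for y
  proof -
    have "(l / 2 * \<bar>y\<bar>)\<^sup>2 \<le> 2 * exp (l / 2 * \<bar>y\<bar>)" using l by (intro sq_le_exp) auto
    then have "y\<^sup>2 \<le> 8 / l\<^sup>2 * exp (l / 2 * \<bar>y\<bar>)" using l by (simp add: power_mult_distrib power_divide field_simps)
    moreover have "exp \<bar>s * y\<bar> \<le> exp (l / 2 * \<bar>y\<bar>)" using s mult_right_mono[OF s(2), of "\<bar>y\<bar>"] by (simp add: abs_mult)
    ultimately have "y\<^sup>2 * exp \<bar>s * y\<bar> \<le> (8 / l\<^sup>2 * exp (l / 2 * \<bar>y\<bar>)) * exp (l / 2 * \<bar>y\<bar>)"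
      by (intro mult_mono) auto
    also have "\<dots> = 8 / l\<^sup>2 * exp (l * \<bar>y\<bar>)"
      by (simp add: exp_add[symmetric] field_simps)
    finally have "s\<^sup>2 * (y\<^sup>2 * exp \<bar>s * y\<bar>) \<le> s\<^sup>2 * (8 / l\<^sup>2 * exp (l * \<bar>y\<bar>))"
      by (intro mult_left_mono) auto
    then show ?thesis by (simp add: power_mult_distrib mult.assoc)
  qed
  have iY: "integrable std_normal Y"
    using assms(1) l int by (rule integrable_if_exp_abs_integrable)
  have ie: "integrable std_normal (\<lambda>x. exp (s * Y x))"
  proof (rule Bochner_Integration.integrable_bound[OF int])
    show "AE x in std_normal. norm (exp (s * Y x)) \<le> norm (exp (l * \<bar>Y x\<bar>))"
    proof (intro AE_I2)
      fix x
      have "s * Y x \<le> s * \<bar>Y x\<bar>" using s by (intro mult_left_mono) auto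
      also have "\<dots> \<le> l * \<bar>Y x\<bar>" using s l by (intro mult_right_mono) auto
      finally show "norm (exp (s * Y x)) \<le> norm (exp (l * \<bar>Y x\<bar>))" by simp
    qed
  qed auto
  have "(\<integral>x. exp (s * Y x) \<partial>std_normal) \<le> (\<integral>x. 1 + s * Y x + s\<^sup>2 * (8 / l\<^sup>2 * exp (l * \<bar>Y x\<bar>)) \<partial>std_normal)"
  proof (intro integral_mono ie)
    show "integrable std_normal (\<lambda>x. 1 + s * Y x + s\<^sup>2 * (8 / l\<^sup>2 * exp (l * \<bar>Y x\<bar>)))"
      using iY int by auto
    fix x show "exp (s * Y x) \<le> 1 + s * Y x + s\<^sup>2 * (8 / l\<^sup>2 * exp (l * \<bar>Y x\<bar>))"
      using exp_le_quadratic[of "s * Y x"] key[of "Y x"] by linarith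
  qed
  also have "\<dots> = 1 + s * \<mu> + s\<^sup>2 * C"
    using iY int std_normal.prob_space by (simp add: \<mu>_def C_def)
  also have "\<dots> = 1 + s * (\<mu> + s * C)" by (simp add: power2_eq_square algebra_simps)
  also have "\<dots> \<le> 1 + s * (\<mu> / 2)" using sC s by (intro add_left_mono mult_left_mono) auto
  also have "\<dots> \<le> exp (s * (\<mu> / 2))" by (rule exp_ge_add_one_self)
  finally have "(\<integral>x. exp (s * Y x) \<partial>std_normal) \<le> exp (- (s * (- \<mu> / 2)))" by simp
  moreover have "0 < s * (- \<mu> / 2)" using s neg by (simp add: \<mu>_def mult_pos_neg)
  ultimately show thesis using s ie by (intro that[of s "s * (- \<mu> / 2)"])
qed

text \<open>Exponential Markov inequality for \<open>f - a\<close>: independence turns the moment of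
  the sum into a power of a single moment, which \<open>exp_moment_less_1\<close> bounds by
  \<open>exp (- c)\<close>. One rate serves all \<open>J\<close>.\<close>

lemma chernoff_gauss:
  fixes f :: "real \<Rightarrow> real"
  assumes [measurable]: "f \<in> borel_measurable borel" and l: "0 < l"
    and int: "integrable std_normal (\<lambda>x. exp (l * \<bar>f x\<bar>))" and mean: "(\<integral>x. f x \<partial>std_normal) < a"
  obtains c where "0 < c" "\<And>J :: 'i set. finite J \<Longrightarrow>
    measure gauss {\<xi>. a * real (card J) \<le> (\<Sum>i\<in>J. f (\<xi> i))} \<le> exp (- c * real (card J))"
proof -
  have int': "integrable std_normal (\<lambda>x. exp (l * \<bar>f x - a\<bar>))"
  proof (rule Bochner_Integration.integrable_bound[of _ "\<lambda>x. exp (l * \<bar>a\<bar>) * exp (l * \<bar>f x\<bar>)"])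
    show "AE x in std_normal. norm (exp (l * \<bar>f x - a\<bar>)) \<le> norm (exp (l * \<bar>a\<bar>) * exp (l * \<bar>f x\<bar>))"
    proof (intro AE_I2)
      fix x
      have "l * \<bar>f x - a\<bar> \<le> l * (\<bar>a\<bar> + \<bar>f x\<bar>)" using l by (intro mult_left_mono) auto
      then show "norm (exp (l * \<bar>f x - a\<bar>)) \<le> norm (exp (l * \<bar>a\<bar>) * exp (l * \<bar>f x\<bar>))"
        by (simp add: exp_add[symmetric] distrib_left)
    qed
  qed (use int in auto)
  have intf: "integrable std_normal f"
    using assms(1) l int by (rule integrable_if_exp_abs_integrable)
  have "(\<integral>x. f x - a \<partial>std_normal) < 0" using intf mean std_normal.prob_space by simp
  then obtain s c where s: "0 < s" and c: "0 < c" and ies: "integrable std_normal (\<lambda>x. exp (s * (f x - a)))"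
    and le: "(\<integral>x. exp (s * (f x - a)) \<partial>std_normal) \<le> exp (- c)"
    using exp_moment_less_1[OF _ l int'] by auto
  have "measure gauss {\<xi>. a * real (card J) \<le> (\<Sum>i\<in>J. f (\<xi> i))} \<le> exp (- c * real (card J))"
    if J: "finite J" for J :: "'i set"
  proof -
    let ?E = "{\<xi> :: 'i \<Rightarrow> real. a * real (card J) \<le> (\<Sum>i\<in>J. f (\<xi> i))}"
    have mE: "?E \<in> sets gauss" by (rule sets_gauss_CollectI) measurable
    have "emeasure gauss ?E = (\<integral>\<^sup>+\<xi>. indicator ?E \<xi> \<partial>gauss)" using mE by simp
    also have "\<dots> \<le> (\<integral>\<^sup>+\<xi>. (\<Prod>i\<in>J. ennreal (exp (s * (f (\<xi> i) - a)))) \<partial>gauss)"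
    proof (intro nn_integral_mono)
      fix \<xi> :: "'i \<Rightarrow> real"
      have p: "(\<Prod>i\<in>J. ennreal (exp (s * (f (\<xi> i) - a)))) = ennreal (exp (s * ((\<Sum>i\<in>J. f (\<xi> i)) - a * real (card J))))"
        by (simp add: prod_ennreal exp_sum[OF J, symmetric] sum_distrib_left[symmetric] sum_subtractf mult.commute)
      show "indicator ?E \<xi> \<le> (\<Prod>i\<in>J. ennreal (exp (s * (f (\<xi> i) - a))))"
      proof (cases "\<xi> \<in> ?E")
        case True
        then have "0 \<le> s * ((\<Sum>i\<in>J. f (\<xi> i)) - a * real (card J))" using s by simp
        then have "1 \<le> exp (s * ((\<Sum>i\<in>J. f (\<xi> i)) - a * real (card J)))" by simp
        then show ?thesis using True unfolding p by (simp del: one_le_exp_iff)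
      qed simp
    qed
    also have "\<dots> = (\<Prod>i\<in>J. \<integral>\<^sup>+x. ennreal (exp (s * (f x - a))) \<partial>std_normal)"
      by (rule nn_integral_gauss_prod[OF J]) auto
    also have "\<dots> = ennreal (\<integral>x. exp (s * (f x - a)) \<partial>std_normal) ^ card J"
      using ies by (simp add: nn_integral_eq_integral)
    also have "\<dots> \<le> ennreal (exp (- c)) ^ card J"
      by (intro power_mono ennreal_leI le) auto
    also have "\<dots> = ennreal (exp (- c * real (card J)))"
      by (simp add: ennreal_power exp_of_nat_mult[symmetric] mult.commute)
    finally show ?thesis by (simp add: gauss.emeasure_eq_measure)
  qed
  with c show thesis by (rule that)
qed

text \<open>Multiplied by the standard density, the integrand is \<open>sqrt 2\<close> times the
  centred normal density of variance 2.\<close>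

lemma integrable_exp_quarter_sq: "integrable std_normal (\<lambda>x. exp (x\<^sup>2 / 4))"
proof -
  have "integrable lborel (\<lambda>x. std_normal_density x * exp (x\<^sup>2 / 4))"
  proof -
    have "std_normal_density x * exp (x\<^sup>2 / 4) = sqrt 2 * normal_density 0 (sqrt 2) x" for x
    proof -
      have "exp (- x\<^sup>2 / 2) * exp (x\<^sup>2 / 4) = exp (- x\<^sup>2 / 4)" by (simp add: exp_add[symmetric])
      then show ?thesis by (simp add: normal_density_def real_sqrt_mult field_simps)
    qed
    then show ?thesis by simp
  qed
  then show ?thesis
    unfolding std_normal_def by (subst integrable_real_density) auto
qed

lemma std_normal_singleton: "measure std_normal {x} = 0"
proof -
  have "emeasure std_normal {x} = 0"
    unfolding std_normal_def by (subst emeasure_density) (auto simp: nn_integral_0_iff_AE intro!: AE_I'[of "{x}"])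
  then show ?thesis by (simp add: measure_def)
qed

text \<open>The two-sided tail is continuous and strictly decreasing on the nonnegative reals, from
  1 at 0 to the limit 0, so the description defining \<open>c_nu\<close> has exactly one solution,
  and \<open>\<beta> < 1\<close> makes it positive.\<close>

lemma c_nu_props:
  assumes "0 < \<beta>" "\<beta> < 1"
  shows "0 < c_nu \<beta>" "measure std_normal {h. c_nu \<beta> \<le> \<bar>h\<bar>} = \<beta>"
proof -
  interpret R: real_distribution std_normal
    by unfold_locales auto
  define G where "G c = measure std_normal {h. c \<le> \<bar>h\<bar>}" for c :: real
  have cont: "continuous_on UNIV (cdf std_normal)"
    by (simp add: continuous_on_eq_continuous_at R.isCont_cdf std_normal_singleton)
  have G_eq: "G c = 1 - cdf std_normal c + cdf std_normal (- c)" if "0 \<le> c" for c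
  proof -
    have "G c = measure std_normal {c..} + measure std_normal {..-c} - measure std_normal ({c..} \<inter> {..-c})"
    proof -
      have "{h. c \<le> \<bar>h\<bar>} = {c..} \<union> {..-c}" by auto
      then show ?thesis unfolding G_def by (simp add: measure_Un3 std_normal.fmeasurable_eq_sets)
    qed
    moreover have "measure std_normal ({c..} \<inter> {..-c}) = 0"
    proof -
      have "{c..} \<inter> {..-c} \<subseteq> {0}" using that by auto
      from std_normal.finite_measure_mono[OF this] show ?thesis by (simp add: std_normal_singleton measure_le_0_iff)
    qed
    moreover have "measure std_normal {c..} = 1 - cdf std_normal c"
    proof -
      have "measure std_normal {c..} = measure std_normal {c<..} + measure std_normal {c}"
        by (subst std_normal.finite_measure_Union[symmetric]) (auto intro!: arg_cong[where f="measure _"])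
      also have "measure std_normal {c<..} = 1 - measure std_normal {..c}"
        using std_normal.prob_compl[of "{..c}"] by (simp add: Compl_eq_Diff_UNIV[symmetric])
      finally show ?thesis by (simp add: std_normal_singleton cdf_def)
    qed
    ultimately show ?thesis by (simp add: cdf_def)
  qed
  have contG: "continuous_on {0..} G"
    by (subst continuous_on_cong[OF refl G_eq])
       (auto intro!: continuous_intros continuous_on_compose2[OF cont])
  have G0: "G 0 = 1" unfolding G_def using std_normal.prob_space by simp
  have "(G \<longlongrightarrow> 1 - 1 + 0) at_top"
  proof (rule Lim_transform_eventually)
    show "((\<lambda>c. 1 - cdf std_normal c + cdf std_normal (- c)) \<longlongrightarrow> 1 - 1 + 0) at_top"
      by (intro tendsto_intros R.cdf_lim_at_top_prob filterlim_compose[OF R.cdf_lim_at_bot filterlim_uminus_at_bot_at_top])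
    show "\<forall>\<^sub>F c in at_top. 1 - cdf std_normal c + cdf std_normal (- c) = G c"
      using eventually_ge_at_top[of 0] by eventually_elim (simp add: G_eq)
  qed
  then have "\<forall>\<^sub>F c in at_top. G c < \<beta>" using assms by (intro order_tendstoD(2)) auto
  then obtain d where d: "G d < \<beta>" "0 \<le> d"
    using eventually_happens'[OF _ eventually_conj[OF _ eventually_ge_at_top[of 0]]] by fastforce
  obtain c where c: "0 \<le> c" "G c = \<beta>"
    using IVT2'[of G d \<beta> 0] d assms G0 continuous_on_subset[OF contG, of "{0..d}"] by auto
  have less: "G y < G x" if "0 \<le> x" "x < y" for x y
  proof -
    have "G x = G y + measure std_normal {h. x \<le> \<bar>h\<bar> \<and> \<bar>h\<bar> < y}"
      unfolding G_def using that
      by (subst std_normal.finite_measure_Union[symmetric]) (auto intro!: arg_cong[where f="measure _"])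
    moreover have "0 < measure std_normal {h. x \<le> \<bar>h\<bar> \<and> \<bar>h\<bar> < y}"
      using that by (intro std_normal_pos[of x y]) auto
    ultimately show ?thesis by simp
  qed
  have "c_nu \<beta> = c"
    unfolding c_nu_def G_def[symmetric]
  proof (rule the_equality)
    show "0 \<le> c \<and> G c = \<beta>" using c by simp
    fix x assume x: "0 \<le> x \<and> G x = \<beta>"
    show "x = c" using less[of x c] less[of c x] x c by (cases x c rule: linorder_cases) auto
  qed
  moreover have "c \<noteq> 0" using c G0 assms by auto
  ultimately show "0 < c_nu \<beta>" "measure std_normal {h. c_nu \<beta> \<le> \<bar>h\<bar>} = \<beta>"
    using c by (auto simp: G_def)
qed

section \<open>Width of the error cone\<close>

lemma qpow_nonneg: "0 \<le> qpow q t"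
  by (simp add: qpow_def)

lemma qpow_le: "0 \<le> q \<Longrightarrow> q \<le> 1 \<Longrightarrow> qpow q t \<le> 1 + \<bar>t\<bar>"
proof -
  assume q: "0 \<le> q" "q \<le> 1"
  have "\<bar>t\<bar> powr q \<le> 1 + \<bar>t\<bar>"
  proof (cases "\<bar>t\<bar> \<le> 1")
    case True
    then show ?thesis using powr_le1[of q "\<bar>t\<bar>"] q by (cases "t = 0") auto
  next
    case False
    then have "\<bar>t\<bar> powr q \<le> \<bar>t\<bar> powr 1" using q by (intro powr_mono) auto
    then show ?thesis using False by simp
  qed
  then show ?thesis by (simp add: qpow_def)
qed

text \<open>Divided by \<open>a + b\<close>, the two arguments lie in \<open>[0, 1]\<close>, where
  \<open>x \<le> x powr q\<close>, and sum to 1.\<close>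

lemma powr_subadditive:
  fixes a b q :: real
  assumes "0 \<le> a" "0 \<le> b" "0 < q" "q \<le> 1"
  shows "(a + b) powr q \<le> a powr q + b powr q"
proof (cases "a + b = 0")
  case False
  define s where "s = a + b"
  have s: "0 < s" using False assms by (simp add: s_def)
  have "x / s \<le> (x / s) powr q" if "0 \<le> x" "x \<le> s" for x
  proof (cases "x = 0")
    case False
    then have "(x / s) powr 1 \<le> (x / s) powr q" using that s assms by (intro powr_mono') auto
    then show ?thesis using that s by simp
  qed simp
  then have "a / s \<le> (a / s) powr q" "b / s \<le> (b / s) powr q" using assms by (simp_all add: s_def)
  moreover have "a / s + b / s = 1" using s by (simp add: s_def add_divide_distrib[symmetric])
  ultimately have "1 \<le> (a / s) powr q + (b / s) powr q" by linarith
  then have "1 \<le> (a powr q + b powr q) / s powr q"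
    using s assms by (simp add: powr_divide add_divide_distrib)
  then show ?thesis using s by (simp add: s_def[symmetric])
qed (use assms in auto)

lemma qpow_triangle: "0 \<le> q \<Longrightarrow> q \<le> 1 \<Longrightarrow> qpow q (x + y) \<le> qpow q x + qpow q y"
proof (cases "q = 0")
  case False
  assume q: "0 \<le> q" "q \<le> 1"
  have "\<bar>x + y\<bar> powr q \<le> (\<bar>x\<bar> + \<bar>y\<bar>) powr q" using q by (intro powr_mono2) auto
  also have "\<dots> \<le> \<bar>x\<bar> powr q + \<bar>y\<bar> powr q" using q False by (intro powr_subadditive) auto
  finally show ?thesis using False by (simp add: qpow_def)
qed (auto simp: qpow_def)

lemma qpow_scale: "0 < s \<Longrightarrow> qpow q (s * t) = s powr q * qpow q t"
  by (auto simp: qpow_def abs_mult powr_mult)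

lemma qpow_minus: "qpow q (- t) = qpow q t"
  by (simp add: qpow_def)

text \<open>Off the support of \<open>xt\<close> the error is \<open>x\<close> itself; on the
  support the triangle inequality bounds the decrease of \<open>qpow\<close> from \<open>xt\<close>
  to \<open>x\<close> by that of the error.\<close>

lemma sparse_error_cone:
  assumes q: "0 \<le> q" "q \<le> 1" and le: "lq_q q n x \<le> lq_q q n xt"
  shows "(\<Sum>j\<in>{..<n} - {j\<in>{0..<n}. xt j \<noteq> 0}. qpow q (x j - xt j)) \<le> (\<Sum>j\<in>{j\<in>{0..<n}. xt j \<noteq> 0}. qpow q (x j - xt j))"
proof -
  let ?K = "{j\<in>{0..<n}. xt j \<noteq> 0}"
  have K: "?K \<subseteq> {..<n}" by auto
  have split: "lq_q q n z = (\<Sum>j\<in>{..<n} - ?K. qpow q (z j)) + (\<Sum>j\<in>?K. qpow q (z j))" for z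
    unfolding lq_q_def by (rule sum.subset_diff[OF K]) simp
  have "(\<Sum>j\<in>{..<n} - ?K. qpow q (xt j)) = 0" by (intro sum.neutral) (auto simp: qpow_def)
  moreover have "(\<Sum>j\<in>{..<n} - ?K. qpow q (x j)) = (\<Sum>j\<in>{..<n} - ?K. qpow q (x j - xt j))"
    by (intro sum.cong) auto
  moreover have "(\<Sum>j\<in>?K. qpow q (xt j)) \<le> (\<Sum>j\<in>?K. qpow q (x j) + qpow q (x j - xt j))"
  proof (intro sum_mono)
    fix j
    show "qpow q (xt j) \<le> qpow q (x j) + qpow q (x j - xt j)"
      using qpow_triangle[OF q, of "x j" "- (x j - xt j)"] by (simp only: qpow_minus) simp
  qed
  ultimately show ?thesis using le unfolding split sum.distrib by linarith
qed

definition error_cone :: "real \<Rightarrow> nat \<Rightarrow> nat \<Rightarrow> (nat \<Rightarrow> real) set" where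
  "error_cone q n k = {w. (\<Sum>j<n. (w j)\<^sup>2) = 1 \<and>
     (\<exists>K\<subseteq>{..<n}. card K \<le> k \<and> (\<Sum>j\<in>{..<n} - K. qpow q (w j)) \<le> (\<Sum>j\<in>K. qpow q (w j)))}"

text \<open>The error of a failed recovery lies in the kernel. Normalising it preserves the cone
  condition because \<open>qpow q\<close> is homogeneous of degree \<open>q\<close>, also for
  \<open>q = 0\<close>.\<close>

lemma not_recovery_cone:
  assumes q: "0 \<le> q" "q \<le> 1" and "\<not> strong_recovery q m n k A"
  obtains w where "w \<in> error_cone q n k" "\<And>i. i < m \<Longrightarrow> (\<Sum>j<n. w j * A (i, j)) = 0"
proof -
  from assms(3) obtain xt x j0 where sp: "sparse n k xt"
    and eq: "\<And>i. i < m \<Longrightarrow> mat_vec n A x i = mat_vec n A xt i" and j0: "j0 < n" "x j0 \<noteq> xt j0"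
    and le: "lq_q q n x \<le> lq_q q n xt"
    unfolding strong_recovery_def not_less[symmetric] by blast
  define K where "K = {j\<in>{0..<n}. xt j \<noteq> 0}"
  define d where "d = (\<Sum>j<n. (x j - xt j)\<^sup>2)"
  define s where "s = 1 / sqrt d"
  define w where "w j = s * (x j - xt j)" for j
  have "0 < (x j0 - xt j0)\<^sup>2" using j0 by simp
  also have "\<dots> \<le> d" unfolding d_def using j0 by (intro member_le_sum) auto
  finally have d: "0 < d" .
  then have s: "0 < s" by (simp add: s_def)
  have "(\<Sum>j<n. (w j)\<^sup>2) = s\<^sup>2 * d" by (simp add: w_def d_def power_mult_distrib sum_distrib_left)
  then have u: "(\<Sum>j<n. (w j)\<^sup>2) = 1" using d by (simp add: s_def power_divide)
  have "(\<Sum>j\<in>{..<n} - K. qpow q (w j)) \<le> (\<Sum>j\<in>K. qpow q (w j))"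
    using sparse_error_cone[OF q le] s
    unfolding w_def K_def qpow_scale[OF s] sum_distrib_left[symmetric] by (simp add: mult_left_mono)
  then have "w \<in> error_cone q n k"
    using u sp unfolding error_cone_def sparse_def K_def[symmetric] by (auto intro!: exI[of _ K] simp: K_def)
  moreover have "(\<Sum>j<n. w j * A (i, j)) = 0" if "i < m" for i
  proof -
    have "(\<Sum>j<n. w j * A (i, j)) = s * (mat_vec n A x i - mat_vec n A xt i)"
      by (simp add: w_def mat_vec_def sum_distrib_left sum_subtractf[symmetric] algebra_simps)
    then show ?thesis using eq[OF that] by simp
  qed
  ultimately show thesis by (rule that)
qed

text \<open>For \<open>\<gamma> > 0\<close> the quadratic term makes both inner suprema finite real
  numbers; \<open>I1_str_zero_gamma\<close> disposes of \<open>\<gamma> = 0\<close>. Below,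
  \<open>up\<close> serves the coordinates of the large part and \<open>lo\<close> the
  others.\<close>

locale inner_max =
  fixes q \<nu> \<gamma> :: real
  assumes q: "0 \<le> q" "q \<le> 1" and nu: "0 \<le> \<nu>" and ga: "0 < \<gamma>"
begin

definition uterm :: "real \<Rightarrow> real \<Rightarrow> real" where "uterm x w = x * \<bar>w\<bar> + \<nu> * qpow q w - \<gamma> * w\<^sup>2"
definition lterm :: "real \<Rightarrow> real \<Rightarrow> real" where "lterm x w = x * \<bar>w\<bar> - \<nu> * qpow q w - \<gamma> * w\<^sup>2"
definition up :: "real \<Rightarrow> real" where "up x = (SUP w. uterm x w)"
definition lo :: "real \<Rightarrow> real" where "lo x = (SUP w. lterm x w)"
definition bnd :: "real \<Rightarrow> real" where "bnd x = \<nu> + (\<bar>x\<bar> + \<nu>)\<^sup>2 / (4 * \<gamma>)"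
definition gap :: "real \<Rightarrow> real" where "gap x = up x - lo x"

lemma lterm_le_uterm: "lterm x w \<le> uterm x w"
  unfolding lterm_def uterm_def using nu qpow_nonneg[of q w] by simp

lemma uterm_le_bnd: "uterm x w \<le> bnd x"
proof -
  \<comment> \<open>Completes the square in \<open>\<bar>w\<bar>\<close>; the \<open>\<nu>\<close>
    in the linear coefficient comes from the bound \<open>qpow_le\<close>.\<close>
  have "0 \<le> (2 * \<gamma> * \<bar>w\<bar> - (\<bar>x\<bar> + \<nu>))\<^sup>2 / (4 * \<gamma>)" using ga by simp
  also have "\<dots> = \<gamma> * w\<^sup>2 - (\<bar>x\<bar> + \<nu>) * \<bar>w\<bar> + (\<bar>x\<bar> + \<nu>)\<^sup>2 / (4 * \<gamma>)"
    using ga by (simp add: power2_eq_square field_simps abs_mult_self_eq)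
  finally have "(\<bar>x\<bar> + \<nu>) * \<bar>w\<bar> - \<gamma> * w\<^sup>2 \<le> (\<bar>x\<bar> + \<nu>)\<^sup>2 / (4 * \<gamma>)" by simp
  moreover have "x * \<bar>w\<bar> \<le> \<bar>x\<bar> * \<bar>w\<bar>" by (intro mult_right_mono) auto
  moreover have "\<nu> * qpow q w \<le> \<nu> * (1 + \<bar>w\<bar>)" using nu qpow_le[OF q] by (intro mult_left_mono) auto
  ultimately show ?thesis unfolding uterm_def bnd_def by (simp add: algebra_simps)
qed

lemma bdd_uterm: "bdd_above (range (uterm x))" and bdd_lterm: "bdd_above (range (lterm x))"
  by (intro bdd_aboveI2[where M="bnd x"] uterm_le_bnd order_trans[OF lterm_le_uterm uterm_le_bnd])+

lemma uterm_le_up: "uterm x w \<le> up x" and lterm_le_lo: "lterm x w \<le> lo x"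
  unfolding up_def lo_def by (auto intro: cSUP_upper bdd_uterm bdd_lterm)

lemma up_le: "(\<And>w. uterm x w \<le> b) \<Longrightarrow> up x \<le> b" and lo_le: "(\<And>w. lterm x w \<le> b) \<Longrightarrow> lo x \<le> b"
  unfolding up_def lo_def by (auto intro: cSUP_least)

lemma lo_nonneg: "0 \<le> lo x"
  using lterm_le_lo[of x 0] by (simp add: lterm_def qpow_def split: if_splits)

lemma lo_le_up: "lo x \<le> up x"
  by (intro lo_le order_trans[OF lterm_le_uterm uterm_le_up])

lemma up_le_bnd: "up x \<le> bnd x"
  by (intro up_le uterm_le_bnd)

lemma up_mono: "x \<le> y \<Longrightarrow> up x \<le> up y"
proof -
  assume "x \<le> y"
  then have "uterm x w \<le> up y" for w
    using uterm_le_up[of y w] mult_right_mono[of x y "\<bar>w\<bar>"] by (simp add: uterm_def)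
  then show ?thesis by (rule up_le)
qed

lemma lo_mono: "x \<le> y \<Longrightarrow> lo x \<le> lo y"
proof -
  assume "x \<le> y"
  then have "lterm x w \<le> lo y" for w
    using lterm_le_lo[of y w] mult_right_mono[of x y "\<bar>w\<bar>"] by (simp add: lterm_def)
  then show ?thesis by (rule lo_le)
qed

lemma up_measurable [measurable]: "up \<in> borel_measurable borel"
  by (intro borel_measurable_mono monoI up_mono)

lemma lo_measurable [measurable]: "lo \<in> borel_measurable borel"
  by (intro borel_measurable_mono monoI lo_mono)

lemma qpow_mono: "\<bar>a\<bar> \<le> \<bar>b\<bar> \<Longrightarrow> qpow q a \<le> qpow q b"
  using q by (auto simp: qpow_def intro!: powr_mono2)

text \<open>Near-maximisers \<open>v\<close> of \<^term>\<open>up x\<close> and \<open>w\<close> of \<^term>\<open>lo y\<close> compete for \<^term>\<open>up y\<close> and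
  \<^term>\<open>lo x\<close> either as they are or interchanged, according to the order of \<^term>\<open>\<bar>v\<bar>\<close> and \<^term>\<open>\<bar>w\<bar>\<close>.\<close>
lemma gap_mono:
  assumes "x \<le> y"
  shows "gap x \<le> gap y"
proof -
  have key: "uterm x v + lterm y w \<le> up y + lo x" for v w
  proof (cases "\<bar>w\<bar> \<le> \<bar>v\<bar>")
    case True
    have "0 \<le> (y - x) * (\<bar>v\<bar> - \<bar>w\<bar>)" using True assms by simp
    then have "uterm x v + lterm y w \<le> uterm y v + lterm x w"
      unfolding uterm_def lterm_def by (simp add: algebra_simps)
    then show ?thesis using uterm_le_up[of y v] lterm_le_lo[of x w] by linarith
  next
    case False
    then have "\<nu> * qpow q v \<le> \<nu> * qpow q w" using nu by (intro mult_left_mono qpow_mono) auto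
    then have "uterm x v + lterm y w \<le> uterm y w + lterm x v"
      unfolding uterm_def lterm_def by simp
    then show ?thesis using uterm_le_up[of y w] lterm_le_lo[of x v] by linarith
  qed
  have "lo y \<le> up y + lo x - uterm x v" for v
    using key by (intro lo_le) (simp add: algebra_simps)
  then have "up x \<le> up y + lo x - lo y"
    by (intro up_le) (simp add: algebra_simps)
  then show ?thesis by (simp add: gap_def)
qed

lemma gap_nonneg: "0 \<le> gap x"
  using lo_le_up[of x] by (simp add: gap_def)

text \<open>Each member of the large part is charged the price \<open>gap c\<close>. Its cost
  \<open>up\<close> is at most \<open>excess c\<close> plus that price, and the cost
  \<open>lo\<close> of any other coordinate is at most \<open>excess c\<close>, so the choice of the
  part drops out.\<close>

definition excess :: "real \<Rightarrow> real \<Rightarrow> real" where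
  "excess c h = lo \<bar>h\<bar> + max 0 (gap \<bar>h\<bar> - gap c)"

lemma excess_measurable [measurable]: "excess c \<in> borel_measurable borel"
  unfolding excess_def gap_def by measurable

lemma excess_bounds: "0 \<le> excess c h" "excess c h \<le> bnd h"
proof -
  show "0 \<le> excess c h" using lo_nonneg[of "\<bar>h\<bar>"] by (simp add: excess_def)
  have "max 0 (gap \<bar>h\<bar> - gap c) \<le> gap \<bar>h\<bar>" using gap_nonneg[of c] gap_nonneg[of "\<bar>h\<bar>"] by auto
  then have "excess c h \<le> up \<bar>h\<bar>" unfolding excess_def gap_def by linarith
  also have "\<dots> \<le> bnd \<bar>h\<bar>" by (rule up_le_bnd)
  finally show "excess c h \<le> bnd h" by (simp add: bnd_def)
qed

lemma integrable_exp_excess: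
  obtains l where "0 < l" "integrable std_normal (\<lambda>x. exp (l * \<bar>excess c x\<bar>))"
proof
  let ?A = "\<nu> + \<nu>\<^sup>2 / (2 * \<gamma>)"
  have b: "bnd x \<le> ?A + x\<^sup>2 / (2 * \<gamma>)" for x
  proof -
    have "0 \<le> (\<bar>x\<bar> - \<nu>)\<^sup>2" by simp
    then have "(\<bar>x\<bar> + \<nu>)\<^sup>2 \<le> 2 * \<nu>\<^sup>2 + 2 * x\<^sup>2" by (simp add: power2_eq_square algebra_simps)
    then have "(\<bar>x\<bar> + \<nu>)\<^sup>2 / (4 * \<gamma>) \<le> (2 * \<nu>\<^sup>2 + 2 * x\<^sup>2) / (4 * \<gamma>)" using ga by (intro divide_right_mono) auto
    also have "\<dots> = \<nu>\<^sup>2 / (2 * \<gamma>) + x\<^sup>2 / (2 * \<gamma>)" using ga by (simp add: field_simps)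
    finally show ?thesis unfolding bnd_def by linarith
  qed
  \<comment> \<open>This rate turns the growth \<open>x\<^sup>2 / (2 * \<gamma>)\<close> of the
    bound into \<open>x\<^sup>2 / 4\<close>, the exponent of
    \<open>integrable_exp_quarter_sq\<close>.\<close>
  show l: "0 < \<gamma> / 2" using ga by simp
  show "integrable std_normal (\<lambda>x. exp (\<gamma> / 2 * \<bar>excess c x\<bar>))"
  proof (rule Bochner_Integration.integrable_bound)
    show "integrable std_normal (\<lambda>x. exp (\<gamma> / 2 * ?A) * exp (x\<^sup>2 / 4))"
      using integrable_exp_quarter_sq by (rule integrable_mult_right)
    show "AE x in std_normal. norm (exp (\<gamma> / 2 * \<bar>excess c x\<bar>)) \<le> norm (exp (\<gamma> / 2 * ?A) * exp (x\<^sup>2 / 4))"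
    proof (intro AE_I2)
      fix x
      have "\<bar>excess c x\<bar> \<le> ?A + x\<^sup>2 / (2 * \<gamma>)" using excess_bounds[of c x] b[of x] by linarith
      then have "\<gamma> / 2 * \<bar>excess c x\<bar> \<le> \<gamma> / 2 * (?A + x\<^sup>2 / (2 * \<gamma>))" using ga by (intro mult_left_mono) auto
      also have "\<dots> = \<gamma> / 2 * ?A + x\<^sup>2 / 4" using ga by (simp add: field_simps)
      finally show "norm (exp (\<gamma> / 2 * \<bar>excess c x\<bar>)) \<le> norm (exp (\<gamma> / 2 * ?A) * exp (x\<^sup>2 / 4))"
        by (simp add: exp_add[symmetric])
    qed
  qed auto
qed

text \<open>Links the real suprema to those in \<open>I1_str\<close> and \<open>I2_str\<close>,
  which truncate negative values to 0 and could a priori be infinite.\<close>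

lemma ennreal_up_le: "ennreal (up x) \<le> (SUP w. ennreal (x * \<bar>w\<bar> + \<nu> * qpow q w - \<gamma> * w\<^sup>2))" (is "_ \<le> ?S")
  and ennreal_lo_le: "ennreal (lo x) \<le> (SUP w. ennreal (x * \<bar>w\<bar> - \<nu> * qpow q w - \<gamma> * w\<^sup>2))" (is "_ \<le> ?T")
proof -
  have *: "ennreal b \<le> s" if fs: "\<And>w. ennreal (f w) \<le> s" and least: "\<And>c. (\<And>w. f w \<le> c) \<Longrightarrow> b \<le> c"
    for f :: "real \<Rightarrow> real" and b s
  proof (cases s)
    case (real r)
    have "f w \<le> r" for w
    proof (cases "0 \<le> f w")
      case True
      then show ?thesis using fs[of w] real by (simp add: ennreal_le_iff)
    next
      case False
      then show ?thesis using real by simp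
    qed
    from least[OF this] show ?thesis unfolding real(2) by (rule ennreal_leI)
  qed simp
  show "ennreal (up x) \<le> ?S"
  proof (rule *)
    show "ennreal (uterm x w) \<le> ?S" for w unfolding uterm_def by (rule SUP_upper) simp
  qed (rule up_le)
  show "ennreal (lo x) \<le> ?T"
  proof (rule *)
    show "ennreal (lterm x w) \<le> ?T" for w unfolding lterm_def by (rule SUP_upper) simp
  qed (rule lo_le)
qed

text \<open>By \<open>gap_mono\<close> the positive part in \<open>excess\<close> equals
  \<open>gap \<bar>h\<bar> - gap c\<close> above the threshold \<open>c\<close> and vanishes below
  it.\<close>

lemma excess_split:
  "ennreal (excess c h + gap c * indicator {h. c \<le> \<bar>h\<bar>} h) =
    indicator {h. c \<le> \<bar>h\<bar>} h * ennreal (up \<bar>h\<bar>) + indicator {h. \<bar>h\<bar> < c} h * ennreal (lo \<bar>h\<bar>)"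
proof (cases "c \<le> \<bar>h\<bar>")
  case True
  have "excess c h + gap c = up \<bar>h\<bar>"
    using gap_mono[OF True] unfolding excess_def by (subst max_absorb2) (simp_all add: gap_def)
  moreover have "indicator {h. c \<le> \<bar>h\<bar>} h = (1::real)" "indicator {h. c \<le> \<bar>h\<bar>} h = (1::ennreal)"
    "indicator {h. \<bar>h\<bar> < c} h = (0::ennreal)"
    using True by auto
  ultimately show ?thesis by (simp only: mult_1_left mult_1_right mult_zero_left add_0_right)
next
  case False
  then have "gap \<bar>h\<bar> \<le> gap c" by (intro gap_mono) simp
  then have "excess c h = lo \<bar>h\<bar>" unfolding excess_def by (subst max_absorb1) simp_all
  moreover have "indicator {h. c \<le> \<bar>h\<bar>} h = (0::real)" "indicator {h. c \<le> \<bar>h\<bar>} h = (0::ennreal)"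
    "indicator {h. \<bar>h\<bar> < c} h = (1::ennreal)"
    using False by auto
  ultimately show ?thesis by (simp only: mult_1_left mult_zero_right mult_zero_left add_0_right add_0_left)
qed

text \<open>Integrates \<open>excess_split\<close> at the threshold exceeded with probability
  \<open>\<beta>\<close>: on average, making the bound uniform over the large part loses nothing
  against the two given integrals.\<close>

lemma excess_mean:
  assumes \<beta>: "0 < \<beta>" "\<beta> < 1"
  shows "ennreal ((\<integral>h. excess (c_nu \<beta>) h \<partial>std_normal) + gap (c_nu \<beta>) * \<beta>) \<le> I1_str q \<beta> \<nu> \<gamma> + I2_str q \<beta> \<nu> \<gamma>"
proof -
  let ?c = "c_nu \<beta>"
  let ?A = "{h. ?c \<le> \<bar>h\<bar>}" and ?B = "{h. \<bar>h\<bar> < ?c}"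
  note c = c_nu_props[OF \<beta>]
  have [measurable]: "?A \<in> sets borel" "?B \<in> sets borel" by measurable
  obtain l where l: "0 < l" "integrable std_normal (\<lambda>x. exp (l * \<bar>excess ?c x\<bar>))"
    using integrable_exp_excess by blast
  have int: "integrable std_normal (excess ?c)"
    using excess_measurable l by (rule integrable_if_exp_abs_integrable)
  have iA: "integrable std_normal (\<lambda>h. gap ?c * indicator ?A h :: real)"
    by (intro integrable_mult_right integrable_real_indicator) (auto simp: std_normal.emeasure_eq_measure)
  have "(\<integral>h. excess ?c h \<partial>std_normal) + gap ?c * \<beta> = (\<integral>h. excess ?c h + gap ?c * indicator ?A h \<partial>std_normal)"
    using int iA c(2) by simp
  then have "ennreal ((\<integral>h. excess ?c h \<partial>std_normal) + gap ?c * \<beta>) =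
      ennreal (\<integral>h. excess ?c h + gap ?c * indicator ?A h \<partial>std_normal)"
    by (rule arg_cong)
  also have "\<dots> = (\<integral>\<^sup>+h. ennreal (excess ?c h + gap ?c * indicator ?A h) \<partial>std_normal)"
    using int iA excess_bounds(1) gap_nonneg
    by (intro nn_integral_eq_integral[symmetric]) auto
  also have "\<dots> = (\<integral>\<^sup>+h. indicator ?A h * ennreal (up \<bar>h\<bar>) + indicator ?B h * ennreal (lo \<bar>h\<bar>) \<partial>std_normal)"
    by (intro nn_integral_cong excess_split)
  also have "\<dots> = (\<integral>\<^sup>+h. indicator ?A h * ennreal (up \<bar>h\<bar>) \<partial>std_normal) + (\<integral>\<^sup>+h. indicator ?B h * ennreal (lo \<bar>h\<bar>) \<partial>std_normal)"
    by (intro nn_integral_add) auto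
  also have "\<dots> \<le> I1_str q \<beta> \<nu> \<gamma> + I2_str q \<beta> \<nu> \<gamma>"
  proof (rule add_mono)
    show "(\<integral>\<^sup>+h. indicator ?A h * ennreal (up \<bar>h\<bar>) \<partial>std_normal) \<le> I1_str q \<beta> \<nu> \<gamma>"
      unfolding I1_str_def by (intro nn_integral_mono mult_left_mono ennreal_up_le) simp
    show "(\<integral>\<^sup>+h. indicator ?B h * ennreal (lo \<bar>h\<bar>) \<partial>std_normal) \<le> I2_str q \<beta> \<nu> \<gamma>"
      unfolding I2_str_def
    proof (intro nn_integral_mono mult_mono ennreal_lo_le)
      fix h
      show "indicator ?B h \<le> (indicator {h. \<bar>h\<bar> \<le> ?c} h :: ennreal)"
        by (simp add: indicator_def)
    qed simp_all
  qed
  finally show ?thesis .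
qed

text \<open>Weak duality: every coordinate is bounded by its inner maximum, the
  \<open>\<nu>\<close>-terms have a favourable sign by the cone condition, and the
  \<open>\<gamma>\<close>-terms are fixed by the normalisation. The bound no longer mentions
  \<open>w\<close>.\<close>

lemma cone_inner_bound:
  assumes w: "w \<in> error_cone q n k"
  shows "sqrt (real n) * \<bar>\<Sum>j<n. w j * h j\<bar> \<le> (\<Sum>j<n. excess c (h j)) + real k * gap c + \<gamma> * real n"
proof -
  from w obtain K where unit: "(\<Sum>j<n. (w j)\<^sup>2) = 1" and K: "K \<subseteq> {..<n}" "card K \<le> k"
    and cone: "(\<Sum>j\<in>{..<n} - K. qpow q (w j)) \<le> (\<Sum>j\<in>K. qpow q (w j))"
    unfolding error_cone_def by auto
  have n: "0 < n" using unit by (cases "n = 0") auto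
  \<comment> \<open>The inner maxima are applied to \<open>s * w\<close>, whose squared norm is
    \<open>n\<close>, so that coordinates have order one on average.\<close>
  define s where "s = sqrt (real n)"
  have s: "0 < s" and s2: "s\<^sup>2 = real n" using n by (auto simp: s_def)
  let ?Kc = "{..<n} - K"
  have split: "(\<Sum>j<n. f j) = (\<Sum>j\<in>?Kc. f j) + (\<Sum>j\<in>K. f j)" for f :: "nat \<Rightarrow> real"
    by (rule sum.subset_diff[OF K(1)]) simp
  define P where "P = (\<Sum>j\<in>K. qpow q (s * w j)) - (\<Sum>j\<in>?Kc. qpow q (s * w j))"
  have P: "0 \<le> P"
    unfolding P_def qpow_scale[OF s] sum_distrib_left[symmetric] using cone by (simp add: mult_left_mono)
  have "s * \<bar>\<Sum>j<n. w j * h j\<bar> \<le> s * (\<Sum>j<n. \<bar>w j * h j\<bar>)"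
    using s by (intro mult_left_mono sum_abs) auto
  also have "\<dots> = (\<Sum>j<n. \<bar>h j\<bar> * \<bar>s * w j\<bar>)"
    using s by (simp add: sum_distrib_left abs_mult mult_ac)
  also have "\<dots> = (\<Sum>j\<in>?Kc. \<bar>h j\<bar> * \<bar>s * w j\<bar>) + (\<Sum>j\<in>K. \<bar>h j\<bar> * \<bar>s * w j\<bar>)" by (rule split)
  also have "\<dots> \<le> (\<Sum>j\<in>?Kc. lo \<bar>h j\<bar> + \<nu> * qpow q (s * w j) + \<gamma> * (s * w j)\<^sup>2) +
     (\<Sum>j\<in>K. up \<bar>h j\<bar> - \<nu> * qpow q (s * w j) + \<gamma> * (s * w j)\<^sup>2)"
  proof (intro add_mono sum_mono)
    fix j
    show "\<bar>h j\<bar> * \<bar>s * w j\<bar> \<le> lo \<bar>h j\<bar> + \<nu> * qpow q (s * w j) + \<gamma> * (s * w j)\<^sup>2"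
      using lterm_le_lo[of "\<bar>h j\<bar>" "s * w j"] by (simp add: lterm_def)
    show "\<bar>h j\<bar> * \<bar>s * w j\<bar> \<le> up \<bar>h j\<bar> - \<nu> * qpow q (s * w j) + \<gamma> * (s * w j)\<^sup>2"
      using uterm_le_up[of "\<bar>h j\<bar>" "s * w j"] by (simp add: uterm_def)
  qed
  also have "\<dots> = (\<Sum>j\<in>?Kc. lo \<bar>h j\<bar>) + (\<Sum>j\<in>K. up \<bar>h j\<bar>) - \<nu> * P + \<gamma> * (\<Sum>j<n. (s * w j)\<^sup>2)"
    unfolding split[of "\<lambda>j. (s * w j)\<^sup>2"] P_def
    by (simp add: sum.distrib sum_subtractf sum_distrib_left[symmetric] algebra_simps)
  also have "(\<Sum>j<n. (s * w j)\<^sup>2) = real n"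
    using unit s2 by (simp add: power_mult_distrib sum_distrib_left[symmetric])
  also have "(\<Sum>j\<in>?Kc. lo \<bar>h j\<bar>) + (\<Sum>j\<in>K. up \<bar>h j\<bar>) - \<nu> * P + \<gamma> * real n \<le>
      (\<Sum>j\<in>?Kc. lo \<bar>h j\<bar>) + (\<Sum>j\<in>K. up \<bar>h j\<bar>) + \<gamma> * real n"
    using P nu by simp
  also have "(\<Sum>j\<in>?Kc. lo \<bar>h j\<bar>) + (\<Sum>j\<in>K. up \<bar>h j\<bar>) \<le> (\<Sum>j\<in>?Kc. excess c (h j)) + (\<Sum>j\<in>K. excess c (h j) + gap c)"
    by (intro add_mono sum_mono) (auto simp: excess_def gap_def)
  also have "\<dots> = (\<Sum>j<n. excess c (h j)) + real (card K) * gap c"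
    unfolding split by (simp add: sum.distrib)
  also have "\<dots> \<le> (\<Sum>j<n. excess c (h j)) + real k * gap c"
    using K(2) gap_nonneg[of c] by (intro add_left_mono mult_right_mono) auto
  finally show ?thesis by (simp add: s_def)
qed

end

text \<open>For \<open>\<gamma> = 0\<close> the inner objective grows at least linearly in
  \<open>\<bar>w\<bar>\<close> on an event of probability \<open>\<beta>\<close>, so a pair of
  finite value has positive \<open>\<gamma>\<close>.\<close>

lemma I1_str_zero_gamma:
  assumes \<beta>: "0 < \<beta>" "\<beta> < 1" and nu: "0 \<le> \<nu>"
  shows "I1_str q \<beta> \<nu> 0 = \<top>"
proof -
  let ?A = "{h. c_nu \<beta> \<le> \<bar>h\<bar>}"
  note c = c_nu_props[OF \<beta>]
  have top: "(SUP w. ennreal (\<bar>h\<bar> * \<bar>w\<bar> + \<nu> * qpow q w - 0 * w\<^sup>2)) = \<top>" if "c_nu \<beta> \<le> \<bar>h\<bar>" for h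
  proof (rule ennreal_SUP_eq_top)
    fix k :: nat
    have h: "0 < \<bar>h\<bar>" using that c by linarith
    have "real k \<le> \<bar>h\<bar> * \<bar>real k / \<bar>h\<bar>\<bar> + \<nu> * qpow q (real k / \<bar>h\<bar>)"
      using h nu qpow_nonneg[of q "real k / \<bar>h\<bar>"] by simp
    then have "ennreal (real k) \<le> ennreal (\<bar>h\<bar> * \<bar>real k / \<bar>h\<bar>\<bar> + \<nu> * qpow q (real k / \<bar>h\<bar>) - 0 * (real k / \<bar>h\<bar>)\<^sup>2)"
      by (intro ennreal_leI) simp
    then show "\<exists>i\<in>UNIV. of_nat k \<le> ennreal (\<bar>h\<bar> * \<bar>i\<bar> + \<nu> * qpow q i - 0 * i\<^sup>2)"
      unfolding ennreal_of_nat_eq_real_of_nat by (rule bexI) simp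
  qed
  have "I1_str q \<beta> \<nu> 0 = (\<integral>\<^sup>+h. \<top> * indicator ?A h \<partial>std_normal)"
    unfolding I1_str_def
  proof (intro nn_integral_cong)
    fix h
    show "indicator ?A h * (SUP w. ennreal (\<bar>h\<bar> * \<bar>w\<bar> + \<nu> * qpow q w - 0 * w\<^sup>2)) = \<top> * indicator ?A h"
    proof (cases "c_nu \<beta> \<le> \<bar>h\<bar>")
      case True
      show ?thesis unfolding top[OF True] by (rule mult.commute)
    qed (simp add: indicator_def)
  qed
  also have "\<dots> = \<top> * emeasure std_normal ?A"
    by (rule nn_integral_cmult_indicator) measurable
  also have "\<dots> = \<top>" using c \<beta> by (simp add: std_normal.emeasure_eq_measure ennreal_top_mult)
  finally show ?thesis .
qed

text \<open>Space is cut into cells of side \<open>e\<close>, and one point of \<open>S\<close> is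
  kept from each of the finitely many cells that \<open>S\<close> meets. The net thus stays inside
  \<open>S\<close> and its points inherit the cone condition.\<close>

lemma finite_net:
  fixes S :: "(nat \<Rightarrow> real) set"
  assumes S: "\<And>w j. w \<in> S \<Longrightarrow> j < n \<Longrightarrow> \<bar>w j\<bar> \<le> 1" and e: "0 < e"
  obtains N where "finite N" "N \<subseteq> S" "\<And>w. w \<in> S \<Longrightarrow> \<exists>v\<in>N. \<forall>j<n. \<bar>w j - v j\<bar> \<le> e"
proof -
  define cell where "cell w = (\<lambda>j\<in>{..<n}. \<lfloor>w j / e\<rfloor>)" for w :: "nat \<Rightarrow> real"
  have "cell ` S \<subseteq> (\<Pi>\<^sub>E j\<in>{..<n}. {\<lfloor>-1 / e\<rfloor>..\<lfloor>1 / e\<rfloor>})"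
  proof (rule image_subsetI, rule PiE_I)
    fix w j assume w: "w \<in> S" and j: "j \<in> {..<n}"
    have "\<bar>w j\<bar> \<le> 1" using S[OF w] j by auto
    then have "-1 / e \<le> w j / e" "w j / e \<le> 1 / e" using e by (intro divide_right_mono; simp)+
    then show "cell w j \<in> {\<lfloor>-1 / e\<rfloor>..\<lfloor>1 / e\<rfloor>}" using j unfolding cell_def
      by (auto intro!: floor_mono)
  qed (auto simp: cell_def)
  then have fin: "finite (cell ` S)" by (rule finite_subset) (auto intro: finite_PiE)
  define N where "N = inv_into S cell ` (cell ` S)"
  have "finite N" using fin by (simp add: N_def)
  moreover have "N \<subseteq> S" unfolding N_def by (auto intro: inv_into_into)
  moreover have "\<exists>v\<in>N. \<forall>j<n. \<bar>w j - v j\<bar> \<le> e" if w: "w \<in> S" for w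
  proof (intro bexI allI impI)
    let ?v = "inv_into S cell (cell w)"
    show "?v \<in> N" using w by (auto simp: N_def)
    fix j assume j: "j < n"
    have "cell ?v = cell w" using w by (simp add: f_inv_into_f)
    then have "\<lfloor>?v j / e\<rfloor> = \<lfloor>w j / e\<rfloor>" using j by (auto simp: cell_def restrict_def fun_eq_iff split: if_splits)
    then have "\<bar>w j / e - ?v j / e\<bar> \<le> 1" by linarith
    then show "\<bar>w j - ?v j\<bar> \<le> e" using e by (simp add: diff_divide_distrib[symmetric] abs_divide divide_le_eq)
  qed
  ultimately show thesis by (rule that)
qed

text \<open>As the threshold grows the events decrease to the empty set, because \<open>J\<close> is
  finite.\<close>

lemma gauss_entries_bounded:
  fixes J :: "'i set"
  assumes J: "finite J" and e: "0 < (e :: real)"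
  obtains R where "0 < R" "measure gauss {\<xi>. \<exists>a\<in>J. R < \<bar>\<xi> a\<bar>} \<le> e"
proof -
  let ?B = "\<lambda>k. {\<xi> :: 'i \<Rightarrow> real. \<exists>a\<in>J. real k < \<bar>\<xi> a\<bar>}"
  have "(\<lambda>k. measure gauss (?B k)) \<longlonglongrightarrow> measure gauss (\<Inter>k. ?B k)"
  proof (rule gauss.finite_Lim_measure_decseq)
    have "?B k \<in> sets gauss" for k
      by (rule sets_gauss_CollectI) (use J in measurable)
    then show "range ?B \<subseteq> sets gauss" by blast
    show "decseq ?B" unfolding decseq_def by (auto intro: le_less_trans of_nat_mono)
  qed
  moreover have "(\<Inter>k. ?B k) = {}"
  proof -
    have "\<exists>k. \<xi> \<notin> ?B k" for \<xi>
    proof -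
      obtain k where "(\<Sum>a\<in>J. \<bar>\<xi> a\<bar>) \<le> real k" using real_arch_simple by blast
      moreover have "\<bar>\<xi> a\<bar> \<le> (\<Sum>a\<in>J. \<bar>\<xi> a\<bar>)" if "a \<in> J" for a
        using that J by (intro member_le_sum) auto
      ultimately show ?thesis by (intro exI[of _ k]) (auto simp: not_less intro: order_trans)
    qed
    then show ?thesis by blast
  qed
  ultimately have "(\<lambda>k. measure gauss (?B k)) \<longlonglongrightarrow> 0" by simp
  then have "\<forall>\<^sub>F k in sequentially. measure gauss (?B k) < e" using e by (rule order_tendstoD(2))
  then obtain k where k: "measure gauss (?B k) < e" "1 \<le> k"
    using eventually_happens'[OF _ eventually_conj[OF _ eventually_ge_at_top[of 1]]] by fastforce
  show thesis by (rule that[of "real k"]) (use k in auto)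
qed

section \<open>Strong recovery\<close>

lemma cone_abs_le_1:
  assumes "w \<in> error_cone q n k" "j < n"
  shows "\<bar>w j\<bar> \<le> 1"
proof -
  have "(w j)\<^sup>2 \<le> (\<Sum>j<n. (w j)\<^sup>2)" using assms by (intro member_le_sum) auto
  then show ?thesis using assms by (simp add: error_cone_def abs_square_le_1)
qed

text \<open>Each row of \<open>A v\<close> is at most \<open>e * R * n = 1 / (m + 1)\<close> in
  size, and \<open>m / (m + 1)\<^sup>2 \<le> 1\<close>.\<close>

lemma kernel_near_net:
  fixes R :: real
  assumes n: "0 < n" and R: "0 < R" and e: "e * (R * real n * (real m + 1)) = 1"
    and A: "\<And>i j. i < m \<Longrightarrow> j < n \<Longrightarrow> \<bar>A (i, j)\<bar> \<le> R"
    and ker: "\<And>i. i < m \<Longrightarrow> (\<Sum>j<n. w j * A (i, j)) = 0"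
    and near: "\<And>j. j < n \<Longrightarrow> \<bar>w j - v j\<bar> \<le> e"
  shows "(\<Sum>i<m. (\<Sum>j<n. v j * A (i, j))\<^sup>2) \<le> 1"
proof -
  have "\<bar>\<Sum>j<n. v j * A (i, j)\<bar> \<le> 1 / (real m + 1)" if i: "i < m" for i
  proof -
    have "(\<Sum>j<n. v j * A (i, j)) = - (\<Sum>j<n. (w j - v j) * A (i, j))"
      using ker[OF i] by (simp add: left_diff_distrib sum_subtractf)
    then have "\<bar>\<Sum>j<n. v j * A (i, j)\<bar> \<le> (\<Sum>j<n. \<bar>(w j - v j) * A (i, j)\<bar>)"
      using sum_abs[of "\<lambda>j. (w j - v j) * A (i, j)" "{..<n}"] by simp
    also have "\<dots> \<le> (\<Sum>j<n. e * R)"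
    proof (intro sum_mono)
      fix j assume "j \<in> {..<n}"
      then show "\<bar>(w j - v j) * A (i, j)\<bar> \<le> e * R"
        unfolding abs_mult using near[of j] A[OF i, of j] by (intro mult_mono) auto
    qed
    also have "\<dots> = 1 / (real m + 1)" using e by (simp add: field_simps)
    finally show ?thesis .
  qed
  then have "(\<Sum>j<n. v j * A (i, j))\<^sup>2 \<le> (1 / (real m + 1))\<^sup>2" if "i < m" for i
    using that abs_le_square_iff[of "\<Sum>j<n. v j * A (i, j)" "1 / (real m + 1)"] by simp
  then have "(\<Sum>i<m. (\<Sum>j<n. v j * A (i, j))\<^sup>2) \<le> (\<Sum>i<m. (1 / (real m + 1))\<^sup>2)"
    by (intro sum_mono) auto
  also have "\<dots> = real m / (real m + 1)\<^sup>2" by (simp add: power_divide)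
  also have "\<dots> \<le> 1"
  proof -
    have "real m \<le> (real m + 1)\<^sup>2" by (simp add: power2_eq_square algebra_simps)
    then show ?thesis by (simp add: divide_le_eq_1 add_pos_nonneg)
  qed
  finally show ?thesis .
qed

text \<open>\<open>E\<close> demands bounded entries and no short image of a net vector, an
  explicitly measurable part of the recovery event. \<open>d\<close> pays for large entries, and
  \<open>B\<close> is the bad event of the comparison process. The net may be arbitrarily fine,
  since the bound of \<open>escape_bound\<close> is independent of its size.\<close>

lemma gauss_matrix_recovery:
  assumes q: "0 \<le> q" "q \<le> 1" and n: "0 < n" and d: "0 < d"
    and B: "B \<in> sets gauss" and cover: "\<And>w \<xi>. w \<in> error_cone q n k \<Longrightarrow>
      sqrt (1 + (\<Sum>i<m. (\<xi> (i, n))\<^sup>2)) + (\<Sum>j<n. w j * \<xi> (m, j)) < 0 \<Longrightarrow> \<xi> \<in> B"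
  obtains E where "E \<in> sets (gauss_matrix m n)"
    "E \<subseteq> {A \<in> space (gauss_matrix m n). strong_recovery q m n k A}"
    "1 - measure gauss B / escape_const - d \<le> measure (gauss_matrix m n) E"
proof -
  let ?J = "{0..<m} \<times> {0..<n}"
  obtain R where R: "0 < R" and Rd: "measure gauss {\<xi>. \<exists>a\<in>?J. R < \<bar>\<xi> a\<bar>} \<le> d"
    using gauss_entries_bounded[of ?J d] d by auto
  define e where "e = 1 / (R * real n * (real m + 1))"
  have e: "0 < e" "e * (R * real n * (real m + 1)) = 1" using R n by (auto simp: e_def)
  obtain N where N: "finite N" "N \<subseteq> error_cone q n k" and net: "\<And>w. w \<in> error_cone q n k \<Longrightarrow> \<exists>v\<in>N. \<forall>j<n. \<bar>w j - v j\<bar> \<le> e"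
    using finite_net[of "error_cone q n k" n e] cone_abs_le_1 e(1) by metis
  let ?L = "{\<xi> :: nat \<times> nat \<Rightarrow> real. \<exists>a\<in>?J. R < \<bar>\<xi> a\<bar>}"
  let ?S = "{\<xi> :: nat \<times> nat \<Rightarrow> real. \<exists>w\<in>N. (\<Sum>i<m. (\<Sum>j<n. w j * \<xi> (i, j))\<^sup>2) \<le> 1}"
  have mL: "?L \<in> sets gauss" by (rule sets_gauss_CollectI) measurable
  have mS: "?S \<in> sets gauss" by (rule sets_gauss_CollectI) (use N in measurable)
  define E where "E = {A \<in> space (gauss_matrix m n). (\<forall>a\<in>?J. \<not> R < \<bar>A a\<bar>) \<and>
     (\<forall>w\<in>N. \<not> (\<Sum>i<m. (\<Sum>j<n. w j * A (i, j))\<^sup>2) \<le> 1)}"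
  have comp: "(\<lambda>A. A a) \<in> borel_measurable (gauss_matrix m n)" if "a \<in> ?J" for a
    using measurable_component_singleton[of a ?J "\<lambda>_. std_normal"] that
    by (simp add: gauss_matrix_def measurable_cong_sets[OF refl sets_std_normal])
  have E: "E \<in> sets (gauss_matrix m n)"
    unfolding E_def using N comp
    by (intro sets.sets_Collect_conj sets.sets_Collect_finite_All sets.sets_Collect_neg borel_measurable_le
        borel_measurable_less borel_measurable_sum borel_measurable_power borel_measurable_times borel_measurable_abs) auto
  have sub: "E \<subseteq> {A \<in> space (gauss_matrix m n). strong_recovery q m n k A}"
  proof safe
    fix A assume A: "A \<in> E"
    show "A \<in> space (gauss_matrix m n)" using A by (simp add: E_def)
    show "strong_recovery q m n k A"
    proof (rule ccontr)
      assume "\<not> strong_recovery q m n k A"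
      then obtain w where w: "w \<in> error_cone q n k" "\<And>i. i < m \<Longrightarrow> (\<Sum>j<n. w j * A (i, j)) = 0"
        using not_recovery_cone[OF q] by blast
      obtain v where v: "v \<in> N" "\<And>j. j < n \<Longrightarrow> \<bar>w j - v j\<bar> \<le> e" using net[OF w(1)] by blast
      have "(\<Sum>i<m. (\<Sum>j<n. v j * A (i, j))\<^sup>2) \<le> 1"
        by (rule kernel_near_net[OF n R e(2) _ w(2) v(2)]) (use A in \<open>auto simp: E_def not_less\<close>)
      then show False using A v(1) by (auto simp: E_def)
    qed
  qed
  have "measure (gauss_matrix m n) E = measure (distr gauss (gauss_matrix m n) (\<lambda>x. restrict x ?J)) E"
    using distr_gauss_restrict[of ?J] by (simp add: gauss_matrix_def)
  also have "\<dots> = measure gauss ((\<lambda>x. restrict x ?J) -` E \<inter> space gauss)"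
  proof (rule measure_distr[OF _ E])
    show "(\<lambda>x. restrict x ?J) \<in> measurable gauss (gauss_matrix m n)"
      unfolding gauss_matrix_def
      by (intro measurable_restrict) (simp add: measurable_cong_sets[OF refl sets_std_normal])
  qed
  also have "(\<lambda>x. restrict x ?J) -` E \<inter> space gauss = - (?L \<union> ?S)"
  proof -
    have r: "(\<Sum>i<m. (\<Sum>j<n. w j * restrict x ?J (i, j))\<^sup>2) = (\<Sum>i<m. (\<Sum>j<n. w j * x (i, j))\<^sup>2)"
      for w :: "nat \<Rightarrow> real" and x :: "nat \<times> nat \<Rightarrow> real"
      by (intro sum.cong refl arg_cong[where f="\<lambda>x. x\<^sup>2"]) auto
    have "restrict x ?J \<in> space (gauss_matrix m n)" for x :: "nat \<times> nat \<Rightarrow> real"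
      by (simp add: gauss_matrix_def space_PiM)
    then show ?thesis unfolding E_def by (auto simp: r simp del: restrict_apply) auto
  qed
  also have "measure gauss \<dots> = 1 - measure gauss (?L \<union> ?S)"
    using gauss.prob_compl[of "?L \<union> ?S"] mL mS by (simp add: Compl_eq_Diff_UNIV)
  finally have eq: "measure (gauss_matrix m n) E = 1 - measure gauss (?L \<union> ?S)" .
  have "measure gauss (?L \<union> ?S) \<le> measure gauss ?L + measure gauss ?S"
    by (rule measure_Un_le[OF mL mS])
  moreover have "measure gauss ?S \<le> measure gauss B / escape_const"
  proof -
    have "escape_const * measure gauss ?S
        \<le> measure gauss {\<xi>. \<exists>w\<in>N. sqrt (1 + (\<Sum>i<m. (\<xi> (i, n))\<^sup>2)) + (\<Sum>j<n. w j * \<xi> (m, j)) < 0}"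
      by (rule escape_bound[OF N(1)]) (use N(2) in \<open>auto simp: error_cone_def\<close>)
    also have "\<dots> \<le> measure gauss B"
      using cover N(2) B by (intro gauss.finite_measure_mono) auto
    finally show ?thesis using escape_const_pos by (simp add: field_simps)
  qed
  ultimately have "1 - measure gauss B / escape_const - d \<le> measure (gauss_matrix m n) E"
    using Rd eq by linarith
  with E sub show thesis by (rule that)
qed

theorem theorem5:
  fixes q \<alpha> \<beta> :: real
  assumes "0 \<le> q" "q \<le> 1"
    and "0 < \<alpha>" "\<alpha> \<le> 1"
    and "0 < \<beta>" "\<beta> < 1"
    and "(INF p\<in>{p::real\<times>real. 0 \<le> fst p \<and> 0 \<le> snd p}.
            I1_str q \<beta> (fst p) (snd p) + I2_str q \<beta> (fst p) (snd p) + ennreal (snd p))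
          < ennreal (sqrt \<alpha>)"
  shows "\<exists>c>0. \<forall>\<^sub>F n in sequentially.
           (let m = nat (round (\<alpha> * real n)); k = nat (round (\<beta> * real n)) in
            \<exists>E\<in>sets (gauss_matrix m n).
              E \<subseteq> {A \<in> space (gauss_matrix m n). strong_recovery q m n k A} \<and>
              measure (gauss_matrix m n) E \<ge> 1 - exp (- c * real n))"
proof -
  note q = assms(1,2) and \<alpha> = assms(3,4) and \<beta> = assms(5,6)
  obtain \<nu> \<gamma> where nu: "0 \<le> \<nu>" and ga0: "0 \<le> \<gamma>"
    and less: "I1_str q \<beta> \<nu> \<gamma> + I2_str q \<beta> \<nu> \<gamma> + ennreal \<gamma> < ennreal (sqrt \<alpha>)"
    using assms(7) unfolding INF_less_iff by auto
  have "\<gamma> \<noteq> 0" using less I1_str_zero_gamma[OF \<beta> nu, of q] by auto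
  then interpret inner_max q \<nu> \<gamma>
    using q nu ga0 by unfold_locales auto
  define c where "c = c_nu \<beta>"
  define \<mu> where "\<mu> = (\<integral>h. excess c h \<partial>std_normal)"
  have \<mu>: "0 \<le> \<mu>" unfolding \<mu>_def using excess_bounds(1) by (intro integral_nonneg_AE) auto
  have "ennreal (\<mu> + gap c * \<beta> + \<gamma>) \<le> I1_str q \<beta> \<nu> \<gamma> + I2_str q \<beta> \<nu> \<gamma> + ennreal \<gamma>"
    using excess_mean[OF \<beta>] \<mu> gap_nonneg[of c] \<beta> ga by (simp add: c_def \<mu>_def add_right_mono)
  also note less
  finally have \<tau>: "\<mu> + gap c * \<beta> + \<gamma> < sqrt \<alpha>"
    using \<mu> gap_nonneg[of c] \<beta> ga by (subst (asm) ennreal_less_iff) auto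
  \<comment> \<open>A third of the slack: one \<open>\<delta>\<close> absorbs the Chernoff
    deviation, one the rounding of \<open>k\<close>, and the last keeps \<open>\<theta>\<close>
    below \<open>sqrt \<alpha>\<close>.\<close>
  define \<delta> where "\<delta> = (sqrt \<alpha> - (\<mu> + gap c * \<beta> + \<gamma>)) / 3"
  define \<theta> where "\<theta> = \<mu> + gap c * \<beta> + \<gamma> + 2 * \<delta>"
  have \<delta>: "0 < \<delta>" using \<tau> by (simp add: \<delta>_def)
  have \<theta>: "0 \<le> \<theta>" "\<theta> < sqrt \<alpha>"
  proof -
    show "0 \<le> \<theta>" using \<delta> \<mu> gap_nonneg[of c] \<beta> ga unfolding \<theta>_def by (auto intro!: add_nonneg_nonneg)
    have "\<mu> + gap c * \<beta> + \<gamma> + 3 * \<delta> = sqrt \<alpha>" unfolding \<delta>_def by (simp add: field_simps)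
    then show "\<theta> < sqrt \<alpha>" using \<delta> unfolding \<theta>_def by linarith
  qed
  have \<theta>2: "\<theta>\<^sup>2 < \<alpha>" using \<theta> \<alpha> power_strict_mono[of \<theta> "sqrt \<alpha>" 2] by simp
  \<comment> \<open>The midpoint of \<open>\<theta>\<^sup>2 / \<alpha>\<close> and 1 leaves room on
    both sides: below the mean 1 of a squared entry, and above what the final contradiction
    requires.\<close>
  define a where "a = (\<theta>\<^sup>2 / \<alpha> + 1) / 2"
  have a: "\<theta>\<^sup>2 < a * \<alpha>" "a < 1" "0 < a" using \<theta>2 \<alpha> by (auto simp: a_def field_simps add_pos_nonneg)
  obtain l where l: "0 < l" "integrable std_normal (\<lambda>x. exp (l * \<bar>excess c x\<bar>))"
    using integrable_exp_excess by blast
  have "(\<integral>x. excess c x \<partial>std_normal) < \<mu> + \<delta>" using \<delta> by (simp add: \<mu>_def)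
  then obtain c1 where c1: "0 < c1" and ch1: "\<And>J :: (nat \<times> nat) set. finite J \<Longrightarrow>
    measure gauss {\<xi>. (\<mu> + \<delta>) * real (card J) \<le> (\<Sum>i\<in>J. excess c (\<xi> i))} \<le> exp (- c1 * real (card J))"
    using chernoff_gauss[OF excess_measurable l, where 'i="nat \<times> nat"] by blast
  \<comment> \<open>The lower tail of the squares is treated as the upper tail of their
    negatives.\<close>
  have "(\<integral>x. - (x\<^sup>2) \<partial>std_normal) < - a" using a std_normal_moments by simp
  moreover have "integrable std_normal (\<lambda>x. exp (1 / 4 * \<bar>- (x\<^sup>2)\<bar>))" using integrable_exp_quarter_sq by simp
  ultimately obtain c2 where c2: "0 < c2" and ch2: "\<And>J :: (nat \<times> nat) set. finite J \<Longrightarrow>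
    measure gauss {\<xi>. - a * real (card J) \<le> (\<Sum>i\<in>J. - ((\<xi> i)\<^sup>2))} \<le> exp (- c2 * real (card J))"
    using chernoff_gauss[of "\<lambda>x. - (x\<^sup>2)" "1/4" "- a", where 'i="nat \<times> nat"] by auto
  \<comment> \<open>\<open>c2\<close> is a rate per row, and eventually there are at least
    \<open>\<alpha> / 2 * n\<close> rows.\<close>
  define c3 where "c3 = min 1 (min c1 (c2 * (\<alpha> / 2)))"
  have c3: "0 < c3" using c1 c2 \<alpha> by (simp add: c3_def)
  \<comment> \<open>Two Chernoff terms divided by \<open>escape_const\<close>, and one term for
    large entries.\<close>
  define P where "P = 2 / escape_const + 1"
  have P: "0 < P" using escape_const_pos by (simp add: P_def add_pos_pos)
  have lim: "filterlim real at_top sequentially" by (rule filterlim_real_sequentially)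
  have large: "\<forall>\<^sub>F n in sequentially. b \<le> x * real n" if "0 < x" for x b :: real
  proof -
    have "\<forall>\<^sub>F n in sequentially. b / x \<le> real n" using lim by (simp add: filterlim_at_top)
    then show ?thesis by eventually_elim (use that in \<open>simp add: field_simps\<close>)
  qed
  \<comment> \<open>Largeness of \<open>n\<close> serves, in turn, the rounding of \<open>k\<close>,
    the rounding of \<open>m\<close> in the contradiction, the lower bound
    \<open>\<alpha> / 2 * n\<close> for \<open>m\<close>, and the absorption of
    \<open>P\<close>.\<close>
  have "0 < a * \<alpha> - \<theta>\<^sup>2" "0 < \<alpha> / 2" "0 < c3 / 2" using a \<alpha> c3 by auto
  from eventually_gt_at_top[of 0] large[OF \<delta>, of "gap c"] large[OF this(1), of a] large[OF this(2), of 1]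
    large[OF this(3), of "ln P"]
  have "\<forall>\<^sub>F n in sequentially.
           (let m = nat (round (\<alpha> * real n)); k = nat (round (\<beta> * real n)) in
            \<exists>E\<in>sets (gauss_matrix m n).
              E \<subseteq> {A \<in> space (gauss_matrix m n). strong_recovery q m n k A} \<and>
              measure (gauss_matrix m n) E \<ge> 1 - exp (- (c3 / 2) * real n))"
  proof eventually_elim
    case (elim n)
    define m where "m = nat (round (\<alpha> * real n))"
    define k where "k = nat (round (\<beta> * real n))"
    have n: "0 < n" using elim by simp
    have rnd: "\<bar>real (nat (round x)) - x\<bar> \<le> 1 / 2" if "0 \<le> x" for x :: real
    proof -
      have "0 \<le> round x" using round_mono[OF that] by simp
      then show ?thesis using of_int_round_abs_le[of x] by simp
    qed
    have "\<bar>real m - \<alpha> * real n\<bar> \<le> 1 / 2" "\<bar>real k - \<beta> * real n\<bar> \<le> 1 / 2"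
      unfolding m_def k_def using \<alpha> \<beta> by (intro rnd, simp)+
    then have m: "\<alpha> * real n - 1 / 2 \<le> real m" and k: "real k \<le> \<beta> * real n + 1 / 2"
      by linarith+
    let ?J1 = "{m} \<times> {..<n}" and ?J2 = "{..<m} \<times> {n}"
    let ?B1 = "{\<xi> :: nat \<times> nat \<Rightarrow> real. (\<mu> + \<delta>) * real (card ?J1) \<le> (\<Sum>i\<in>?J1. excess c (\<xi> i))}"
    let ?B2 = "{\<xi> :: nat \<times> nat \<Rightarrow> real. - a * real (card ?J2) \<le> (\<Sum>i\<in>?J2. - ((\<xi> i)\<^sup>2))}"
    have s1: "(\<Sum>i\<in>?J1. f i) = (\<Sum>j<n. f (m, j))" and s2: "(\<Sum>i\<in>?J2. f i) = (\<Sum>i<m. f (i, n))" for f :: "nat \<times> nat \<Rightarrow> real"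
      by (simp_all add: sum.cartesian_product')
    have "?B1 \<in> sets gauss" by (rule sets_gauss_CollectI) measurable
    moreover have "?B2 \<in> sets gauss" by (rule sets_gauss_CollectI) measurable
    ultimately have mB: "?B1 \<in> sets gauss" "?B2 \<in> sets gauss" .
    \<comment> \<open>Outside \<open>?B1\<close> the inner products with cone vectors are at most
      \<open>\<theta> * sqrt n\<close> in size; outside \<open>?B2\<close> the last column has
      larger norm than that, so the sum cannot be negative.\<close>
    have cover: "\<xi> \<in> ?B1 \<union> ?B2" if w: "w \<in> error_cone q n k"
      and neg: "sqrt (1 + (\<Sum>i<m. (\<xi> (i, n))\<^sup>2)) + (\<Sum>j<n. w j * \<xi> (m, j)) < 0" for w \<xi>
    proof (rule ccontr)
      assume "\<xi> \<notin> ?B1 \<union> ?B2"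
      then have b1: "(\<Sum>j<n. excess c (\<xi> (m, j))) < (\<mu> + \<delta>) * real n"
        and b2: "a * real m < (\<Sum>i<m. (\<xi> (i, n))\<^sup>2)"
        by (auto simp: s1 s2 not_le sum_negf)
      have "real k * gap c \<le> (\<beta> * real n + 1 / 2) * gap c" using k gap_nonneg by (intro mult_right_mono) auto
      also have "\<dots> \<le> (\<beta> * gap c + \<delta>) * real n" using elim(2) gap_nonneg[of c] by (simp add: algebra_simps)
      finally have kg: "real k * gap c \<le> (\<beta> * gap c + \<delta>) * real n" .
      define T where "T = (\<Sum>i<m. (\<xi> (i, n))\<^sup>2)"
      define I where "I = \<bar>\<Sum>j<n. w j * \<xi> (m, j)\<bar>"
      have "sqrt (real n) * I \<le> (\<Sum>j<n. excess c (\<xi> (m, j))) + real k * gap c + \<gamma> * real n"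
        unfolding I_def by (rule cone_inner_bound[OF w])
      also have "\<dots> \<le> \<theta> * real n" using b1 kg by (simp add: \<theta>_def algebra_simps)
      finally have I: "sqrt (real n) * I \<le> \<theta> * real n" .
      have T0: "0 \<le> T" unfolding T_def by (intro sum_nonneg) auto
      have "sqrt (1 + T) < I" using neg unfolding T_def I_def by linarith
      then have "(sqrt (1 + T))\<^sup>2 \<le> I\<^sup>2" by (intro power_mono) (use T0 in auto)
      then have "T \<le> I\<^sup>2" using T0 by simp
      then have "real n * T \<le> (sqrt (real n) * I)\<^sup>2" by (simp add: power_mult_distrib mult_left_mono)
      also have "\<dots> \<le> (\<theta> * real n)\<^sup>2" using I by (intro power_mono) (auto simp: I_def)
      also have "\<dots> = real n * (\<theta>\<^sup>2 * real n)" by (simp add: power2_eq_square)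
      finally have "T \<le> \<theta>\<^sup>2 * real n" using n by simp
      also have "\<dots> \<le> a * \<alpha> * real n - a" using elim(3) by (simp add: algebra_simps)
      also have "\<dots> \<le> a * (\<alpha> * real n - 1 / 2)" using a by (simp add: algebra_simps)
      also have "\<dots> \<le> a * real m" using m a by (intro mult_left_mono) auto
      finally show False using b2 unfolding T_def by simp
    qed
    obtain E where E: "E \<in> sets (gauss_matrix m n)"
      "E \<subseteq> {A \<in> space (gauss_matrix m n). strong_recovery q m n k A}"
      "1 - measure gauss (?B1 \<union> ?B2) / escape_const - exp (- c3 * real n) \<le> measure (gauss_matrix m n) E"
      by (rule gauss_matrix_recovery[OF q n _ sets.Un[OF mB], of "exp (- c3 * real n)" k m])
        (simp, rule cover, assumption+)
    have "measure gauss (?B1 \<union> ?B2) \<le> measure gauss ?B1 + measure gauss ?B2"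
      by (rule measure_Un_le[OF mB])
    also have "\<dots> \<le> exp (- c1 * real (card ?J1)) + exp (- c2 * real (card ?J2))"
      by (intro add_mono ch1 ch2) auto
    also have "\<dots> \<le> exp (- c3 * real n) + exp (- c3 * real n)"
    proof (intro add_mono)
      have "c3 * real n \<le> c1 * real n" by (intro mult_right_mono) (auto simp: c3_def)
      then show "exp (- c1 * real (card ?J1)) \<le> exp (- c3 * real n)" by simp
      have "c3 * real n \<le> c2 * (\<alpha> / 2) * real n" by (intro mult_right_mono) (auto simp: c3_def)
      also have "\<dots> = c2 * (\<alpha> / 2 * real n)" by simp
      also have "\<dots> \<le> c2 * real m" using m elim(4) c2 by (intro mult_left_mono) auto
      finally show "exp (- c2 * real (card ?J2)) \<le> exp (- c3 * real n)" by simp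
    qed
    finally have "measure gauss (?B1 \<union> ?B2) / escape_const \<le> 2 * exp (- c3 * real n) / escape_const"
      using escape_const_pos by (intro divide_right_mono) auto
    then have "1 - P * exp (- c3 * real n) \<le> measure (gauss_matrix m n) E"
      using E(3) by (simp add: P_def algebra_simps)
    \<comment> \<open>Half of the rate is given up to absorb the constant \<open>P\<close>.\<close>
    moreover have "P * exp (- c3 * real n) \<le> exp (- (c3 / 2) * real n)"
    proof -
      have "P = exp (ln P)" using P by simp
      also have "\<dots> \<le> exp (c3 / 2 * real n)" using elim(5) by simp
      finally have "P * exp (- c3 * real n) \<le> exp (c3 / 2 * real n) * exp (- c3 * real n)"
        by (intro mult_right_mono) auto
      then show ?thesis by (simp add: exp_add[symmetric])
    qed
    ultimately have "1 - exp (- (c3 / 2) * real n) \<le> measure (gauss_matrix m n) E" by linarith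
    with E show ?case unfolding m_def k_def Let_def by auto
  qed
  then show ?thesis using c3 by (intro exI[of _ "c3 / 2"]) auto
qed

end
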